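(* Suppose $n+1+\alpha=-N$ for some positive integer $N$, and let $$(z-1)^N\log\frac1{1-z}=\sum_{k=0}^\infty A_kz^k$$ be the Taylor expansion in the unit disk $\{z\in\mathbb C:|z|<1\}$. Then for any polynomial $$Q(z,w)=\sum_{|m|\le N}\omega_mz^m\overline w^m$$ with (real) coefficients having the property that $$\omega_m>-\frac{|m|!\,A_{|m|}}{m!}\qquad\text{for all }|m|\le N,$$ we can equip $A^2_\alpha$ with an inner product such that the associated reproducing kernel is $$K_\alpha(z,w)=Q(z,w)+(\langle z,w\rangle-1)^N\log\frac1{1-\langle z,w\rangle}.$$
   Context: Fix a positive integer $n$. $\mathbb B_n$ is the open unit ball of $\mathbb C^n$, $\langle z,w\rangle=\sum_j z_j\overline{w_j}$, $dv$ is volume measure, and $dv_\alpha(z)=(1-|z|^2)^\alpha dv(z)$ for real $\alpha\le-1$. $m=(m_1,\dots,m_n)$ denotes a multi-index of nonnegative integers, $|m|=m_1+\cdots+m_n$, $m!=m_1!\cdots m_n!$, $z^m=z_1^{m_1}\cdots z_n^{m_n}$. The radial derivative is $Rf(z)=\sum_{k=1}^n z_k\frac{\partial f}{\partial z_k}(z)$ and $R^k$ is its $k$-fold iterate. $A^2_\alpha$ is the space of holomorphic $f$ in $\mathbb B_n$ such that, for a nonnegative integer $k$ with $2k+\alpha>-1$, $(1-|z|^2)^kR^kf(z)\in L^2(\mathbb B_n,dv_\alpha)$ (independent of the choice of such $k$). Saying an inner product has reproducing kernel $K_\alpha$ means that $A^2_\alpha$ is a Hilbert space under it and, for every $w\in\mathbb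 B_n$, $K_\alpha(\cdot,w)\in A^2_\alpha$ and $f(w)=\langle f,K_\alpha(\cdot,w)\rangle$ for all $f\in A^2_\alpha$. The logarithm is the principal branch. *)

theory Defs
  imports "HOL-Analysis.Analysis"
begin

definition unit_ball :: "(complex ^ 'n) set" where
  "unit_ball = ball 0 1"

definition hinner :: "complex ^ 'n \<Rightarrow> complex ^ 'n \<Rightarrow> complex" where
  "hinner z w = (\<Sum>j\<in>UNIV. z $ j * cnj (w $ j))"


subsection \<open>Multi-indices\<close>

type_synonym 'n multi_index = "'n \<Rightarrow> nat"

definition mi_deg :: "('n::finite) multi_index \<Rightarrow> nat" where
  "mi_deg m = (\<Sum>i\<in>UNIV. m i)"

definition mi_fact :: "('n::finite) multi_index \<Rightarrow> real" where
  "mi_fact m = (\<Prod>i\<in>UNIV. fact (m i))"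

definition mi_power :: "complex ^ 'n \<Rightarrow> 'n multi_index \<Rightarrow> complex" where
  "mi_power z m = (\<Prod>i\<in>UNIV. (z $ i) ^ m i)"

definition cnj_vec :: "complex ^ 'n \<Rightarrow> complex ^ 'n" where
  "cnj_vec w = (\<chi> i. cnj (w $ i))"


subsection \<open>Holomorphic functions of several variables\<close>

text \<open>On an open set: real Frechet differentiable with complex-linear derivative.\<close>

definition holo_on :: "(complex ^ 'n) set \<Rightarrow> (complex ^ 'n \<Rightarrow> complex) \<Rightarrow> bool" where
  "holo_on S f \<longleftrightarrow>
     (\<forall>z\<in>S. \<exists>D. (f has_derivative D) (at z) \<and> (\<forall>c v. D (c *s v) = c * D v))"

definition partial_deriv ::
    "'n \<Rightarrow> (complex ^ 'n \<Rightarrow> complex) \<Rightarrow> complex ^ 'n \<Rightarrow> complex" where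
  "partial_deriv k f z = deriv (\<lambda>\<zeta>. f (\<chi> i. if i = k then \<zeta> else z $ i)) (z $ k)"

definition radial_deriv ::
    "(complex ^ 'n \<Rightarrow> complex) \<Rightarrow> complex ^ 'n \<Rightarrow> complex" where
  "radial_deriv f z = (\<Sum>k\<in>UNIV. z $ k * partial_deriv k f z)"


subsection \<open>The spaces $A^2_\alpha$\<close>

definition dv_measure :: "real \<Rightarrow> (complex ^ 'n) measure" where
  "dv_measure \<alpha> = density (restrict_space lborel unit_ball)
      (\<lambda>z. ennreal ((1 - (norm z)\<^sup>2) powr \<alpha>))"

definition square_integrable :: "'a measure \<Rightarrow> ('a \<Rightarrow> complex) \<Rightarrow> bool" where
  "square_integrable M g \<longleftrightarrow>
     g \<in> borel_measurable M \<and> integrable M (\<lambda>x. (norm (g x))\<^sup>2)"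

text \<open>A function on the ball is represented by its extension by zero to the whole space, so
  that two elements of \<open>A2 \<alpha>\<close> are equal iff they agree on the ball.\<close>

definition zero_ext :: "(complex ^ 'n \<Rightarrow> complex) \<Rightarrow> complex ^ 'n \<Rightarrow> complex" where
  "zero_ext f = (\<lambda>z. if z \<in> unit_ball then f z else 0)"

definition A2 :: "real \<Rightarrow> (complex ^ 'n \<Rightarrow> complex) set" where
  "A2 \<alpha> = {f. zero_ext f = f \<and> holo_on unit_ball f \<and>
     (\<exists>k::nat. 2 * real k + \<alpha> > -1 \<and>
        square_integrable (dv_measure \<alpha>)
          (\<lambda>z. complex_of_real ((1 - (norm z)\<^sup>2) ^ k) * (radial_deriv ^^ k) f z))}"


subsection \<open>Hilbert spaces of functions and reproducing kernels\<close>

definition function_subspace :: "('a \<Rightarrow> complex) set \<Rightarrow> bool" where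
  "function_subspace V \<longleftrightarrow> (\<lambda>x. 0) \<in> V \<and>
     (\<forall>f\<in>V. \<forall>g\<in>V. (\<lambda>x. f x + g x) \<in> V) \<and> (\<forall>c. \<forall>f\<in>V. (\<lambda>x. c * f x) \<in> V)"

definition inner_product_on ::
    "('a \<Rightarrow> complex) set \<Rightarrow> (('a \<Rightarrow> complex) \<Rightarrow> ('a \<Rightarrow> complex) \<Rightarrow> complex) \<Rightarrow> bool" where
  "inner_product_on V ip \<longleftrightarrow>
     (\<forall>f\<in>V. \<forall>g\<in>V. \<forall>h\<in>V. ip (\<lambda>x. f x + g x) h = ip f h + ip g h) \<and>
     (\<forall>c. \<forall>f\<in>V. \<forall>g\<in>V. ip (\<lambda>x. c * f x) g = c * ip f g) \<and>
     (\<forall>f\<in>V. \<forall>g\<in>V. ip g f = cnj (ip f g)) \<and>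
     (\<forall>f\<in>V. ip f f \<in> \<real> \<and> Re (ip f f) \<ge> 0) \<and>
     (\<forall>f\<in>V. ip f f = 0 \<longrightarrow> f = (\<lambda>x. 0))"

definition ip_dist ::
    "(('a \<Rightarrow> complex) \<Rightarrow> ('a \<Rightarrow> complex) \<Rightarrow> complex) \<Rightarrow> ('a \<Rightarrow> complex) \<Rightarrow> ('a \<Rightarrow> complex) \<Rightarrow> real" where
  "ip_dist ip f g = sqrt (Re (ip (\<lambda>x. f x - g x) (\<lambda>x. f x - g x)))"

text \<open>\<open>Metric_space\<close> requires its axioms of the distance at all points of the type, not only at
  those of the carrier, hence the distance is set to \<open>0\<close> outside \<open>V\<close>.\<close>

definition hilbert_space_on ::
    "('a \<Rightarrow> complex) set \<Rightarrow> (('a \<Rightarrow> complex) \<Rightarrow> ('a \<Rightarrow> complex) \<Rightarrow> complex) \<Rightarrow> bool" where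
  "hilbert_space_on V ip \<longleftrightarrow> function_subspace V \<and> inner_product_on V ip \<and>
     Metric_space.mcomplete V (\<lambda>f g. if f \<in> V \<and> g \<in> V then ip_dist ip f g else 0)"

definition has_reproducing_kernel ::
    "(complex ^ 'n \<Rightarrow> complex) set \<Rightarrow>
     ((complex ^ 'n \<Rightarrow> complex) \<Rightarrow> (complex ^ 'n \<Rightarrow> complex) \<Rightarrow> complex) \<Rightarrow>
     (complex ^ 'n \<Rightarrow> complex ^ 'n \<Rightarrow> complex) \<Rightarrow> bool" where
  "has_reproducing_kernel V ip K \<longleftrightarrow> hilbert_space_on V ip \<and>
     (\<forall>w\<in>unit_ball. zero_ext (\<lambda>z. K z w) \<in> V \<and>
        (\<forall>f\<in>V. f w = ip f (zero_ext (\<lambda>z. K z w))))"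


subsection \<open>The kernel\<close>

definition Q_poly ::
    "nat \<Rightarrow> (('n::finite) multi_index \<Rightarrow> real) \<Rightarrow> complex ^ 'n \<Rightarrow> complex ^ 'n \<Rightarrow> complex" where
  "Q_poly N \<omega> z w =
     (\<Sum>m | mi_deg m \<le> N. complex_of_real (\<omega> m) * mi_power z m * mi_power (cnj_vec w) m)"

definition log_fun :: "nat \<Rightarrow> complex \<Rightarrow> complex" where
  "log_fun N z = (z - 1) ^ N * Ln (1 / (1 - z))"

definition K_ker ::
    "nat \<Rightarrow> (('n::finite) multi_index \<Rightarrow> real) \<Rightarrow> complex ^ 'n \<Rightarrow> complex ^ 'n \<Rightarrow> complex" where
  "K_ker N \<omega> z w = Q_poly N \<omega> z w + log_fun N (hinner z w)"

text \<open>The Taylor coefficients of \<open>log_fun N\<close> at the origin are real.\<close>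

lemma log_fun_real_taylor:
  "\<exists>A::nat \<Rightarrow> real. \<forall>z. norm z < 1 \<longrightarrow> (\<lambda>k. complex_of_real (A k) * z ^ k) sums log_fun N z"
proof (induction N)
  case 0
  have "(\<lambda>k. complex_of_real (1 / real k) * z ^ k) sums log_fun 0 z" if z: "norm z < 1" for z
  proof -
    have "Re (1 - z) > 0"
      using z complex_Re_le_cmod[of z] by simp
    then have "1 - z \<notin> \<real>\<^sub>\<le>\<^sub>0"
      by (auto simp: complex_nonpos_Reals_iff)
    then have eq: "log_fun 0 z = - Ln (1 - z)"
      using Ln_inverse[of "1 - z"] by (simp add: log_fun_def inverse_eq_divide)
    have "(\<lambda>n. - ((- (- z)) ^ n) / of_nat n) sums ln (1 + - z)"
      using z by (intro Ln_series') simp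
    from sums_minus[OF this] show ?thesis
      by (simp add: eq)
  qed
  then show ?case by (intro exI[of _ "\<lambda>k. 1 / real k"] allI impI)
next
  case (Suc N)
  then obtain A :: "nat \<Rightarrow> real" where
    A: "\<And>z. norm z < 1 \<Longrightarrow> (\<lambda>k. complex_of_real (A k) * z ^ k) sums log_fun N z"
    by blast
  define B where "B = (\<lambda>k. (if k = 0 then 0 else A (k - 1)) - A k)"
  have "(\<lambda>k. complex_of_real (B k) * z ^ k) sums log_fun (Suc N) z" if z: "norm z < 1" for z
  proof -
    have "(\<lambda>k. z * (complex_of_real (A k) * z ^ k)) sums (z * log_fun N z)"
      by (intro sums_mult A z)
    then have "(\<lambda>k. complex_of_real (if Suc k = 0 then 0 else A (Suc k - 1)) * z ^ Suc k)
        sums (z * log_fun N z)"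
      by (simp add: mult_ac)
    then have "(\<lambda>k. complex_of_real (if k = 0 then 0 else A (k - 1)) * z ^ k)
        sums (z * log_fun N z)"
      by (subst (asm) sums_Suc_iff) simp
    from sums_diff[OF this A[OF z]] show ?thesis
      by (simp add: B_def log_fun_def algebra_simps)
  qed
  then show ?case by (intro exI[of _ B] allI impI)
qed

end

theory Submission
  imports Defs "HOL-Complex_Analysis.Complex_Analysis"
begin

text \<open>
  On the unit ball every holomorphic function is a power series \<open>\<Sum>\<^sub>m a\<^sub>m z\<^sup>m\<close>, grouped into
  homogeneous parts, and the radial derivative multiplies the part of degree \<open>d\<close> by \<open>d\<close>.  The
  space \<open>A2 \<alpha>\<close> is therefore a weighted sequence space, and the point is that its weights are, up
  to bounded factors, the reciprocals of the Taylor coefficients of the kernel.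

  For \<open>k\<close> as in the definition of \<open>A2 \<alpha>\<close>, the function \<open>(1 - \<bar>z\<bar>\<^sup>2)\<^sup>k R\<^sup>k f\<close> is square integrable
  for \<open>dv\<^sub>\<alpha>\<close> iff \<open>R\<^sup>k f\<close> is so for the weight \<open>(1 - \<bar>z\<bar>\<^sup>2)\<^sup>\<beta>\<close> with \<open>\<beta> = 2 k + \<alpha>\<close>; as
  \<open>\<alpha> = - (n + 1 + N)\<close>, the number \<open>\<beta>\<close> is a natural number.  Monomials are orthogonal for this weight
  because it is invariant under rotation of each coordinate, and the squared norm of \<open>z\<^sup>m\<close> is
  \<open>\<pi>\<^sup>n m! \<beta>! / (\<bar>m\<bar> + n + \<beta>)!\<close>.  This value comes from the Gaussian integral of \<open>\<bar>z\<^sup>m\<bar>\<^sup>2\<close>, which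
  factors into one-dimensional integrals, together with the homogeneity of \<open>\<bar>z\<^sup>m\<bar>\<^sup>2\<close>, which reduces
  both the Gaussian and the weighted integral to the same radial density.  Hence \<open>f\<close> lies in
  \<open>A2 \<alpha>\<close> iff \<open>\<Sum>\<^sub>m \<bar>m\<bar>\<^sup>2\<^sup>k m! / (\<bar>m\<bar> + n + \<beta>)! \<bar>a\<^sub>m\<bar>\<^sup>2\<close> converges.

  The kernel is \<open>\<Sum>\<^sub>m c\<^sub>m z\<^sup>m w'\<^sup>m\<close>, where \<open>w'\<close> is the conjugate of \<open>w\<close> and
  \<open>c\<^sub>m = \<bar>m\<bar>! A\<^sub>\<bar>\<^sub>m\<^sub>\<bar> / m!\<close>, increased by \<open>\<omega>\<^sub>m\<close> if \<open>\<bar>m\<bar> \<le> N\<close>.  For degrees \<open>d\<close> above \<open>N\<close> the Taylor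
  coefficient is \<open>A\<^sub>d = N! (d - N - 1)! / d!\<close>, so that \<open>1 / c\<^sub>m = m! / (N! (\<bar>m\<bar> - N - 1)!)\<close>.  The
  quotient of this number and the weight above is, up to a constant, the ratio of a \<open>2 k\<close>-th power of \<open>\<bar>m\<bar>\<close> and a
  product of \<open>2 k\<close> factors comparable to \<open>\<bar>m\<bar>\<close>, and thus bounded from above and below.  For the finitely
  many \<open>m\<close> of degree at most \<open>N\<close> the hypothesis on \<open>\<omega>\<close> says exactly that \<open>c\<^sub>m\<close> is positive.  So
  \<open>A2 \<alpha>\<close> is the space of all \<open>f\<close> with \<open>\<Sum>\<^sub>m \<bar>a\<^sub>m\<bar>\<^sup>2 / c\<^sub>m < \<infinity>\<close>, the image of the sequence space
  \<open>\<ell>\<^sup>2\<close> under \<open>u \<mapsto> \<Sum>\<^sub>m sqrt c\<^sub>m u\<^sub>m z\<^sup>m\<close>.  Transporting the inner product of \<open>\<ell>\<^sup>2\<close>, evaluation at \<open>w\<close>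
  becomes the pairing with \<open>sqrt c\<^sub>m w'\<^sup>m\<close>, and the image of that sequence is the kernel.

  The lemmas that carry the proof are \<open>nn_integral_ball_mi_power\<close> (norms of monomials),
  \<open>holo_on_ball_expansion\<close> and \<open>radial_deriv_funpow_pseries\<close> (power series on the ball),
  \<open>pseries_square_integral_finite_iff\<close> (Parseval), \<open>bergman_norm_comparable\<close> and
  \<open>A2_eq_weighted_pseries\<close> (the description of the space), and \<open>hilbert_space_on_ell2_image\<close>.
\<close>

(* The dollar sign denotes components of vectors throughout. *)
unbundle no fps_syntax

section \<open>Lebesgue measure on complex n-space\<close>

text \<open>
  Transfers rotation invariance from \<open>real ^ 2\<close>, where orthogonal maps preserve Lebesgue measure, to
  the complex plane.
\<close>

lemma lborel_complex_eq_distr_real2: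
  "lborel = distr lborel borel (\<lambda>x::real^2. Complex (x $ 1) (x $ 2))"
proof (rule lborel_eqI)
  fix l u :: complex
  assume le: "\<And>b. b \<in> Basis \<Longrightarrow> l \<bullet> b \<le> u \<bullet> b"
  have le': "Re l \<le> Re u" "Im l \<le> Im u"
    using le[of 1] le[of \<i>] by (auto simp: Basis_complex_def inner_complex_def)
  have m: "(\<lambda>x::real^2. Complex (x $ 1) (x $ 2)) \<in> borel_measurable borel"
    by (intro borel_measurable_continuous_onI) (auto simp: Complex_eq intro!: continuous_intros)
  have vi: "(\<lambda>x::real^2. Complex (x $ 1) (x $ 2)) -` box l u
      = box (vector [Re l, Im l]) (vector [Re u, Im u])"
    by (auto simp: mem_box_cart in_box_complex_iff forall_2)
  have "emeasure (distr lborel borel (\<lambda>x::real^2. Complex (x $ 1) (x $ 2))) (box l u)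
     = emeasure lborel (box (vector [Re l, Im l]) (vector [Re u, Im u]) :: (real^2) set)"
    using m by (simp add: emeasure_distr vi)
  also have "\<dots> = (\<Prod>b\<in>Basis. (vector [Re u, Im u] - vector [Re l, Im l] :: real^2) \<bullet> b)"
  proof (rule emeasure_lborel_box)
    fix b :: "real^2" assume "b \<in> Basis"
    then obtain i where b: "b = axis i 1" by (auto simp: Basis_vec_def)
    show "vector [Re l, Im l] \<bullet> b \<le> vector [Re u, Im u] \<bullet> b"
      using le' exhaust_2[of i] by (auto simp: b inner_axis)
  qed
  also have "(\<Prod>b\<in>Basis. (vector [Re u, Im u] - vector [Re l, Im l] :: real^2) \<bullet> b)
     = (\<Prod>i\<in>UNIV. (vector [Re u, Im u] - vector [Re l, Im l] :: real^2) $ i)"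
  proof -
    have B: "Basis = range (\<lambda>i::2. axis i (1::real))" by (auto simp: Basis_vec_def)
    have "inj (\<lambda>i::2. axis i (1::real))" by (auto simp: inj_on_def axis_eq_axis)
    then show ?thesis unfolding B by (subst prod.reindex) (auto simp: inner_axis)
  qed
  also have "\<dots> = (\<Prod>b\<in>Basis. (u - l) \<bullet> b)"
    by (simp add: Basis_complex_def inner_complex_def UNIV_2)
  finally show "emeasure (distr lborel borel (\<lambda>x::real^2. Complex (x $ 1) (x $ 2))) (box l u)
     = ennreal (\<Prod>b\<in>Basis. (u - l) \<bullet> b)" .
qed simp

lemma lborel_distr_complex_rotation:
  fixes c :: complex
  assumes "norm c = 1"
  shows "distr lborel borel ((*) c) = lborel"
proof (rule lborel_eqI[symmetric])
  fix l u :: complex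
  assume le: "\<And>b. b \<in> Basis \<Longrightarrow> l \<bullet> b \<le> u \<bullet> b"
  define T where "T = (\<lambda>x::real^2. Complex (x $ 1) (x $ 2))"
  define S where "S = (\<lambda>z. vector [Re z, Im z] :: real^2)"
  have TS: "T (S z) = z" for z by (simp add: T_def S_def)
  have ST: "S (T x) = x" for x by (simp add: T_def S_def vec_eq_iff forall_2)
  have mT[measurable]: "T \<in> borel_measurable borel" unfolding T_def
    by (intro borel_measurable_continuous_onI) (auto simp: Complex_eq intro!: continuous_intros)
  have eT: "emeasure lborel X = emeasure lborel (T -` X)" if "X \<in> sets borel" for X
    using that by (subst lborel_complex_eq_distr_real2) (simp add: emeasure_distr T_def[symmetric])
  define g where "g = (\<lambda>x. S (cnj c * T x))"
  have cc: "c * cnj c = 1" using assms by (simp add: complex_norm_square[symmetric])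
  have gon: "orthogonal_transformation g"
  proof -
    have lin: "linear g"
      by (rule linearI) (auto simp: g_def T_def S_def vec_eq_iff forall_2 algebra_simps)
    have nT: "norm (T x) = norm x" for x
      by (simp add: T_def norm_vec_def L2_set_def UNIV_2 cmod_def)
    have "norm (g x) = norm x" for x
      using nT[of "g x"] nT[of x] assms by (simp add: g_def TS norm_mult)
    then show ?thesis using lin by (simp add: orthogonal_transformation)
  qed
  have vi: "T -` ((*) c -` box l u) = g ` (T -` box l u)"
  proof (intro subset_antisym subsetI)
    fix x assume "x \<in> T -` ((*) c -` box l u)"
    then have x: "c * T x \<in> box l u" by simp
    have "x = g (S (c * T x))"
      using cc by (simp add: g_def TS ST mult.assoc[symmetric] mult.commute)
    moreover have "S (c * T x) \<in> T -` box l u" using x by (simp add: TS)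
    ultimately show "x \<in> g ` (T -` box l u)" by blast
  next
    fix y assume "y \<in> g ` (T -` box l u)"
    then obtain x where x: "T x \<in> box l u" and y: "y = g x" by blast
    have "c * T (g x) = T x" using cc by (simp add: g_def TS mult.assoc[symmetric])
    then show "y \<in> T -` ((*) c -` box l u)" using x y by simp
  qed
  have Tbox: "T -` box l u = box (S l) (S u)"
    by (auto simp: T_def S_def mem_box_cart in_box_complex_iff forall_2)
  have lm: "box (S l) (S u) \<in> lmeasurable" by simp
  have m1: "(*) c -` box l u \<in> sets borel"
    by (intro measurable_sets_borel[of _ borel] borel_measurable_continuous_onI continuous_intros) auto
  have "emeasure (distr lborel borel ((*) c)) (box l u) = emeasure lborel ((*) c -` box l u)"
    by (subst emeasure_distr) auto
  also have "\<dots> = emeasure lborel (T -` ((*) c -` box l u))"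
    by (rule eT[OF m1])
  also have "\<dots> = emeasure lebesgue (T -` ((*) c -` box l u))"
    using measurable_sets_borel[OF mT m1] by simp
  also have "\<dots> = emeasure lebesgue (g ` box (S l) (S u))" by (simp add: vi Tbox)
  also have "\<dots> = ennreal (measure lebesgue (g ` box (S l) (S u)))"
    using measurable_orthogonal_image[OF gon lm] by (simp add: emeasure_eq_measure2)
  also have "\<dots> = ennreal (measure lebesgue (box (S l) (S u)))"
    using measure_orthogonal_image[OF gon lm] by simp
  also have "\<dots> = emeasure lebesgue (T -` box l u)"
    using lm by (simp add: emeasure_eq_measure2 Tbox)
  also have "\<dots> = emeasure lborel (T -` box l u)"
    by (simp add: Tbox)
  also have "\<dots> = emeasure lborel (box l u)" by (rule eT[symmetric]) simp
  also have "\<dots> = ennreal (\<Prod>b\<in>Basis. (u - l) \<bullet> b)"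
    using le by simp
  finally show "emeasure (distr lborel borel ((*) c)) (box l u) = ennreal (\<Prod>b\<in>Basis. (u - l) \<bullet> b)" .
qed simp

lemma prod_Basis_vec:
  fixes g :: "('a::euclidean_space) ^ 'n \<Rightarrow> real"
  shows "(\<Prod>b\<in>Basis. g b) = (\<Prod>i\<in>UNIV. \<Prod>b\<in>Basis. g (axis i b))"
proof -
  have B: "Basis = (\<lambda>(i, b). axis i b :: 'a ^ 'n) ` (UNIV \<times> Basis)"
    by (auto simp: Basis_vec_def)
  have inj: "inj_on (\<lambda>(i, b). axis i b :: 'a ^ 'n) (UNIV \<times> Basis)"
    by (auto simp: inj_on_def axis_eq_axis)
  show ?thesis
    unfolding B by (subst prod.reindex[OF inj]) (simp add: prod.cartesian_product case_prod_unfold)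
qed

lemma in_box_vec_iff:
  fixes x :: "('a::euclidean_space) ^ 'n"
  shows "x \<in> box l u \<longleftrightarrow> (\<forall>i. x $ i \<in> box (l $ i) (u $ i))"
  by (auto simp: mem_box Basis_vec_def inner_axis)

text \<open>
  A box in complex n-space is a product of boxes in the plane, so Lebesgue measure is the product of
  the planar ones.  The rotations \<open>c i\<close> come for free, since each factor is invariant; with
  \<open>c i = 1\<close> this is the plain product decomposition, and the two cases together give
  the invariance under the torus below.
\<close>

lemma lborel_vec_eq_distr_PiM:
  fixes c :: "'n::finite \<Rightarrow> complex"
  assumes c: "\<And>i. norm (c i) = 1"
  shows "(\<lambda>x. \<chi> i. c i * x i) \<in> (\<Pi>\<^sub>M i\<in>UNIV. lborel) \<rightarrow>\<^sub>M (borel :: (complex ^ 'n) measure)"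
    and "distr (\<Pi>\<^sub>M i\<in>UNIV. lborel) borel (\<lambda>x. \<chi> i. c i * x i) = (lborel :: (complex ^ 'n) measure)"
proof -
  show m: "(\<lambda>x. \<chi> i. c i * x i) \<in> (\<Pi>\<^sub>M i\<in>UNIV. lborel) \<rightarrow>\<^sub>M (borel :: (complex ^ 'n) measure)"
    by (subst borel_measurable_euclidean_space) (auto simp: Basis_vec_def inner_axis)
  interpret product_sigma_finite "\<lambda>_::'n. lborel :: complex measure" by standard
  let ?M = "distr (\<Pi>\<^sub>M i\<in>UNIV. lborel) borel (\<lambda>x. \<chi> i. c i * x i) :: (complex ^ 'n) measure"
  show "distr (\<Pi>\<^sub>M i\<in>UNIV. lborel) borel (\<lambda>x. \<chi> i. c i * x i) = (lborel :: (complex ^ 'n) measure)"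
  proof (rule lborel_eqI[symmetric])
    fix l u :: "complex ^ 'n"
    assume le: "\<And>b. b \<in> Basis \<Longrightarrow> l \<bullet> b \<le> u \<bullet> b"
    have le': "l $ i \<bullet> b \<le> u $ i \<bullet> b" if "b \<in> Basis" for i b
      using le[of "axis i b"] that by (auto simp: Basis_vec_def inner_axis)
    have mi: "(*) (c i) -` box (l $ i) (u $ i) \<in> sets borel" for i
      by (intro measurable_sets_borel[of _ borel] borel_measurable_continuous_onI continuous_intros) auto
    have vi: "(\<lambda>x. \<chi> i. c i * x i) -` box l u \<inter> space (\<Pi>\<^sub>M i\<in>UNIV. lborel)
        = (\<Pi>\<^sub>E i\<in>UNIV. (*) (c i) -` box (l $ i) (u $ i))"
      by (auto simp: in_box_vec_iff space_PiM PiE_iff)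
    have "emeasure (?M) (box l u)
        = emeasure (\<Pi>\<^sub>M i\<in>UNIV. lborel) (\<Pi>\<^sub>E i\<in>UNIV. (*) (c i) -` box (l $ i) (u $ i))"
      using m by (subst emeasure_distr) (auto simp: vi)
    also have "\<dots> = (\<Prod>i\<in>UNIV. emeasure lborel ((*) (c i) -` box (l $ i) (u $ i)))"
      using mi by (subst emeasure_PiM) auto
    also have "\<dots> = (\<Prod>i\<in>UNIV. emeasure lborel (box (l $ i) (u $ i)))"
    proof (rule prod.cong)
      fix i
      have "emeasure lborel (box (l $ i) (u $ i)) = emeasure (distr lborel borel ((*) (c i))) (box (l $ i) (u $ i))"
        by (subst lborel_distr_complex_rotation[OF c]) simp
      also have "\<dots> = emeasure lborel ((*) (c i) -` box (l $ i) (u $ i))"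
        by (subst emeasure_distr) auto
      finally show "emeasure lborel ((*) (c i) -` box (l $ i) (u $ i)) = emeasure lborel (box (l $ i) (u $ i))" ..
    qed simp
    also have "\<dots> = (\<Prod>i\<in>UNIV. ennreal (\<Prod>b\<in>Basis. (u $ i - l $ i) \<bullet> b))"
      using le' by (intro prod.cong refl emeasure_lborel_box) auto
    also have "\<dots> = ennreal (\<Prod>i\<in>UNIV. \<Prod>b\<in>Basis. (u $ i - l $ i) \<bullet> b)"
      using le' by (intro prod_ennreal) (auto intro!: prod_nonneg simp: inner_diff_left)
    also have "(\<Prod>i\<in>UNIV. \<Prod>b\<in>Basis. (u $ i - l $ i) \<bullet> b) = (\<Prod>b\<in>Basis. (u - l) \<bullet> b)"
      by (simp add: prod_Basis_vec inner_axis)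
    finally show "emeasure (?M) (box l u)
        = ennreal (\<Prod>b\<in>Basis. (u - l) \<bullet> b)" .
  qed simp
qed

definition torus_act :: "('n \<Rightarrow> complex) \<Rightarrow> complex ^ 'n \<Rightarrow> complex ^ 'n" where
  "torus_act c z = (\<chi> i. c i * z $ i)"

lemma measurable_torus_act[measurable]: "torus_act (c :: 'n::finite \<Rightarrow> complex) \<in> borel_measurable borel"
  unfolding torus_act_def by (intro borel_measurable_continuous_onI continuous_intros)

lemma lborel_distr_torus_act:
  fixes c :: "'n::finite \<Rightarrow> complex"
  assumes c: "\<And>i. norm (c i) = 1"
  shows "distr lborel borel (torus_act c) = lborel"
proof -
  have m1: "(\<lambda>x. \<chi> i. x i) \<in> (\<Pi>\<^sub>M i\<in>UNIV. lborel) \<rightarrow>\<^sub>M (borel :: (complex ^ 'n) measure)"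
    using lborel_vec_eq_distr_PiM(1)[of "\<lambda>i::'n. 1"] by simp
  have "distr lborel borel (torus_act c)
      = distr (distr (\<Pi>\<^sub>M i\<in>UNIV. lborel) borel (\<lambda>x. \<chi> i. x i)) borel (torus_act c)"
    using lborel_vec_eq_distr_PiM(2)[of "\<lambda>i::'n. 1"] by simp
  also have "\<dots> = distr (\<Pi>\<^sub>M i\<in>UNIV. lborel) borel (\<lambda>x. \<chi> i. c i * x i)"
    using m1 by (subst distr_distr) (auto simp: torus_act_def o_def)
  also have "\<dots> = lborel" by (rule lborel_vec_eq_distr_PiM(2)[OF c])
  finally show ?thesis .
qed

lemma norm_torus_act:
  assumes "\<And>i. norm (c i) = 1"
  shows "norm (torus_act c z) = norm z"
  using assms by (simp add: torus_act_def norm_vec_def norm_mult)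

lemma nn_integral_lborel_prod_vec:
  fixes g :: "'n::finite \<Rightarrow> complex \<Rightarrow> ennreal"
  assumes [measurable]: "\<And>i. g i \<in> borel_measurable borel"
  shows "(\<integral>\<^sup>+z. (\<Prod>i\<in>UNIV. g i (z $ i)) \<partial>lborel) = (\<Prod>i\<in>UNIV. \<integral>\<^sup>+x. g i x \<partial>lborel)"
proof -
  interpret product_sigma_finite "\<lambda>_::'n. lborel :: complex measure" by standard
  have m1: "(\<lambda>x. \<chi> i. x i) \<in> (\<Pi>\<^sub>M i\<in>UNIV. lborel) \<rightarrow>\<^sub>M (borel :: (complex ^ 'n) measure)"
    using lborel_vec_eq_distr_PiM(1)[of "\<lambda>i::'n. 1"] by simp
  have mc: "(\<lambda>z::complex ^ 'n. z $ i) \<in> borel_measurable borel" for i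
    by (intro borel_measurable_continuous_onI continuous_intros)
  have [measurable]: "(\<lambda>z::complex ^ 'n. \<Prod>i\<in>UNIV. g i (z $ i)) \<in> borel_measurable borel"
    using measurable_compose[OF mc assms] by (intro borel_measurable_prod_ennreal)
  have "(\<integral>\<^sup>+z. (\<Prod>i\<in>UNIV. g i (z $ i)) \<partial>(lborel :: (complex ^ 'n) measure))
      = (\<integral>\<^sup>+z. (\<Prod>i\<in>UNIV. g i (z $ i)) \<partial>distr (\<Pi>\<^sub>M i\<in>UNIV. lborel) borel (\<lambda>x. \<chi> i. x i))"
    using lborel_vec_eq_distr_PiM(2)[of "\<lambda>i::'n. 1"] by simp
  also have "\<dots> = (\<integral>\<^sup>+x. (\<Prod>i\<in>UNIV. g i (x i)) \<partial>(\<Pi>\<^sub>M i\<in>UNIV. lborel))"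
    using m1 by (subst nn_integral_distr) auto
  also have "\<dots> = (\<Prod>i\<in>UNIV. \<integral>\<^sup>+x. g i x \<partial>lborel)"
    by (rule product_nn_integral_prod) auto
  finally show ?thesis .
qed

lemma nn_integral_lborel_scale:
  fixes f :: "'a::euclidean_space \<Rightarrow> ennreal"
  assumes [measurable]: "f \<in> borel_measurable borel" and t: "t > 0"
  shows "(\<integral>\<^sup>+x. f x \<partial>lborel) = ennreal (t ^ DIM('a)) * (\<integral>\<^sup>+x. f (t *\<^sub>R x) \<partial>lborel)"
proof -
  have T: "(\<lambda>x::'a. 0 + (\<Sum>j\<in>Basis. (t * (x \<bullet> j)) *\<^sub>R j)) = (\<lambda>x. t *\<^sub>R x)"
    by (auto simp flip: scaleR_scaleR scaleR_sum_right simp: euclidean_representation)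
  have eq: "lborel = density (distr lborel borel (\<lambda>x::'a. t *\<^sub>R x)) (\<lambda>_. ennreal (t ^ DIM('a)))"
    using lborel_affine_euclidean[where 'a='a and c="\<lambda>_. t" and t=0] t unfolding T by simp
  show ?thesis
    by (subst eq) (simp add: nn_integral_density nn_integral_distr nn_integral_cmult)
qed

section \<open>Radial integrals and the norms of monomials\<close>

lemma nn_integral_power_times_exp:
  "(\<integral>\<^sup>+s. ennreal (s ^ k * exp (- s)) * indicator {0..} s \<partial>lborel) = ennreal (fact k)"
proof (rule nn_integral_has_integral_lebesgue')
  have "((\<lambda>t. t powr (real (Suc k) - 1) / exp t) has_integral Gamma (real (Suc k))) {0..}"
    by (rule Gamma_integral_real) simp
  then have "((\<lambda>t. t powr real k / exp t) has_integral fact k) {0..}"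
    using Gamma_fact[of k, where 'a=real] by (simp add: add.commute)
  note I = this
  show "((\<lambda>s::real. s ^ k * exp (- s)) has_integral fact k) {0..}"
  proof (rule has_integral_spike_finite[OF _ _ I])
    show "finite {0::real}" by simp
  qed (auto simp: powr_realpow exp_minus field_simps)
qed auto

lemma nn_integral_beta:
  "(\<integral>\<^sup>+s. ennreal (s ^ a * (1 - s) ^ b) * indicator {0..1} s \<partial>lborel)
     = ennreal (fact a * fact b / fact (a + b + 1))"
proof (rule nn_integral_has_integral_lebesgue')
  have "((\<lambda>t. t powr (real (Suc a) - 1) * (1 - t) powr (real (Suc b) - 1)) has_integral
      Beta (real (Suc a)) (real (Suc b))) {0..1}"
    by (rule has_integral_Beta_real) simp_all
  moreover have "Beta (real (Suc a)) (real (Suc b)) = fact a * fact b / fact (a + b + 1)"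
  proof -
    have "real (Suc a) + real (Suc b) = 1 + real (a + b + 1)" by simp
    then show ?thesis
      using Gamma_fact[of a, where 'a=real] Gamma_fact[of b, where 'a=real]
        Gamma_fact[of "a + b + 1", where 'a=real]
      by (simp only: Beta_def) (simp add: add_ac)
  qed
  ultimately have "((\<lambda>t. t powr real a * (1 - t) powr real b) has_integral
      fact a * fact b / fact (a + b + 1)) {0..1}"
    by simp
  note I = this
  show "((\<lambda>s::real. s ^ a * (1 - s) ^ b) has_integral fact a * fact b / fact (a + b + 1)) {0..1}"
  proof (rule has_integral_spike_finite[OF _ _ I])
    show "finite {0::real, 1}" by simp
  qed (auto simp: powr_realpow)
qed auto

text \<open>
  Integration in polar coordinates without spheres: if the sublevel sets of \<open>q\<close> have measure \<open>C t\<^sup>d\<close>,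
  then the image measure under \<open>q\<close> has the derivative of this function as its density, because both
  measures agree on all half-lines.
\<close>

lemma nn_integral_distr_power_growth:
  fixes q :: "'a \<Rightarrow> real" and C :: real
  assumes q[measurable]: "q \<in> borel_measurable M" and q0: "\<And>x. x \<in> space M \<Longrightarrow> q x \<ge> 0"
    and d: "d \<ge> 1" and C: "C \<ge> 0"
    and growth: "\<And>t. t \<ge> 0 \<Longrightarrow> emeasure M {x \<in> space M. q x \<le> t} = ennreal (C * t ^ d)"
    and h[measurable]: "h \<in> borel_measurable borel"
  shows "(\<integral>\<^sup>+x. h (q x) \<partial>M)
      = (\<integral>\<^sup>+s. h s * (ennreal (C * (real d * s ^ (d - 1))) * indicator {0..} s) \<partial>lborel)"
proof -
  define p where "p = (\<lambda>s::real. ennreal (C * (real d * s ^ (d - 1))) * indicator {0..} s)"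
  have [measurable]: "p \<in> borel_measurable borel" unfolding p_def by measurable
  have neg: "{x \<in> space M. q x \<le> t} = {}" if "t < 0" for t
    using q0 that by force
  have e1: "emeasure (distr M borel q) {..t} = (if t \<ge> 0 then ennreal (C * t ^ d) else 0)" for t
  proof -
    have "emeasure (distr M borel q) {..t} = emeasure M {x \<in> space M. q x \<le> t}"
      by (subst emeasure_distr) (auto intro!: arg_cong2[where f=emeasure])
    then show ?thesis using growth[of t] neg[of t] by (cases "t \<ge> 0") (simp_all add: not_le)
  qed
  have e2: "emeasure (density lborel p) {..t} = (if t \<ge> 0 then ennreal (C * t ^ d) else 0)" for t
  proof (cases "t \<ge> 0")
    case True
    have "((\<lambda>s. C * (real d * s ^ (d - 1))) has_integral C * t ^ d - C * 0 ^ d) {0..t}"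
      using True by (intro fundamental_theorem_of_calculus)
        (auto intro!: derivative_eq_intros simp flip: has_real_derivative_iff_has_vector_derivative)
    then have I: "((\<lambda>s. C * (real d * s ^ (d - 1))) has_integral C * t ^ d) {0..t}"
      using d by (simp add: power_0_left)
    have "emeasure (density lborel p) {..t} = (\<integral>\<^sup>+s. p s * indicator {..t} s \<partial>lborel)"
      by (simp add: emeasure_density)
    also have "\<dots> = (\<integral>\<^sup>+s. ennreal (C * (real d * s ^ (d - 1))) * indicator {0..t} s \<partial>lborel)"
      by (intro nn_integral_cong) (auto simp: p_def indicator_def)
    also have "\<dots> = ennreal (C * t ^ d)"
      by (rule nn_integral_has_integral_lebesgue'[OF _ I]) (use C in auto)
    finally show ?thesis using True by simp
  next
    case False
    have "emeasure (density lborel p) {..t} = (\<integral>\<^sup>+s. p s * indicator {..t} s \<partial>lborel)"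
      by (simp add: emeasure_density)
    also have "\<dots> = (\<integral>\<^sup>+s. 0 \<partial>(lborel :: real measure))"
      using False by (intro nn_integral_cong) (auto simp: p_def indicator_def)
    finally show ?thesis using False by simp
  qed
  have "distr M borel q = density lborel p"
  proof (rule measure_eqI_generator_eq[where E="range atMost" and A="\<lambda>i. {..real i}" and \<Omega>=UNIV])
    show "Int_stable (range atMost :: real set set)"
      by (auto simp: Int_stable_def)
    show "sets (distr M borel q) = sigma_sets UNIV (range atMost)"
      by (simp add: borel_eq_atMost)
    show "sets (density lborel p) = sigma_sets UNIV (range atMost)"
      by (simp add: borel_eq_atMost)
    show "(\<Union>i. {..real i}) = UNIV" using real_arch_simple by auto
  qed (auto simp: e1 e2)
  then have "(\<integral>\<^sup>+s. h s \<partial>distr M borel q) = (\<integral>\<^sup>+s. h s \<partial>density lborel p)"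
    by simp
  then show ?thesis
    by (simp add: nn_integral_distr nn_integral_density p_def mult.commute)
qed

text \<open>
  For a homogeneous weight the measure of a ball scales as a power of its radius.  The constant \<open>C\<close> is the
  integral of \<open>w\<close> over the unit ball.  What matters is that one and the same \<open>C\<close> serves all radial
  profiles \<open>h\<close>: computing the integral for one profile determines it for every other.
\<close>

lemma nn_integral_homogeneous_radial:
  fixes w :: "'a::euclidean_space \<Rightarrow> real"
  assumes w[measurable]: "w \<in> borel_measurable borel" and w0: "\<And>z. w z \<ge> 0"
    and hom: "\<And>t z. t > 0 \<Longrightarrow> w (t *\<^sub>R z) = t ^ (2 * k) * w z"
    and bound: "\<And>z. norm z \<le> 1 \<Longrightarrow> w z \<le> 1"
    and dim: "DIM('a) = 2 * n"
  obtains C where "C \<ge> 0" "\<And>h. h \<in> borel_measurable borel \<Longrightarrow>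
      (\<integral>\<^sup>+z. h ((norm z)\<^sup>2) * ennreal (w z) \<partial>lborel)
        = (\<integral>\<^sup>+s. h s * (ennreal (C * (real (k + n) * s ^ (k + n - 1))) * indicator {0..} s) \<partial>lborel)"
proof -
  let ?M = "density lborel (\<lambda>z. ennreal (w z))"
  define c where "c = (\<integral>\<^sup>+z. ennreal (w z) * indicator {z. (norm z)\<^sup>2 \<le> 1} z \<partial>lborel)"
  have "c \<le> (\<integral>\<^sup>+z. indicator (cball 0 1 :: 'a set) z \<partial>lborel)"
    unfolding c_def using bound
    by (intro nn_integral_mono) (auto simp: indicator_def power_le_one_iff abs_square_le_1)
  also have "\<dots> < \<infinity>" using emeasure_lborel_cball_finite[of "0::'a" 1] by simp
  finally have cfin: "c = ennreal (enn2real c)" by (simp add: less_top)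
  have n0: "n > 0" using dim DIM_positive[where 'a='a] by linarith
  have growth: "emeasure ?M {z \<in> space ?M. (norm z)\<^sup>2 \<le> t} = ennreal (enn2real c * t ^ (k + n))"
    if t: "t \<ge> 0" for t
  proof (cases "t = 0")
    case True
    have "{z::'a. (norm z)\<^sup>2 \<le> 0} = {0}" by auto
    moreover have "emeasure ?M {0} = 0"
      by (subst emeasure_density) (auto simp: nn_integral_0_iff_AE intro!: AE_mp[OF AE_lborel_singleton[of 0]])
    ultimately show ?thesis using True n0 by simp
  next
    case False
    then have t: "t > 0" using t by simp
    define r where "r = sqrt t"
    have r: "r > 0" "r\<^sup>2 = t" using t by (auto simp: r_def)
    have "emeasure ?M {z \<in> space ?M. (norm z)\<^sup>2 \<le> t}
        = (\<integral>\<^sup>+z. ennreal (w z) * indicator {z. (norm z)\<^sup>2 \<le> t} z \<partial>lborel)"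
      by (simp add: emeasure_density)
    also have "\<dots> = ennreal (r ^ DIM('a)) *
        (\<integral>\<^sup>+z. ennreal (w (r *\<^sub>R z)) * indicator {z. (norm z)\<^sup>2 \<le> t} (r *\<^sub>R z) \<partial>lborel)"
      by (rule nn_integral_lborel_scale) (use r in auto)
    also have "(\<integral>\<^sup>+z. ennreal (w (r *\<^sub>R z)) * indicator {z. (norm z)\<^sup>2 \<le> t} (r *\<^sub>R z) \<partial>lborel)
        = (\<integral>\<^sup>+z. ennreal (r ^ (2 * k)) * (ennreal (w z) * indicator {z. (norm z)\<^sup>2 \<le> 1} z) \<partial>lborel)"
      using r t w0 by (intro nn_integral_cong)
        (auto simp: hom ennreal_mult indicator_def power_mult_distrib mult_ac)
    also have "\<dots> = ennreal (r ^ (2 * k)) * c"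
      unfolding c_def by (rule nn_integral_cmult) measurable
    also have "ennreal (r ^ DIM('a)) * (ennreal (r ^ (2 * k)) * c) = ennreal (enn2real c * t ^ (k + n))"
      unfolding r(2)[symmetric] using r(1) by (subst cfin)
        (simp add: dim ennreal_mult'[symmetric] power_mult power_add mult_ac power2_eq_square power_mult_distrib)
    finally show ?thesis .
  qed
  have "(\<integral>\<^sup>+z. h ((norm z)\<^sup>2) * ennreal (w z) \<partial>lborel)
        = (\<integral>\<^sup>+s. h s * (ennreal (enn2real c * (real (k + n) * s ^ (k + n - 1))) * indicator {0..} s) \<partial>lborel)"
    if [measurable]: "h \<in> borel_measurable borel" for h
  proof -
    have "(\<integral>\<^sup>+z. h ((norm z)\<^sup>2) * ennreal (w z) \<partial>lborel) = (\<integral>\<^sup>+z. h ((norm z)\<^sup>2) \<partial>?M)"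
      by (simp add: nn_integral_density mult.commute)
    also have "\<dots> = (\<integral>\<^sup>+s. h s * (ennreal (enn2real c * (real (k + n) * s ^ (k + n - 1))) * indicator {0..} s) \<partial>lborel)"
      by (rule nn_integral_distr_power_growth) (use growth n0 in auto)
    finally show ?thesis .
  qed
  then show ?thesis by (intro that[of "enn2real c"]) auto
qed

lemma mi_power_torus_act:
  "mi_power (torus_act c z) m = (\<Prod>i\<in>UNIV. c i ^ m i) * mi_power z m"
  by (simp add: mi_power_def torus_act_def power_mult_distrib prod.distrib)

lemma mi_power_scale: "mi_power (c *s z) m = c ^ mi_deg m * mi_power z m"
  by (simp add: mi_power_def mi_deg_def power_mult_distrib prod.distrib power_sum)

lemma continuous_on_mi_power[continuous_intros]:
  "continuous_on S (\<lambda>z::complex ^ 'n::finite. mi_power z m)"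
  unfolding mi_power_def by (intro continuous_intros)

lemma measurable_mi_power[measurable]:
  "(\<lambda>z::complex ^ 'n::finite. mi_power z m) \<in> borel_measurable borel"
  by (intro borel_measurable_continuous_onI continuous_intros)

lemma norm_mi_power_le_one:
  assumes "norm z \<le> 1"
  shows "norm (mi_power z m) \<le> 1"
  unfolding mi_power_def prod_norm[symmetric]
  by (intro prod_le_1) (auto simp: norm_power intro!: power_le_one order.trans[OF Finite_Cartesian_Product.norm_nth_le assms])

text \<open>
  In the plane the disc of squared radius \<open>t\<close> has area \<open>\<pi> t\<close>, so the squared modulus has constant
  density \<open>\<pi>\<close>, and a Gamma integral remains.
\<close>

lemma nn_integral_complex_gaussian:
  "(\<integral>\<^sup>+z. ennreal ((cmod z ^ j)\<^sup>2 * exp (- (cmod z)\<^sup>2)) \<partial>lborel) = ennreal (pi * fact j)"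
proof -
  have growth: "emeasure lborel {z \<in> space lborel. (cmod z)\<^sup>2 \<le> t} = ennreal (pi * t ^ 1)"
    if t: "t \<ge> 0" for t
  proof -
    have "{z \<in> space lborel. (cmod z)\<^sup>2 \<le> t} = cball 0 (sqrt t)"
      using t by (auto simp: real_le_rsqrt real_sqrt_ge_abs1 intro: real_le_rsqrt)
        (metis norm_ge_zero real_sqrt_le_iff real_sqrt_unique)+
    then show ?thesis using t
      by (simp add: emeasure_cball unit_ball_vol_2)
  qed
  have "(\<integral>\<^sup>+z. ennreal ((cmod z ^ j)\<^sup>2 * exp (- (cmod z)\<^sup>2)) \<partial>lborel)
     = (\<integral>\<^sup>+z. (\<lambda>s. ennreal (s ^ j * exp (- s))) ((cmod z)\<^sup>2) \<partial>lborel)"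
    by (simp add: power_mult[symmetric] mult.commute)
  also have "\<dots> = (\<integral>\<^sup>+s. ennreal (s ^ j * exp (- s)) * (ennreal (pi * (real 1 * s ^ (1 - 1))) * indicator {0..} s) \<partial>lborel)"
    by (rule nn_integral_distr_power_growth) (use growth in auto)
  also have "\<dots> = (\<integral>\<^sup>+s. ennreal pi * (ennreal (s ^ j * exp (- s)) * indicator {0..} s) \<partial>lborel)"
    by (intro nn_integral_cong) (simp add: mult_ac)
  also have "\<dots> = ennreal pi * ennreal (fact j)"
    by (subst nn_integral_cmult) (simp_all add: nn_integral_power_times_exp)
  finally show ?thesis by (simp add: ennreal_mult)
qed

lemma norm_sq_vec: "(norm z)\<^sup>2 = (\<Sum>i\<in>UNIV. (cmod (z $ i))\<^sup>2)"
  by (simp add: norm_vec_def L2_set_def sum_nonneg)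

lemma nn_integral_gaussian_mi_power:
  fixes m :: "'n::finite multi_index"
  shows "(\<integral>\<^sup>+z. ennreal (exp (- (norm z)\<^sup>2)) * ennreal ((norm (mi_power z m))\<^sup>2) \<partial>lborel)
     = ennreal (pi ^ CARD('n) * mi_fact m)"
proof -
  have "(\<integral>\<^sup>+z. ennreal (exp (- (norm z)\<^sup>2)) * ennreal ((norm (mi_power z m))\<^sup>2) \<partial>lborel)
     = (\<integral>\<^sup>+z. (\<Prod>i\<in>UNIV. (\<lambda>x. ennreal ((cmod x ^ m i)\<^sup>2 * exp (- (cmod x)\<^sup>2))) (z $ i)) \<partial>lborel)"
    by (intro nn_integral_cong)
      (simp add: prod_ennreal norm_sq_vec exp_sum sum_negf[symmetric] mi_power_def prod_norm[symmetric]
        norm_power prod.distrib prod_power_distrib ennreal_mult[symmetric] prod_nonneg mult.commute)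
  also have "\<dots> = (\<Prod>i\<in>UNIV. \<integral>\<^sup>+x. ennreal ((cmod x ^ m i)\<^sup>2 * exp (- (cmod x)\<^sup>2)) \<partial>lborel)"
    by (rule nn_integral_lborel_prod_vec) measurable
  also have "\<dots> = (\<Prod>i\<in>(UNIV::'n set). ennreal (pi * fact (m i)))"
    by (simp only: nn_integral_complex_gaussian)
  also have "\<dots> = ennreal (pi ^ CARD('n) * mi_fact m)"
    by (subst prod_ennreal) (auto simp: prod.distrib mi_fact_def)
  finally show ?thesis .
qed

text \<open>
  The squared norm of the monomial \<open>z\<^sup>m\<close> for the weight \<open>(1 - \<bar>z\<bar>\<^sup>2)\<^sup>\<beta>\<close> on the ball.
\<close>

definition bergman_norm :: "nat \<Rightarrow> 'n::finite multi_index \<Rightarrow> real" where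
  "bergman_norm \<beta> m = pi ^ CARD('n) * mi_fact m * fact \<beta> / fact (mi_deg m + CARD('n) + \<beta>)"

lemma bergman_norm_pos: "bergman_norm \<beta> m > 0"
  by (auto simp: bergman_norm_def mi_fact_def intro!: divide_pos_pos mult_pos_pos prod_pos)

text \<open>
  The Gaussian profile fixes the radial constant \<open>D\<close>; the profile \<open>(1 - s)\<^sup>\<beta>\<close> on the unit interval then
  gives a Beta integral.
\<close>

lemma nn_integral_ball_mi_power:
  fixes m :: "'n::finite multi_index"
  shows "(\<integral>\<^sup>+z. ennreal ((1 - (norm z)\<^sup>2) ^ \<beta>) * indicator (ball 0 1) z * ennreal ((norm (mi_power z m))\<^sup>2) \<partial>lborel)
     = ennreal (bergman_norm \<beta> m)"
proof -
  let ?w = "\<lambda>z. ennreal ((norm (mi_power z m))\<^sup>2)"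
  define k where "k = mi_deg m"
  define n where "n = CARD('n)"
  have n0: "n > 0" by (simp add: n_def)
  have meas: "(\<lambda>z. (norm (mi_power z m))\<^sup>2) \<in> borel_measurable borel" by measurable
  have hom: "(norm (mi_power (t *\<^sub>R z) m))\<^sup>2 = t ^ (2 * k) * (norm (mi_power z m))\<^sup>2" if "t > 0" for t z
  proof -
    have "t *\<^sub>R z = complex_of_real t *s z" by (simp add: vec_eq_iff) (simp add: scaleR_conv_of_real)
    then show ?thesis using that
      by (simp add: mi_power_scale norm_mult norm_power power_mult_distrib power_mult[symmetric] k_def mult.commute)
  qed
  have bnd: "(norm (mi_power z m))\<^sup>2 \<le> 1" if "norm z \<le> 1" for z
    using norm_mi_power_le_one[OF that, of m] by (simp add: power_le_one)
  obtain C where C: "C \<ge> 0" "\<And>h. h \<in> borel_measurable borel \<Longrightarrow>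
      (\<integral>\<^sup>+z. h ((norm z)\<^sup>2) * ?w z \<partial>lborel)
        = (\<integral>\<^sup>+s. h s * (ennreal (C * (real (k + n) * s ^ (k + n - 1))) * indicator {0..} s) \<partial>lborel)"
    using nn_integral_homogeneous_radial[OF meas _ hom bnd, of n] by (auto simp: n_def)
  define D where "D = C * real (k + n)"
  have D: "D \<ge> 0" using C by (simp add: D_def)
  have "ennreal (pi ^ n * mi_fact m)
      = (\<integral>\<^sup>+z. ennreal (exp (- (norm z)\<^sup>2)) * ?w z \<partial>lborel)"
    by (simp add: nn_integral_gaussian_mi_power n_def)
  also have "\<dots> = (\<integral>\<^sup>+s. ennreal (exp (- s)) * (ennreal (C * (real (k + n) * s ^ (k + n - 1))) * indicator {0..} s) \<partial>lborel)"
    by (rule C(2)[where h="\<lambda>s. ennreal (exp (- s))"]) measurable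
  also have "\<dots> = (\<integral>\<^sup>+s. ennreal D * (ennreal (s ^ (k + n - 1) * exp (- s)) * indicator {0..} s) \<partial>lborel)"
    using D C(1) by (intro nn_integral_cong)
      (auto simp: D_def indicator_def ennreal_mult'[symmetric] ennreal_mult[symmetric] mult_ac)
  also have "\<dots> = ennreal D * ennreal (fact (k + n - 1))"
    by (subst nn_integral_cmult) (simp_all add: nn_integral_power_times_exp)
  also have "\<dots> = ennreal (D * fact (k + n - 1))" using D by (simp add: ennreal_mult)
  finally have Deq: "D * fact (k + n - 1) = pi ^ n * mi_fact m"
    using D by (simp add: mi_fact_def prod_nonneg)
  have "(\<integral>\<^sup>+z. ennreal ((1 - (norm z)\<^sup>2) ^ \<beta>) * indicator (ball 0 1) z * ?w z \<partial>lborel)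
     = (\<integral>\<^sup>+z. (\<lambda>s. ennreal ((1 - s) ^ \<beta>) * indicator {0..<1} s) ((norm z)\<^sup>2) * ?w z \<partial>lborel)"
    by (intro nn_integral_cong) (auto simp: indicator_def abs_square_less_1)
  also have "\<dots> = (\<integral>\<^sup>+s. ennreal ((1 - s) ^ \<beta>) * indicator {0..<1} s
      * (ennreal (C * (real (k + n) * s ^ (k + n - 1))) * indicator {0..} s) \<partial>lborel)"
    by (rule C(2)) measurable
  also have "\<dots> = (\<integral>\<^sup>+s. ennreal D * (ennreal (s ^ (k + n - 1) * (1 - s) ^ \<beta>) * indicator {0..1} s) \<partial>lborel)"
  proof (rule nn_integral_cong_AE, rule AE_mp[OF AE_lborel_singleton[of "1::real"]], intro AE_I2 impI)
    fix s :: real assume s: "s \<noteq> 1"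
    have D': "C * (real (k + n) * x) = D * x" for x by (simp add: D_def)
    show "ennreal ((1 - s) ^ \<beta>) * indicator {0..<1} s
        * (ennreal (C * (real (k + n) * s ^ (k + n - 1))) * indicator {0..} s)
      = ennreal D * (ennreal (s ^ (k + n - 1) * (1 - s) ^ \<beta>) * indicator {0..1} s)"
      unfolding D' using s D
      by (cases "0 \<le> s"; cases "s < 1") (simp_all add: indicator_def ennreal_mult mult_ac)
  qed
  also have "\<dots> = ennreal D * ennreal (fact (k + n - 1) * fact \<beta> / fact (k + n - 1 + \<beta> + 1))"
    by (subst nn_integral_cmult) (simp_all add: nn_integral_beta)
  also have "\<dots> = ennreal (D * fact (k + n - 1) * fact \<beta> / fact (k + n - 1 + \<beta> + 1))"
    using D by (simp add: ennreal_mult[symmetric] mult.assoc)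
  also have "k + n - 1 + \<beta> + 1 = k + n + \<beta>" using n0 by simp
  finally show ?thesis unfolding Deq by (simp add: bergman_norm_def n_def k_def)
qed

section \<open>Orthogonality of monomials and square integrals of power series\<close>

text \<open>
  The radius \<open>r\<close> is kept as a parameter since a power series converges uniformly only on balls with
  \<open>r < 1\<close>, while the norms of interest belong to \<open>r = 1\<close>.
\<close>

definition bergman_density :: "nat \<Rightarrow> real \<Rightarrow> complex ^ 'n::finite \<Rightarrow> real" where
  "bergman_density \<beta> r z = (if norm z < r then (1 - (norm z)\<^sup>2) ^ \<beta> else 0)"

definition bergman_measure :: "nat \<Rightarrow> real \<Rightarrow> (complex ^ 'n::finite) measure" where
  "bergman_measure \<beta> r = density lborel (\<lambda>z. ennreal (bergman_density \<beta> r z))"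

lemma measurable_bergman_density[measurable]:
  "bergman_density \<beta> r \<in> borel_measurable borel"
  unfolding bergman_density_def by measurable

lemma sets_bergman_measure[measurable_cong, simp]: "sets (bergman_measure \<beta> r) = sets borel"
  by (simp add: bergman_measure_def)

lemma space_bergman_measure[simp]: "space (bergman_measure \<beta> r) = UNIV"
  by (simp add: bergman_measure_def)

lemma bergman_density_bounds:
  assumes "r \<le> 1"
  shows "0 \<le> bergman_density \<beta> r z" "bergman_density \<beta> r z \<le> indicator (cball 0 1) z"
  using assms
  by (auto simp: bergman_density_def indicator_def abs_square_le_1 intro!: zero_le_power power_le_one)

lemma finite_measure_bergman:
  assumes "r \<le> 1"
  shows "finite_measure (bergman_measure \<beta> r :: (complex ^ 'n::finite) measure)"
proof
  let ?M = "bergman_measure \<beta> r :: (complex ^ 'n) measure"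
  have "emeasure ?M (space ?M)
      = (\<integral>\<^sup>+z. ennreal (bergman_density \<beta> r z) \<partial>(lborel :: (complex ^ 'n) measure))"
    by (simp add: bergman_measure_def emeasure_density)
  also have "\<dots> \<le> (\<integral>\<^sup>+z. indicator (cball 0 1) z \<partial>(lborel :: (complex ^ 'n) measure))"
    using bergman_density_bounds(2)[OF assms]
    by (intro nn_integral_mono) (simp flip: ennreal_indicator add: ennreal_leI)
  also have "\<dots> < \<infinity>"
    using emeasure_lborel_cball_finite[of "0::complex ^ 'n" 1] by simp
  finally show "emeasure ?M (space ?M) \<noteq> \<infinity>" by simp
qed

lemma AE_bergman_measure: "AE z in bergman_measure \<beta> r. norm z < r"
  unfolding bergman_measure_def by (subst AE_density) (auto simp: bergman_density_def)

lemma integrable_bergman_measure: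
  fixes f :: "complex ^ 'n::finite \<Rightarrow> 'b::{banach, second_countable_topology}"
  assumes "r \<le> 1" and [measurable]: "f \<in> borel_measurable borel"
    and "\<And>z. norm z < r \<Longrightarrow> norm (f z) \<le> B"
  shows "integrable (bergman_measure \<beta> r) f"
proof -
  interpret finite_measure "bergman_measure \<beta> r" by (rule finite_measure_bergman[OF assms(1)])
  show ?thesis
    by (rule integrable_const_bound[where B=B])
      (use AE_bergman_measure[of r \<beta>] assms(3) in \<open>auto elim: AE_mp\<close>)
qed

lemma bergman_measure_distr_torus_act:
  fixes c :: "'n::finite \<Rightarrow> complex"
  assumes c: "\<And>i. norm (c i) = 1"
  shows "distr (bergman_measure \<beta> r) borel (torus_act c) = bergman_measure \<beta> r"
proof (rule measure_eqI)
  let ?M = "bergman_measure \<beta> r :: (complex ^ 'n) measure"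
  fix A assume "A \<in> sets (distr (?M) borel (torus_act c))"
  then have [measurable]: "A \<in> sets borel" by simp
  have [measurable]: "torus_act c -` A \<in> sets borel"
    using measurable_sets_borel[OF measurable_torus_act[of c]] by simp
  have "emeasure (distr (?M) borel (torus_act c)) A
      = emeasure (?M) (torus_act c -` A)"
    by (subst emeasure_distr) (auto simp: measurable_torus_act)
  also have "\<dots> = (\<integral>\<^sup>+z. ennreal (bergman_density \<beta> r z) * indicator (torus_act c -` A) z \<partial>lborel)"
    unfolding bergman_measure_def by (subst emeasure_density) auto
  also have "\<dots> = (\<integral>\<^sup>+z. ennreal (bergman_density \<beta> r (torus_act c z)) * indicator A (torus_act c z) \<partial>lborel)"
    by (intro nn_integral_cong) (auto simp: bergman_density_def norm_torus_act[OF c] indicator_def)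
  also have "\<dots> = (\<integral>\<^sup>+z. ennreal (bergman_density \<beta> r z) * indicator A z \<partial>distr lborel borel (torus_act c))"
    by (subst nn_integral_distr) auto
  also have "\<dots> = emeasure (?M) A"
    unfolding bergman_measure_def lborel_distr_torus_act[OF c] by (subst emeasure_density) auto
  finally show "emeasure (distr (?M) borel (torus_act c)) A = emeasure (?M) A" .
qed simp

text \<open>
  A rotation of the coordinate \<open>i\<close> where \<open>m\<close> and \<open>m'\<close> differ leaves the measure unchanged but multiplies
  the integrand by a constant.  The angle is chosen to make that constant equal to \<open>-1\<close>.
\<close>

lemma mi_power_orthogonal:
  fixes m m' :: "'n::finite multi_index"
  assumes "m \<noteq> m'"
  shows "(\<integral>z. mi_power z m * cnj (mi_power z m') \<partial>bergman_measure \<beta> r) = 0"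
proof -
  obtain i where i: "m i \<noteq> m' i" using assms by auto
  \<comment> \<open>The integrand picks up the factor \<open>cis (\<theta> (m i - m' i)) = cis pi\<close>.\<close>
  define \<theta> where "\<theta> = pi / (real (m i) - real (m' i))"
  define c where "c = (\<lambda>j. if j = i then cis \<theta> else 1)"
  have c: "norm (c j) = 1" for j by (simp add: c_def)
  have pr: "(\<Prod>j\<in>UNIV. c j ^ l j) = cis (\<theta> * real (l i))" for l
  proof -
    have "(\<Prod>j\<in>UNIV. c j ^ l j) = (\<Prod>j\<in>UNIV. if j = i then cis \<theta> ^ l j else 1)"
      by (intro prod.cong) (auto simp: c_def)
    then show ?thesis using Complex.DeMoivre[of \<theta> "l i"] by (simp add: mult.commute)
  qed
  have "cis (\<theta> * real (m i)) * cnj (cis (\<theta> * real (m' i))) = cis (\<theta> * real (m i) - \<theta> * real (m' i))"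
    by (simp add: cis_cnj cis_mult)
  also have "\<theta> * real (m i) - \<theta> * real (m' i) = pi"
  proof -
    have "\<theta> * real (m i) - \<theta> * real (m' i) = \<theta> * (real (m i) - real (m' i))"
      by (simp add: right_diff_distrib)
    then show ?thesis using i by (simp add: \<theta>_def)
  qed
  finally have minus: "cis (\<theta> * real (m i)) * cnj (cis (\<theta> * real (m' i))) = -1" by simp
  let ?I = "\<integral>z. mi_power z m * cnj (mi_power z m') \<partial>bergman_measure \<beta> r"
  have "?I = (\<integral>z. mi_power z m * cnj (mi_power z m') \<partial>distr (bergman_measure \<beta> r) borel (torus_act c))"
    by (simp only: bergman_measure_distr_torus_act[OF c])
  also have "\<dots> = (\<integral>z. mi_power (torus_act c z) m * cnj (mi_power (torus_act c z) m') \<partial>bergman_measure \<beta> r)"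
    by (subst integral_distr) (auto intro!: borel_measurable_continuous_onI continuous_intros)
  also have "\<dots> = (\<integral>z. - (mi_power z m * cnj (mi_power z m')) \<partial>bergman_measure \<beta> r)"
  proof (rule Bochner_Integration.integral_cong[OF refl])
    fix z
    have "mi_power (torus_act c z) m * cnj (mi_power (torus_act c z) m')
        = (cis (\<theta> * real (m i)) * cnj (cis (\<theta> * real (m' i)))) * (mi_power z m * cnj (mi_power z m'))"
      by (simp add: mi_power_torus_act pr mult_ac)
    then show "mi_power (torus_act c z) m * cnj (mi_power (torus_act c z) m')
        = - (mi_power z m * cnj (mi_power z m'))" by (simp add: minus)
  qed
  also have "\<dots> = - ?I" by simp
  finally show ?thesis by simp
qed

definition mi_poly :: "'n multi_index set \<Rightarrow> ('n::finite multi_index \<Rightarrow> complex) \<Rightarrow> complex ^ 'n \<Rightarrow> complex" where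
  "mi_poly F a z = (\<Sum>m\<in>F. a m * mi_power z m)"

lemma continuous_on_mi_poly[continuous_intros]: "continuous_on S (mi_poly F a)"
  unfolding mi_poly_def by (intro continuous_intros)

lemma measurable_mi_poly[measurable]: "mi_poly F a \<in> borel_measurable borel"
  by (intro borel_measurable_continuous_onI continuous_intros)

lemma norm_mi_poly_le:
  assumes "norm z \<le> 1"
  shows "norm (mi_poly F a z) \<le> (\<Sum>m\<in>F. norm (a m))"
  unfolding mi_poly_def
  by (rule sum_norm_le) (simp add: norm_mult mult_left_le norm_mi_power_le_one[OF assms])

lemma nn_integral_bergman_mi_poly:
  fixes F :: "'n::finite multi_index set"
  assumes F: "finite F" and r: "r \<le> 1"
  shows "(\<integral>\<^sup>+z. ennreal ((norm (mi_poly F a z))\<^sup>2) \<partial>bergman_measure \<beta> r)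
     = ennreal (\<Sum>m\<in>F. (norm (a m))\<^sup>2 * (\<integral>z. (norm (mi_power z m))\<^sup>2 \<partial>bergman_measure \<beta> r))"
proof -
  let ?M = "bergman_measure \<beta> r"
  have int1: "integrable ?M (\<lambda>z. mi_power z m * cnj (mi_power z m'))" for m m' :: "'n multi_index"
  proof (rule integrable_bergman_measure[OF r, where B=1])
    show "norm (mi_power z m * cnj (mi_power z m')) \<le> 1" if "norm z < r" for z
      using norm_mi_power_le_one[of z m] norm_mi_power_le_one[of z m'] that r
      by (simp add: norm_mult mult_le_one)
  qed (intro borel_measurable_continuous_onI continuous_intros)
  have int2: "integrable ?M (\<lambda>z. (norm (mi_poly F a z))\<^sup>2)"
  proof (rule integrable_bergman_measure[OF r, where B="(\<Sum>m\<in>F. norm (a m))\<^sup>2"])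
    show "norm ((norm (mi_poly F a z))\<^sup>2) \<le> (\<Sum>m\<in>F. norm (a m))\<^sup>2" if "norm z < r" for z
      using norm_mi_poly_le[of z F a] that r by (auto intro!: power_mono)
  qed measurable
  have sq: "complex_of_real ((norm (mi_poly F a z))\<^sup>2)
     = (\<Sum>m\<in>F. \<Sum>m'\<in>F. (a m * cnj (a m')) * (mi_power z m * cnj (mi_power z m')))" for z
    by (simp only: complex_norm_square mi_poly_def cnj_sum sum_product) (simp add: mult_ac)
  have "complex_of_real (\<integral>z. (norm (mi_poly F a z))\<^sup>2 \<partial>?M)
     = (\<integral>z. complex_of_real ((norm (mi_poly F a z))\<^sup>2) \<partial>?M)"
    by (simp only: integral_complex_of_real)
  also have "\<dots> = (\<integral>z. (\<Sum>m\<in>F. \<Sum>m'\<in>F. (a m * cnj (a m')) * (mi_power z m * cnj (mi_power z m'))) \<partial>?M)"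
    by (simp only: sq)
  also have "\<dots> = (\<Sum>m\<in>F. \<Sum>m'\<in>F. (a m * cnj (a m')) * (\<integral>z. mi_power z m * cnj (mi_power z m') \<partial>?M))"
    using int1 by (simp add: Bochner_Integration.integral_sum)
  also have "\<dots> = (\<Sum>m\<in>F. \<Sum>m'\<in>F. if m' = m then (a m * cnj (a m)) * (\<integral>z. mi_power z m * cnj (mi_power z m) \<partial>?M) else 0)"
    by (intro sum.cong refl) (auto simp: mi_power_orthogonal)
  also have "\<dots> = (\<Sum>m\<in>F. (a m * cnj (a m)) * (\<integral>z. complex_of_real ((norm (mi_power z m))\<^sup>2) \<partial>?M))"
  proof -
    have N: "complex_of_real ((norm (mi_power z m))\<^sup>2) = mi_power z m * cnj (mi_power z m)"
      for z and m :: "'n multi_index" by (rule complex_norm_square)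
    show ?thesis using F by (simp add: N del: of_real_power)
  qed
  also have "\<dots> = complex_of_real (\<Sum>m\<in>F. (norm (a m))\<^sup>2 * (\<integral>z. (norm (mi_power z m))\<^sup>2 \<partial>?M))"
    by (simp only: integral_complex_of_real complex_norm_square[symmetric] of_real_mult[symmetric] of_real_sum[symmetric])
  finally have "(\<integral>z. (norm (mi_poly F a z))\<^sup>2 \<partial>?M) = (\<Sum>m\<in>F. (norm (a m))\<^sup>2 * (\<integral>z. (norm (mi_power z m))\<^sup>2 \<partial>?M))"
    by (simp only: of_real_eq_iff)
  with int2 show ?thesis by (simp add: nn_integral_eq_integral)
qed

lemma nn_integral_bergman_mi_poly_unit:
  fixes F :: "'n::finite multi_index set"
  assumes F: "finite F"
  shows "(\<integral>\<^sup>+z. ennreal ((norm (mi_poly F a z))\<^sup>2) \<partial>bergman_measure \<beta> 1)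
     = ennreal (\<Sum>m\<in>F. (norm (a m))\<^sup>2 * bergman_norm \<beta> m)"
proof -
  have "(\<integral>z. (norm (mi_power z m))\<^sup>2 \<partial>bergman_measure \<beta> 1) = bergman_norm \<beta> m" for m :: "'n multi_index"
  proof -
    have "(\<integral>\<^sup>+z. ennreal ((norm (mi_power z m))\<^sup>2) \<partial>bergman_measure \<beta> 1)
       = (\<integral>\<^sup>+z. ennreal ((1 - (norm z)\<^sup>2) ^ \<beta>) * indicator (ball 0 1) z * ennreal ((norm (mi_power z m))\<^sup>2) \<partial>lborel)"
      unfolding bergman_measure_def
      by (subst nn_integral_density) (auto simp: bergman_density_def indicator_def intro!: nn_integral_cong)
    also have "\<dots> = ennreal (bergman_norm \<beta> m)" by (rule nn_integral_ball_mi_power)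
    finally show ?thesis
      using bergman_norm_pos[of \<beta> m] by (subst integral_eq_nn_integral) auto
  qed
  then show ?thesis by (subst nn_integral_bergman_mi_poly[OF F]) auto
qed

text \<open>
  These finite sets of multi-indices exhaust all of them; partial sums over them are the partial sums
  of the homogeneous expansion.
\<close>

definition mi_below :: "nat \<Rightarrow> 'n::finite multi_index set" where
  "mi_below K = {m. mi_deg m < K}"

lemma finite_mi_below: "finite (mi_below K :: 'n::finite multi_index set)"
proof (rule finite_subset)
  show "mi_below K \<subseteq> (\<Pi>\<^sub>E i\<in>(UNIV::'n set). {..<K})"
  proof (intro subsetI PiE_I)
    fix m :: "'n multi_index" and i assume "m \<in> mi_below K"
    then show "m i \<in> {..<K}" using member_le_sum[of i UNIV m] by (simp add: mi_below_def mi_deg_def)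
  qed simp
qed (auto intro: finite_PiE)

text \<open>
  Bessel's inequality.  On a ball of radius \<open>r < 1\<close> uniform convergence allows passing to the limit in
  the integrals of the partial sums; all late ones dominate the one over \<open>F\<close> by orthogonality;
  then \<open>r\<close> tends to 1.
\<close>

lemma mi_poly_sq_nn_integral_le:
  fixes f :: "complex ^ 'n::finite \<Rightarrow> complex"
  assumes f[measurable]: "f \<in> borel_measurable borel"
    and unif: "\<And>r. 0 < r \<Longrightarrow> r < 1 \<Longrightarrow> uniform_limit (cball 0 r) (\<lambda>K. mi_poly (mi_below K) a) f sequentially"
    and F: "finite F"
  shows "ennreal (\<Sum>m\<in>F. (norm (a m))\<^sup>2 * bergman_norm \<beta> m)
      \<le> (\<integral>\<^sup>+z. ennreal ((norm (f z))\<^sup>2) \<partial>bergman_measure \<beta> 1)"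
proof -
  let ?S = "\<lambda>F r. \<integral>\<^sup>+z. ennreal ((norm (mi_poly F a z))\<^sup>2) \<partial>bergman_measure \<beta> r"
  let ?R = "\<integral>\<^sup>+z. ennreal ((norm (f z))\<^sup>2) \<partial>bergman_measure \<beta> 1"
  obtain K0 where K0: "F \<subseteq> mi_below K0"
  proof
    show "F \<subseteq> mi_below (Suc (Max (mi_deg ` F)))"
      using F by (auto simp: mi_below_def less_Suc_eq_le)
  qed
  have step: "?S F r \<le> ?R"
    if r: "0 < r" "r < 1" for r
  proof -
    let ?M = "bergman_measure \<beta> r :: (complex ^ 'n) measure"
    interpret finite_measure ?M using r by (intro finite_measure_bergman) auto
    have ul: "uniform_limit (cball 0 r) (\<lambda>K. mi_poly (mi_below K) a) f sequentially" by (rule unif[OF r])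
    have ptw: "(\<lambda>K. mi_poly (mi_below K) a z) \<longlonglongrightarrow> f z" if "norm z < r" for z
      using tendsto_uniform_limitI[OF ul, of z] that by simp
    obtain K1 where K1: "\<And>K z. K \<ge> K1 \<Longrightarrow> norm z \<le> r \<Longrightarrow> dist (mi_poly (mi_below K) a z) (f z) < 1"
    proof -
      have "\<forall>\<^sub>F K in sequentially. \<forall>z\<in>cball 0 r. dist (mi_poly (mi_below K) a z) (f z) < 1"
        using ul unfolding uniform_limit_iff by simp
      then obtain K1 where "\<forall>K\<ge>K1. \<forall>z\<in>cball 0 r. dist (mi_poly (mi_below K) a z) (f z) < 1"
        unfolding eventually_sequentially by blast
      then show ?thesis by (intro that[of K1]) auto
    qed
    \<comment> \<open>All late partial sums differ by less than 2 from the one of index \<open>K1\<close>.\<close>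
    define B where "B = (\<Sum>m\<in>mi_below K1. norm (a m)) + 2"
    have B: "norm (mi_poly (mi_below K) a z) \<le> B" if "K \<ge> K1" "norm z < r" for K z
    proof -
      have "dist (mi_poly (mi_below K) a z) (mi_poly (mi_below K1) a z) < 2"
        using K1[of K z] K1[of K1 z] that
          dist_triangle2[of "mi_poly (mi_below K) a z" "mi_poly (mi_below K1) a z" "f z"] by simp
      moreover have "norm (mi_poly (mi_below K1) a z) \<le> (\<Sum>m\<in>mi_below K1. norm (a m))"
        using that r by (intro norm_mi_poly_le) auto
      ultimately show ?thesis unfolding B_def dist_norm
        using norm_triangle_sub[of "mi_poly (mi_below K) a z" "mi_poly (mi_below K1) a z"] by linarith
    qed
    have lim: "(\<lambda>K. \<integral>\<^sup>+z. ennreal ((norm (mi_poly (mi_below (K + K1)) a z))\<^sup>2) \<partial>?M)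
        \<longlonglongrightarrow> (\<integral>\<^sup>+z. ennreal ((norm (f z))\<^sup>2) \<partial>?M)"
    proof (rule nn_integral_dominated_convergence[where w="\<lambda>_. ennreal (B\<^sup>2)"])
      show "AE z in ?M. ennreal ((norm (mi_poly (mi_below (K + K1)) a z))\<^sup>2) \<le> ennreal (B\<^sup>2)" for K
        by (rule AE_mp[OF AE_bergman_measure[of r \<beta>]])
          (auto intro!: AE_I2 ennreal_leI power_mono B)
      show "(\<integral>\<^sup>+z. ennreal (B\<^sup>2) \<partial>?M) < \<infinity>"
        using emeasure_finite[of UNIV] by (auto simp: ennreal_mult_less_top less_top[symmetric] ennreal_mult_eq_top_iff)
      show "AE z in ?M. (\<lambda>K. ennreal ((norm (mi_poly (mi_below (K + K1)) a z))\<^sup>2)) \<longlonglongrightarrow> ennreal ((norm (f z))\<^sup>2)"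
        by (rule AE_mp[OF AE_bergman_measure[of r \<beta>]])
          (auto intro!: AE_I2 tendsto_intros LIMSEQ_ignore_initial_segment[OF ptw])
    qed measurable
    have "?S F r \<le> (\<integral>\<^sup>+z. ennreal ((norm (f z))\<^sup>2) \<partial>?M)"
    proof (rule tendsto_lowerbound[OF lim])
      show "\<forall>\<^sub>F K in sequentially. ?S F r
          \<le> ?S (mi_below (K + K1)) r"
      proof (rule eventually_mono[OF eventually_ge_at_top[of K0]])
        fix K assume "K \<ge> K0"
        then have "F \<subseteq> mi_below (K + K1)" using K0 by (auto simp: mi_below_def)
        then show "?S F r
          \<le> ?S (mi_below (K + K1)) r"
          using r F by (simp add: nn_integral_bergman_mi_poly finite_mi_below)
            (intro ennreal_leI sum_mono2, auto simp: finite_mi_below)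
      qed
    qed simp
    also have "\<dots> \<le> ?R"
      unfolding bergman_measure_def using r
      by (subst (1 2) nn_integral_density) (auto simp: bergman_density_def intro!: nn_integral_mono)
    finally show ?thesis .
  qed
  \<comment> \<open>The densities on the balls of radius \<open>r j\<close> increase to the one on the unit ball; Fatou suffices.\<close>
  define r where "r = (\<lambda>j::nat. 1 - 1 / (real j + 2))"
  have r: "0 < r j" "r j < 1" for j by (auto simp: r_def field_simps)
  have lim_r: "r \<longlonglongrightarrow> 1" unfolding r_def by real_asymp
  let ?g = "\<lambda>j z. ennreal (bergman_density \<beta> (r j) z) * ennreal ((norm (mi_poly F a z))\<^sup>2)"
  have dens: "?S F s
      = (\<integral>\<^sup>+z. ennreal (bergman_density \<beta> s z) * ennreal ((norm (mi_poly F a z))\<^sup>2) \<partial>lborel)" for s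
    unfolding bergman_measure_def by (subst nn_integral_density) auto
  have "ennreal (\<Sum>m\<in>F. (norm (a m))\<^sup>2 * bergman_norm \<beta> m)
      = (\<integral>\<^sup>+z. ennreal (bergman_density \<beta> 1 z) * ennreal ((norm (mi_poly F a z))\<^sup>2) \<partial>lborel)"
    using F by (simp add: nn_integral_bergman_mi_poly_unit dens[symmetric])
  also have "\<dots> \<le> (\<integral>\<^sup>+z. liminf (\<lambda>j. ?g j z) \<partial>lborel)"
  proof (rule nn_integral_mono)
    fix z :: "complex ^ 'n"
    have "\<forall>\<^sub>F j in sequentially. bergman_density \<beta> 1 z \<le> bergman_density \<beta> (r j) z"
    proof (cases "norm z < 1")
      case True
      show ?thesis
        by (rule eventually_mono[OF order_tendstoD(1)[OF lim_r True]]) (simp add: bergman_density_def True)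
    next
      case False
      then have "bergman_density \<beta> 1 z = 0" by (simp add: bergman_density_def)
      moreover have "0 \<le> bergman_density \<beta> (r j) z" for j
        using bergman_density_bounds(1)[of "r j"] r[of j] by simp
      ultimately show ?thesis by simp
    qed
    then show "ennreal (bergman_density \<beta> 1 z) * ennreal ((norm (mi_poly F a z))\<^sup>2) \<le> liminf (\<lambda>j. ?g j z)"
      by (intro Liminf_bounded) (auto elim!: eventually_mono intro!: mult_right_mono ennreal_leI)
  qed
  also have "\<dots> \<le> liminf (\<lambda>j. integral\<^sup>N lborel (?g j))"
    by (rule nn_integral_liminf) measurable
  also have "\<dots> \<le> ?R"
    using step[OF r] by (intro Liminf_le) (auto simp: dens)
  finally show ?thesis .
qed

text \<open>
  The reverse of Bessel's inequality needs only pointwise convergence, by Fatou's lemma.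
\<close>

lemma nn_integral_le_of_mi_poly:
  fixes f :: "complex ^ 'n::finite \<Rightarrow> complex"
  assumes f[measurable]: "f \<in> borel_measurable borel"
    and lim: "\<And>z. norm z < 1 \<Longrightarrow> (\<lambda>K. mi_poly (mi_below K) a z) \<longlonglongrightarrow> f z"
    and E: "\<And>F. finite F \<Longrightarrow> (\<Sum>m\<in>F. (norm (a m))\<^sup>2 * bergman_norm \<beta> m) \<le> E"
  shows "(\<integral>\<^sup>+z. ennreal ((norm (f z))\<^sup>2) \<partial>bergman_measure \<beta> 1) \<le> ennreal E"
proof -
  have "(\<integral>\<^sup>+z. ennreal ((norm (f z))\<^sup>2) \<partial>bergman_measure \<beta> 1)
     = (\<integral>\<^sup>+z. liminf (\<lambda>K. ennreal ((norm (mi_poly (mi_below K) a z))\<^sup>2)) \<partial>bergman_measure \<beta> 1)"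
  proof (rule nn_integral_cong_AE)
    show "AE z in bergman_measure \<beta> 1. ennreal ((norm (f z))\<^sup>2)
        = liminf (\<lambda>K. ennreal ((norm (mi_poly (mi_below K) a z))\<^sup>2))"
      using AE_bergman_measure[of 1 \<beta>]
    proof (rule AE_mp, intro AE_I2 impI)
      fix z :: "complex ^ 'n" assume "norm z < 1"
      then have "(\<lambda>K. ennreal ((norm (mi_poly (mi_below K) a z))\<^sup>2)) \<longlonglongrightarrow> ennreal ((norm (f z))\<^sup>2)"
        by (intro tendsto_intros lim)
      then show "ennreal ((norm (f z))\<^sup>2) = liminf (\<lambda>K. ennreal ((norm (mi_poly (mi_below K) a z))\<^sup>2))"
        by (intro lim_imp_Liminf[symmetric]) simp
    qed
  qed
  also have "\<dots> \<le> liminf (\<lambda>K. \<integral>\<^sup>+z. ennreal ((norm (mi_poly (mi_below K) a z))\<^sup>2) \<partial>bergman_measure \<beta> 1)"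
    by (rule nn_integral_liminf) measurable
  also have "\<dots> \<le> ennreal E"
    by (intro Liminf_le always_eventually allI)
      (auto simp: nn_integral_bergman_mi_poly_unit finite_mi_below intro!: ennreal_leI E)
  finally show ?thesis .
qed

section \<open>Homogeneous polynomials from one-variable polynomials\<close>

text \<open>
  The basis polynomials depend on the degree bound only, not on \<open>p\<close>; therefore they can be applied to
  the coordinates of a function of several variables one after the other.
\<close>

lemma lagrange_interpolation_at_naturals:
  obtains L :: "nat \<Rightarrow> complex poly" where
    "\<And>t. t \<le> k \<Longrightarrow> degree (L t) \<le> k"
    "\<And>p x. degree p \<le> k \<Longrightarrow> poly p x = (\<Sum>t\<le>k. poly p (of_nat t) * poly (L t) x)"
proof
  define N where "N = (\<lambda>t. \<Prod>s\<in>{..k} - {t}. [:- of_nat s, 1:] :: complex poly)"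
  define L where "L = (\<lambda>t. smult (inverse (poly (N t) (of_nat t))) (N t))"
  have degN: "degree (N t) \<le> k" if "t \<le> k" for t
  proof -
    have "degree (N t) \<le> (\<Sum>s\<in>{..k} - {t}. degree [:- of_nat s, 1 :: complex:])"
      unfolding N_def using degree_prod_sum_le[of "{..k} - {t}" "\<lambda>s. [:- of_nat s, 1 :: complex:]"]
      by (simp add: o_def)
    also have "\<dots> = k" using that by simp
    finally show ?thesis .
  qed
  show degL: "degree (L t) \<le> k" if "t \<le> k" for t
    unfolding L_def by (rule order_trans[OF degree_smult_le degN[OF that]])
  have val: "poly (L t) (of_nat s) = (if s = t then 1 else 0)" if "t \<le> k" "s \<le> k" for s t
  proof -
    have N: "poly (N t) x = (\<Prod>s\<in>{..k} - {t}. x - of_nat s)" for x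
      by (simp add: N_def poly_prod)
    have "poly (N t) (of_nat t) \<noteq> 0" unfolding N by (subst prod_zero_iff) auto
    moreover have "poly (N t) (of_nat s) = 0" if "s \<noteq> t"
      unfolding N using that \<open>s \<le> k\<close> by (intro prod_zero) auto
    ultimately show ?thesis by (simp add: L_def)
  qed
  show "poly p x = (\<Sum>t\<le>k. poly p (of_nat t) * poly (L t) x)" if p: "degree p \<le> k" for p x
  proof -
    define q where "q = (\<Sum>t\<le>k. smult (poly p (of_nat t)) (L t))"
    have "degree q \<le> k" unfolding q_def
      by (intro degree_sum_le) (auto intro: degL)
    have "p = q"
    proof (rule poly_eqI_degree[where A="of_nat ` {..k}"])
      have "card (of_nat ` {..k} :: complex set) = Suc k"
        by (subst card_image) (auto simp: inj_on_def)
      then show "card (of_nat ` {..k} :: complex set) > degree p"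
          "card (of_nat ` {..k} :: complex set) > degree q"
        using p \<open>degree q \<le> k\<close> by simp_all
    next
      fix y :: complex assume "y \<in> of_nat ` {..k}"
      then obtain s where s: "s \<le> k" "y = of_nat s" by auto
      have "poly q y = (\<Sum>t\<le>k. if t = s then poly p (of_nat t) else 0)"
        unfolding q_def poly_sum using s by (intro sum.cong) (auto simp: val)
      then show "poly p y = poly q y" using s by simp
    qed
    then have "poly p x = poly q x" by simp
    then show ?thesis by (simp add: q_def poly_sum)
  qed
qed

definition coord_subst :: "'n set \<Rightarrow> ('n \<Rightarrow> complex) \<Rightarrow> complex ^ 'n \<Rightarrow> complex ^ 'n" where
  "coord_subst S c z = (\<chi> j. if j \<in> S then c j else z $ j)"

text \<open>
  Interpolating in one coordinate after another expresses \<open>F\<close> through its values on the grid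
  \<open>{0,\<dots>,k}\<^sup>n\<close> and products of one-variable polynomials, which multiply out to monomials.
\<close>

lemma mi_poly_if_polynomial_in_each_coordinate:
  fixes F :: "complex ^ 'n::finite \<Rightarrow> complex"
  assumes sep: "\<And>i z. \<exists>p. degree p \<le> k \<and> (\<forall>\<zeta>. F (coord_subst {i} (\<lambda>_. \<zeta>) z) = poly p \<zeta>)"
  obtains b where "\<And>z. F z = mi_poly (\<Pi>\<^sub>E i\<in>UNIV. {..k}) b z"
proof -
  obtain L :: "nat \<Rightarrow> complex poly" where
    degL: "\<And>t. t \<le> k \<Longrightarrow> degree (L t) \<le> k" and
    L: "\<And>p x. degree p \<le> k \<Longrightarrow> poly p x = (\<Sum>t\<le>k. poly p (of_nat t) * poly (L t) x)"
    by (rule lagrange_interpolation_at_naturals[of k]) blast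
  have one: "F z = (\<Sum>s\<le>k. F (coord_subst {i} (\<lambda>_. of_nat s) z) * poly (L s) (z $ i))" for i z
  proof -
    from sep[of i z] obtain p where
      "degree p \<le> k \<and> (\<forall>\<zeta>. F (coord_subst {i} (\<lambda>_. \<zeta>) z) = poly p \<zeta>)" ..
    then have p: "degree p \<le> k" "\<And>\<zeta>. F (coord_subst {i} (\<lambda>_. \<zeta>) z) = poly p \<zeta>"
      by simp_all
    have "coord_subst {i} (\<lambda>_. z $ i) z = z" by (simp add: coord_subst_def vec_eq_iff)
    then have "F z = poly p (z $ i)" using p(2)[of "z $ i"] by simp
    also have "\<dots> = (\<Sum>s\<le>k. F (coord_subst {i} (\<lambda>_. of_nat s) z) * poly (L s) (z $ i))"
      by (subst L[OF p(1)]) (simp add: p(2))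
    finally show ?thesis .
  qed
  define T where "T = (\<lambda>S z t. F (coord_subst S (\<lambda>j. of_nat (t j)) z) * (\<Prod>j\<in>S. poly (L (t j :: nat)) (z $ j)))"
  have many: "F z = (\<Sum>t\<in>PiE S (\<lambda>_. {..k}). T S z t)"
    if "finite S" for S z
    using that
  proof (induction S)
    case empty
    then show ?case by (simp add: coord_subst_def T_def)
  next
    case (insert i S)
    have sub: "coord_subst {i} (\<lambda>_. of_nat s) (coord_subst S (\<lambda>j. of_nat (t j)) z)
        = coord_subst (insert i S) (\<lambda>j. of_nat ((t(i := s)) j)) z" for s and t :: "'n \<Rightarrow> nat"
      using insert.hyps by (auto simp: coord_subst_def vec_eq_iff)
    have comp: "coord_subst S (\<lambda>j. of_nat (t j)) z $ i = z $ i" for t :: "'n \<Rightarrow> nat"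
      using insert.hyps by (simp add: coord_subst_def)
    have pr: "(\<Prod>j\<in>insert i S. poly (L ((t(i := s)) j)) (z $ j)) = poly (L s) (z $ i) * (\<Prod>j\<in>S. poly (L (t j)) (z $ j))"
      for s and t :: "'n \<Rightarrow> nat"
    proof -
      have "(\<Prod>j\<in>S. poly (L ((t(i := s)) j)) (z $ j)) = (\<Prod>j\<in>S. poly (L (t j)) (z $ j))"
        using insert.hyps by (intro prod.cong) auto
      then show ?thesis using insert.hyps by (simp del: fun_upd_apply) simp
    qed
    have "F z = (\<Sum>t\<in>PiE S (\<lambda>_. {..k}). T S z t)"
      by (rule insert.IH)
    also have "\<dots> = (\<Sum>t\<in>PiE S (\<lambda>_. {..k}). \<Sum>s\<le>k. T (insert i S) z (t(i := s)))"
      unfolding T_def by (intro sum.cong refl, subst one[of _ i])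
        (simp add: sum_distrib_right sub comp pr mult.assoc del: fun_upd_apply)
    also have "\<dots> = (\<Sum>s\<le>k. \<Sum>t\<in>PiE S (\<lambda>_. {..k}). T (insert i S) z (t(i := s)))"
      by (rule sum.swap)
    also have "\<dots> = (\<Sum>(s, t)\<in>{..k} \<times> PiE S (\<lambda>_. {..k}). T (insert i S) z (t(i := s)))"
      by (rule sum.cartesian_product)
    also have "\<dots> = (\<Sum>t\<in>PiE (insert i S) (\<lambda>_. {..k}). T (insert i S) z t)"
      unfolding PiE_insert_eq
      by (subst sum.reindex[OF inj_combinator]) (use insert.hyps in \<open>auto simp: case_prod_unfold o_def\<close>)
    finally show ?case .
  qed
  define P where "P = (\<Pi>\<^sub>E i\<in>(UNIV::'n set). {..k})"
  have poly_L: "poly (L t) x = (\<Sum>l\<le>k. coeff (L t) l * x ^ l)" if "t \<le> k" for t x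
    by (subst poly_as_sum_of_monoms'[OF degL[OF that], symmetric]) (simp add: poly_sum poly_monom)
  have expand: "(\<Prod>j\<in>UNIV. poly (L (t j)) (z $ j)) = (\<Sum>m\<in>P. (\<Prod>j\<in>UNIV. coeff (L (t j)) (m j)) * mi_power z m)"
    if "t \<in> P" for t and z :: "complex ^ 'n"
  proof -
    have "(\<Prod>j\<in>UNIV. poly (L (t j)) (z $ j)) = (\<Prod>j\<in>UNIV. \<Sum>l\<le>k. coeff (L (t j)) l * (z $ j) ^ l)"
      using that by (intro prod.cong refl poly_L) (auto simp: P_def PiE_iff)
    also have "\<dots> = (\<Sum>m\<in>P. \<Prod>j\<in>UNIV. coeff (L (t j)) (m j) * (z $ j) ^ m j)"
      unfolding P_def by (rule prod_sum_PiE) auto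
    finally show ?thesis by (simp add: prod.distrib mi_power_def)
  qed
  define b where "b = (\<lambda>m. \<Sum>t\<in>P. F (\<chi> j. of_nat (t j)) * (\<Prod>j\<in>UNIV. coeff (L (t j)) (m j)))"
  have "F z = mi_poly P b z" for z
  proof -
    have "F z = (\<Sum>t\<in>P. F (\<chi> j. of_nat (t j)) * (\<Prod>j\<in>UNIV. poly (L (t j)) (z $ j)))"
      using many[of UNIV z] by (simp add: T_def coord_subst_def P_def)
    also have "\<dots> = (\<Sum>t\<in>P. \<Sum>m\<in>P. F (\<chi> j. of_nat (t j)) * (\<Prod>j\<in>UNIV. coeff (L (t j)) (m j)) * mi_power z m)"
      by (intro sum.cong refl) (simp add: expand sum_distrib_left mult.assoc)
    also have "\<dots> = (\<Sum>m\<in>P. \<Sum>t\<in>P. F (\<chi> j. of_nat (t j)) * (\<Prod>j\<in>UNIV. coeff (L (t j)) (m j)) * mi_power z m)"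
      by (rule sum.swap)
    also have "\<dots> = mi_poly P b z"
      by (simp add: mi_poly_def b_def sum_distrib_right)
    finally show ?thesis .
  qed
  then show ?thesis by (intro that) (simp add: P_def)
qed

definition hpart :: "('n::finite multi_index \<Rightarrow> complex) \<Rightarrow> nat \<Rightarrow> complex ^ 'n \<Rightarrow> complex" where
  "hpart a k = mi_poly {m. mi_deg m = k} a"

lemma finite_mi_deg_eq: "finite {m :: 'n::finite multi_index. mi_deg m = k}"
  by (rule finite_subset[OF _ finite_mi_below[of "Suc k"]]) (auto simp: mi_below_def)

lemma hpart_scale: "hpart a k (c *s z) = c ^ k * hpart a k z"
  by (simp add: hpart_def mi_poly_def mi_power_scale sum_distrib_left mult_ac)

text \<open>
  Along the ray through \<open>z\<close> both sides are polynomials in the scaling factor; comparing the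
  coefficients of its \<open>k\<close>-th power removes all monomials of other degrees.
\<close>

lemma hpart_if_homogeneous:
  fixes F :: "complex ^ 'n::finite \<Rightarrow> complex"
  assumes hom: "\<And>c z. F (c *s z) = c ^ k * F z"
    and F: "\<And>z. F z = mi_poly (\<Pi>\<^sub>E i\<in>UNIV. {..k}) b z"
  shows "F z = hpart b k z"
proof -
  define P where "P = (\<Pi>\<^sub>E i\<in>(UNIV::'n set). {..k})"
  have fP: "finite P" unfolding P_def by (auto intro: finite_PiE)
  have "poly (monom (F z) k) c = poly (\<Sum>m\<in>P. monom (b m * mi_power z m) (mi_deg m)) c" for c
    using hom[of c z] F[of "c *s z"]
    by (simp add: poly_monom poly_sum mi_poly_def mi_power_scale P_def mult_ac)
  then have "monom (F z) k = (\<Sum>m\<in>P. monom (b m * mi_power z m) (mi_deg m))"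
    by (simp add: poly_eq_poly_eq_iff[symmetric] fun_eq_iff)
  then have "coeff (monom (F z) k) k = coeff (\<Sum>m\<in>P. monom (b m * mi_power z m) (mi_deg m)) k"
    by simp
  then have "F z = (\<Sum>m\<in>P. if mi_deg m = k then b m * mi_power z m else 0)"
    by (simp add: coeff_sum)
  also have "\<dots> = (\<Sum>m\<in>{m. mi_deg m = k}. b m * mi_power z m)"
  proof -
    have "{m. mi_deg m = k} \<subseteq> P"
      using member_le_sum[of _ UNIV] by (force simp: P_def mi_deg_def PiE_iff)
    then show ?thesis
      using fP by (subst sum.If_cases) (auto intro: sum.cong)
  qed
  finally show ?thesis by (simp add: hpart_def mi_poly_def)
qed

section \<open>Taylor expansion of holomorphic functions on the ball\<close>

lemma norm_vector_smult: "norm (c *s z) = cmod c * norm (z :: complex ^ 'n::finite)"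
  by (simp add: norm_vec_def norm_mult L2_set_right_distrib)

lemma has_field_derivative_along_line:
  fixes f :: "complex ^ 'n::finite \<Rightarrow> complex"
  assumes D: "(f has_derivative D) (at (a + \<zeta> *s b))" "\<And>c v. D (c *s v) = c * D v"
  shows "((\<lambda>\<zeta>. f (a + \<zeta> *s b)) has_field_derivative D b) (at \<zeta>)"
proof -
  have lin: "bounded_linear (\<lambda>\<eta>::complex. \<eta> *s b)"
    by (intro linear_conv_bounded_linear[THEN iffD1] linearI)
      (auto simp: vec_eq_iff algebra_simps)
  have "((\<lambda>\<zeta>. a + \<zeta> *s b) has_derivative (\<lambda>\<eta>. \<eta> *s b)) (at \<zeta>)"
    using bounded_linear.has_derivative[OF lin has_derivative_ident]
    by (auto intro!: derivative_eq_intros)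
  from diff_chain_at[OF this D(1)]
  have "((\<lambda>\<zeta>. f (a + \<zeta> *s b)) has_derivative (\<lambda>\<eta>. D (\<eta> *s b))) (at \<zeta>)"
    by (simp add: o_def)
  then show ?thesis
    unfolding has_field_derivative_def
    by (rule has_derivative_eq_rhs) (simp add: fun_eq_iff D(2) mult.commute)
qed

lemma holo_on_line:
  fixes f :: "complex ^ 'n::finite \<Rightarrow> complex"
  assumes f: "holo_on S f"
  shows "(\<lambda>\<zeta>. f (a + \<zeta> *s b)) holomorphic_on {\<zeta>. a + \<zeta> *s b \<in> S}"
  unfolding holomorphic_on_def
proof
  fix \<zeta> assume "\<zeta> \<in> {\<zeta>. a + \<zeta> *s b \<in> S}"
  then obtain D where "(f has_derivative D) (at (a + \<zeta> *s b))" "\<And>c v. D (c *s v) = c * D v"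
    using f unfolding holo_on_def by blast
  from has_field_derivative_along_line[OF this]
  show "(\<lambda>\<zeta>. f (a + \<zeta> *s b)) field_differentiable at \<zeta> within {\<zeta>. a + \<zeta> *s b \<in> S}"
    by (auto simp: field_differentiable_def intro: has_field_derivative_at_within)
qed

lemma holo_on_line_ball:
  fixes f :: "complex ^ 'n::finite \<Rightarrow> complex"
  assumes f: "holo_on unit_ball f"
  shows "(\<lambda>\<zeta>. f (a + \<zeta> *s b)) holomorphic_on {\<zeta>. norm (a + \<zeta> *s b) < 1}"
  using holo_on_line[OF f, of a b] by (simp add: unit_ball_def)

lemma holo_on_imp_continuous_on:
  assumes "holo_on S f"
  shows "continuous_on S f"
proof (rule continuous_at_imp_continuous_on, rule ballI)
  fix z assume "z \<in> S"
  then obtain D where "(f has_derivative D) (at z)" using assms unfolding holo_on_def by blast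
  then show "isCont f z" by (rule has_derivative_continuous)
qed

text \<open>
  The \<open>k\<close>-th Taylor coefficient at 0 of \<open>f\<close> along the complex line through \<open>z\<close>.  It makes sense for every
  \<open>z\<close>, also outside the ball, as only small multiples of \<open>z\<close> enter.
\<close>

definition line_coeff :: "(complex ^ 'n \<Rightarrow> complex) \<Rightarrow> nat \<Rightarrow> complex ^ 'n \<Rightarrow> complex" where
  "line_coeff f k z = (deriv ^^ k) (\<lambda>\<mu>. f (\<mu> *s z)) 0 / fact k"

text \<open>
  Turns a uniform bound on one ball into geometric decay on smaller balls, which is the source of
  the convergence statements for power series.
\<close>

lemma homogeneous_bound:
  fixes F :: "complex ^ 'n::finite \<Rightarrow> complex"
  assumes hom: "\<And>c z. F (c *s z) = c ^ k * F z"
    and base: "\<And>z. norm z \<le> \<rho> \<Longrightarrow> norm (F z) \<le> M" and \<rho>: "0 < \<rho>"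
  shows "norm (F z) \<le> M * (norm z / \<rho>) ^ k"
proof (cases "z = 0")
  case True
  show ?thesis
  proof (cases "k = 0")
    case True
    then show ?thesis using base[of z] \<rho> \<open>z = 0\<close> by simp
  next
    case False
    have "F z = 0" using hom[of 0 0] False \<open>z = 0\<close> by (simp add: power_0_left)
    then show ?thesis using False \<open>z = 0\<close> by (simp add: power_0_left)
  qed
next
  case False
  define t where "t = norm z / \<rho>"
  have t: "t > 0" using False \<rho> by (simp add: t_def)
  define y where "y = complex_of_real (1 / t) *s z"
  have zy: "z = complex_of_real t *s y" using t by (simp add: y_def vector_smult_assoc)
  have "norm y \<le> \<rho>" using False \<rho> by (simp add: y_def t_def norm_vector_smult norm_divide)
  then have "norm (F y) \<le> M" by (rule base)
  moreover have "norm (F z) = t ^ k * norm (F y)"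
    using t by (subst zy) (simp add: hom norm_mult norm_power)
  ultimately show ?thesis using t by (simp add: t_def[symmetric] mult.commute)
qed

context
  fixes f :: "complex ^ 'n::finite \<Rightarrow> complex"
  assumes f: "holo_on unit_ball f"
begin

lemma slice_holomorphic:
  assumes "norm z \<le> W" "W > 0"
  shows "(\<lambda>\<mu>. f (\<mu> *s z)) holomorphic_on ball 0 (1 / W)"
proof -
  have "ball 0 (1 / W) \<subseteq> {\<mu>. norm (0 + \<mu> *s z) < 1}"
  proof
    fix \<mu> :: complex assume "\<mu> \<in> ball 0 (1 / W)"
    then have "cmod \<mu> * W < 1" using assms by (simp add: pos_less_divide_eq)
    moreover have "cmod \<mu> * norm z \<le> cmod \<mu> * W" using assms by (intro mult_left_mono) auto
    ultimately show "\<mu> \<in> {\<mu>. norm (0 + \<mu> *s z) < 1}" by (simp add: norm_vector_smult)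
  qed
  then show ?thesis using holo_on_line_ball[OF f, of 0 z] by (auto intro: holomorphic_on_subset)
qed

lemma line_coeff_sums:
  assumes "norm (c *s z) < 1"
  shows "(\<lambda>k. line_coeff f k z * c ^ k) sums f (c *s z)"
proof -
  obtain W where W: "W > 0" "norm z \<le> W" "cmod c * W < 1"
  proof (cases "z = 0")
    case True
    show ?thesis
    proof (rule that[of "1 / (cmod c + 1)"])
      have "cmod c + 1 > 0" by (simp add: add_nonneg_pos)
      then show "1 / (cmod c + 1) > 0" "norm z \<le> 1 / (cmod c + 1)" "cmod c * (1 / (cmod c + 1)) < 1"
        by (simp_all add: True pos_divide_less_eq)
    qed
  next
    case False
    then show ?thesis using assms by (intro that[of "norm z"]) (auto simp: norm_vector_smult)
  qed
  have "c \<in> ball 0 (1 / W)" using W by (simp add: pos_less_divide_eq)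
  from holomorphic_power_series[OF slice_holomorphic[OF W(2,1)] this]
  show ?thesis by (simp add: line_coeff_def)
qed

lemma line_coeff_scale: "line_coeff f k (c *s z) = c ^ k * line_coeff f k z"
proof -
  define W where "W = norm z + 1"
  define V where "V = W * (cmod c + 1)"
  have W: "W > 0" "norm z \<le> W" by (auto simp: W_def add_nonneg_pos)
  have "V > 0" unfolding V_def using W by (intro mult_pos_pos) (auto intro: add_nonneg_pos)
  have "(deriv ^^ k) (\<lambda>w. (\<lambda>\<mu>. f (\<mu> *s z)) (c * w)) 0 = c ^ k * (deriv ^^ k) (\<lambda>\<mu>. f (\<mu> *s z)) (c * 0)"
  proof (rule higher_deriv_compose_linear[OF slice_holomorphic[OF W(2,1)]])
    show "open (ball 0 (1 / V) :: complex set)" "open (ball 0 (1 / W) :: complex set)" "0 \<in> ball (0::complex) (1 / V)"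
      using \<open>V > 0\<close> by auto
    fix w :: complex assume "w \<in> ball 0 (1 / V)"
    then have w: "cmod w * V < 1" using \<open>V > 0\<close> by (simp add: pos_less_divide_eq)
    have "cmod (c * w) * W \<le> cmod w * V"
      using W(1) by (simp add: V_def norm_mult algebra_simps)
    then show "c * w \<in> ball 0 (1 / W)" using w W(1) by (simp add: pos_less_divide_eq)
  qed
  then show ?thesis
    by (simp add: line_coeff_def vector_smult_assoc mult.commute)
qed

text \<open>
  Cauchy's estimate on the unit circle of the line through a point of norm at most \<open>\<rho>\<close> bounds the
  coefficient by the maximum of \<open>f\<close> on the closed ball of radius \<open>\<rho>\<close>; homogeneity does the rest.
\<close>

lemma line_coeff_bound:
  assumes \<rho>: "0 < \<rho>" "\<rho> < 1"
  obtains M where "M \<ge> 0" "\<And>k z. norm (line_coeff f k z) \<le> M * (norm z / \<rho>) ^ k"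
proof -
  have "continuous_on (cball 0 \<rho>) f"
    using \<rho> by (intro continuous_on_subset[OF holo_on_imp_continuous_on[OF f]]) (auto simp: unit_ball_def)
  then have "compact (f ` cball 0 \<rho>)" by (intro compact_continuous_image) auto
  then have "bounded (f ` cball 0 \<rho>)" by (rule compact_imp_bounded)
  then obtain M where "\<forall>y\<in>f ` cball 0 \<rho>. norm y \<le> M" unfolding bounded_iff ..
  then have M: "norm (f z) \<le> M" if "norm z \<le> \<rho>" for z using that by simp
  have base: "norm (line_coeff f k z) \<le> M" if z: "norm z \<le> \<rho>" for k z
  proof -
    have hol: "(\<lambda>\<mu>. f (\<mu> *s z)) holomorphic_on ball 0 (1 / \<rho>)"
      by (rule slice_holomorphic) (use z \<rho> in auto)
    have sub: "cball 0 1 \<subseteq> ball (0::complex) (1 / \<rho>)"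
    proof -
      have "1 < 1 / \<rho>" using \<rho> by simp
      then show ?thesis by (auto intro: le_less_trans)
    qed
    have "norm ((deriv ^^ k) (\<lambda>\<mu>. f (\<mu> *s z)) 0) \<le> fact k * M / 1 ^ k"
    proof (rule Cauchy_inequality)
      show "(\<lambda>\<mu>. f (\<mu> *s z)) holomorphic_on ball 0 1"
        using sub ball_subset_cball[of "0::complex" 1] by (intro holomorphic_on_subset[OF hol]) blast
      show "continuous_on (cball 0 1) (\<lambda>\<mu>. f (\<mu> *s z))"
        by (rule continuous_on_subset[OF holomorphic_on_imp_continuous_on[OF hol] sub])
      show "norm (f (x *s z)) \<le> M" if "norm (0 - x) = 1" for x
        using that z by (intro M) (simp add: norm_vector_smult)
    qed simp
    then show ?thesis by (simp add: line_coeff_def norm_divide divide_le_eq mult.commute)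
  qed
  have "M \<ge> 0" using order_trans[OF norm_ge_zero base[of 0 0]] \<rho> by simp
  show ?thesis
    by (rule that[OF \<open>M \<ge> 0\<close>], rule homogeneous_bound[OF line_coeff_scale base \<rho>(1)])
qed

text \<open>
  Holomorphy in a transversal direction \<open>b\<close> cannot be read off the definition, which differentiates
  along rays.  By induction on \<open>k\<close>: the coefficient of order \<open>k\<close> is the limit for \<open>l \<rightarrow> 0\<close> of
  \<open>(f (l w) - \<Sum>\<^sub>i\<^sub><\<^sub>k coeff\<^sub>i w l\<^sup>i) / l\<^sup>k\<close>, these quotients are holomorphic along lines by induction
  hypothesis, and the limit is locally uniform since the remaining terms decay geometrically.
\<close>

lemma line_coeff_holomorphic: "(\<lambda>\<zeta>. line_coeff f k (a + \<zeta> *s b)) holomorphic_on UNIV"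
proof (induction k rule: less_induct)
  case (less k)
  let ?g = "\<lambda>\<zeta>. line_coeff f k (a + \<zeta> *s b)"
  obtain M where M: "M \<ge> 0" "\<And>k z. norm (line_coeff f k z) \<le> M * (norm z / (1/2)) ^ k"
    by (rule line_coeff_bound[of "1/2"]) auto
  have "?g holomorphic_on ball 0 R" if R: "R > 0" for R
  proof -
    \<comment> \<open>A bound for the points of the line over the disc of radius \<open>R\<close>.\<close>
    define W where "W = norm a + R * norm b + 1"
    have W: "W \<ge> 1" using R by (simp add: W_def)
    have nW: "norm (a + \<zeta> *s b) \<le> W" if "\<zeta> \<in> ball 0 R" for \<zeta>
    proof -
      have "norm (a + \<zeta> *s b) \<le> norm a + cmod \<zeta> * norm b"
        using norm_triangle_ineq[of a "\<zeta> *s b"] by (simp add: norm_vector_smult)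
      also have "cmod \<zeta> * norm b \<le> R * norm b" using that by (intro mult_right_mono) auto
      finally show ?thesis by (simp add: W_def)
    qed
    \<comment> \<open>Scales so small that the ratio \<open>2 W l j\<close> of the geometric series is at most one half, and tending to 0.\<close>
    define l where "l = (\<lambda>j::nat. 1 / (4 * W * (real j + 1)))"
    have l0: "l j > 0" for j using W by (simp add: l_def)
    have lW: "2 * W * l j = 1 / (2 * (real j + 1))" for j
    proof -
      have "2 * W * (1 / (4 * W * x)) = 1 / (2 * x)" for x :: real
        using W by (cases "x = 0") (simp_all add: divide_simps)
      then show ?thesis by (simp only: l_def)
    qed
    define G where "G = (\<lambda>j \<zeta>. (f (complex_of_real (l j) *s (a + \<zeta> *s b))
        - (\<Sum>i<k. line_coeff f i (a + \<zeta> *s b) * complex_of_real (l j) ^ i)) / complex_of_real (l j) ^ k)"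
    have small: "norm (complex_of_real (l j) *s w) < 1" if "norm w \<le> W" for j and w :: "complex ^ 'n"
    proof -
      have "norm (complex_of_real (l j) *s w) \<le> l j * W"
        using that l0[of j] by (simp add: norm_vector_smult mult_left_mono)
      also have "l j * W = (2 * W * l j) / 2" by simp
      also have "\<dots> = 1 / (4 * (real j + 1))" unfolding lW by simp
      also have "\<dots> < 1" by simp
      finally show ?thesis .
    qed
    have Ghol: "G j holomorphic_on ball 0 R" for j
    proof -
      let ?c = "complex_of_real (l j)"
      have "(\<lambda>\<zeta>. f (?c *s a + \<zeta> *s (?c *s b))) holomorphic_on ball 0 R"
      proof (rule holomorphic_on_subset[OF holo_on_line_ball[OF f]])
        show "ball 0 R \<subseteq> {\<zeta>. norm (?c *s a + \<zeta> *s (?c *s b)) < 1}"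
        proof
          fix \<zeta> :: complex assume "\<zeta> \<in> ball 0 R"
          from small[OF nW[OF this], of j]
          show "\<zeta> \<in> {\<zeta>. norm (?c *s a + \<zeta> *s (?c *s b)) < 1}"
            by (simp add: vector_add_ldistrib vector_smult_assoc mult.commute)
        qed
      qed
      then have "(\<lambda>\<zeta>. f (?c *s (a + \<zeta> *s b))) holomorphic_on ball 0 R"
        by (simp add: vector_add_ldistrib vector_smult_assoc mult.commute)
      moreover have "(\<lambda>\<zeta>. line_coeff f i (a + \<zeta> *s b)) holomorphic_on ball 0 R" if "i < k" for i
        using less.IH[OF that] by (rule holomorphic_on_subset) auto
      ultimately show ?thesis
        unfolding G_def using l0[of j] by (auto intro!: holomorphic_intros)
    qed
    have Gdist: "dist (G j \<zeta>) (?g \<zeta>) \<le> M * (2 * W) ^ k * (1 / (real j + 1))"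
      if \<zeta>: "\<zeta> \<in> ball 0 R" for j \<zeta>
    proof -
      let ?c = "complex_of_real (l j)" and ?w = "a + \<zeta> *s b"
      have w: "norm ?w \<le> W" by (rule nW[OF \<zeta>])
      define h where "h = (\<lambda>i. line_coeff f (i + Suc k) ?w * ?c ^ Suc i)"
      have c0: "?c \<noteq> 0" using l0[of j] by simp
      have "(\<lambda>i. line_coeff f i ?w * ?c ^ i) sums f (?c *s ?w)"
        by (rule line_coeff_sums[OF small[OF w]])
      from sums_split_initial_segment[OF this, of "Suc k"]
      have "(\<lambda>i. line_coeff f (i + Suc k) ?w * ?c ^ (i + Suc k)) sums
          (f (?c *s ?w) - (\<Sum>i<Suc k. line_coeff f i ?w * ?c ^ i))" .
      from sums_divide[OF this, of "?c ^ k"]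
      have "(\<lambda>i. line_coeff f (i + Suc k) ?w * ?c ^ (i + Suc k) / ?c ^ k) sums
          ((f (?c *s ?w) - (\<Sum>i<Suc k. line_coeff f i ?w * ?c ^ i)) / ?c ^ k)" .
      also have "(\<lambda>i. line_coeff f (i + Suc k) ?w * ?c ^ (i + Suc k) / ?c ^ k) = h"
        using c0 by (auto simp: h_def power_add)
      also have "(f (?c *s ?w) - (\<Sum>i<Suc k. line_coeff f i ?w * ?c ^ i)) / ?c ^ k
          = G j \<zeta> - line_coeff f k ?w"
        using c0 by (simp add: G_def diff_divide_distrib add_divide_distrib)
      finally have hs: "h sums (G j \<zeta> - line_coeff f k ?w)" .
      have lj: "l j * (2 * W) = (1 / 2) * (1 / (real j + 1))" using lW[of j] by (simp add: mult_ac)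
      have hb: "norm (h i) \<le> M * (2 * W) ^ k * (1 / (real j + 1)) * (1 / 2) ^ Suc i" for i
      proof -
        have "norm (h i) \<le> (M * (norm ?w / (1/2)) ^ (i + Suc k)) * l j ^ Suc i"
          unfolding h_def norm_mult norm_power using M(2)[of "i + Suc k" ?w] l0[of j]
          by (intro mult_mono) (auto intro!: M(1) mult_nonneg_nonneg intro: less_imp_le)
        also have "\<dots> \<le> (M * (2 * W) ^ (i + Suc k)) * l j ^ Suc i"
          using w M(1) l0[of j] by (intro mult_right_mono mult_left_mono power_mono) (auto simp: less_imp_le)
        also have "\<dots> = M * (2 * W) ^ k * (l j * (2 * W)) ^ Suc i"
          by (simp only: power_add power_Suc power_mult_distrib add_Suc_right mult_ac)
        also have "\<dots> = M * (2 * W) ^ k * ((1 / (real j + 1)) ^ Suc i * (1 / 2) ^ Suc i)"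
          unfolding lj power_mult_distrib by (simp add: mult_ac)
        also have "\<dots> \<le> M * (2 * W) ^ k * ((1 / (real j + 1)) * (1 / 2) ^ Suc i)"
          using M(1) W power_le_one[of "1 / (real j + 1)" i]
          by (intro mult_left_mono mult_right_mono) (auto simp: divide_right_mono)
        finally show ?thesis by (simp add: mult_ac)
      qed
      have geo: "(\<lambda>i. M * (2 * W) ^ k * (1 / (real j + 1)) * (1 / 2) ^ Suc i) sums (M * (2 * W) ^ k * (1 / (real j + 1)) * 1)"
        by (intro sums_mult power_half_series)
      have "norm (suminf h) \<le> (\<Sum>i. M * (2 * W) ^ k * (1 / (real j + 1)) * (1 / 2) ^ Suc i)"
        by (rule norm_suminf_le[OF hb sums_summable[OF geo]])
      then show ?thesis
        using sums_unique[OF hs] sums_unique[OF geo] by (simp add: dist_norm)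
    qed
    show ?thesis
    proof (rule holomorphic_uniform_sequence[OF open_ball Ghol])
      fix x :: complex assume x: "x \<in> ball 0 R"
      then obtain d where d: "d > 0" "cball x d \<subseteq> ball 0 R"
        using open_ball open_contains_cball by blast
      have "uniform_limit (cball x d) G ?g sequentially"
      proof (rule uniform_limitI)
        fix e :: real assume e: "e > 0"
        have "(\<lambda>j. M * (2 * W) ^ k * (1 / (real j + 1))) \<longlonglongrightarrow> M * (2 * W) ^ k * 0"
          by (intro tendsto_mult tendsto_const) real_asymp
        then have "\<forall>\<^sub>F j in sequentially. M * (2 * W) ^ k * (1 / (real j + 1)) < e"
          using e by (intro order_tendstoD(2)) auto
        then show "\<forall>\<^sub>F j in sequentially. \<forall>\<zeta>\<in>cball x d. dist (G j \<zeta>) (?g \<zeta>) < e"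
        proof (rule eventually_mono, intro ballI)
          fix j \<zeta>
          assume j: "M * (2 * W) ^ k * (1 / (real j + 1)) < e" and "\<zeta> \<in> cball x d"
          then have "\<zeta> \<in> ball 0 R" using d(2) by blast
          from le_less_trans[OF Gdist[OF this] j]
          show "dist (G j \<zeta>) (?g \<zeta>) < e" .
        qed
      qed
      with d show "\<exists>d>0. cball x d \<subseteq> ball 0 R \<and>
          uniform_limit (cball x d) G ?g sequentially" by blast
    qed
  qed
  then have "?g field_differentiable at \<zeta>" for \<zeta>
    using holomorphic_on_imp_differentiable_at[OF _ open_ball, of _ 0 "cmod \<zeta> + 1" \<zeta>]
    by (simp add: add_nonneg_pos)
  then show ?case by (simp add: holomorphic_on_def field_differentiable_at_within)
qed

text \<open>
  An entire function that grows at most like the \<open>k\<close>-th power is a polynomial, by Liouville's theorem.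
\<close>

lemma line_coeff_polynomial_on_lines:
  "\<exists>p. degree p \<le> k \<and> (\<forall>\<zeta>. line_coeff f k (a + \<zeta> *s b) = poly p \<zeta>)"
proof -
  obtain M where M: "M \<ge> 0" "\<And>k z. norm (line_coeff f k z) \<le> M * (norm z / (1/2)) ^ k"
    by (rule line_coeff_bound[of "1/2"]) auto
  let ?g = "\<lambda>\<zeta>. line_coeff f k (a + \<zeta> *s b)"
  have L: "?g \<xi> = (\<Sum>i\<le>k. (deriv ^^ i) ?g 0 / fact i * \<xi> ^ i)" for \<xi>
  proof (rule Liouville_polynomial[OF line_coeff_holomorphic, where A=1 and B="M * (2 * (norm a + norm b)) ^ k"])
    fix \<zeta> :: complex assume \<zeta>: "1 \<le> cmod \<zeta>"
    have "norm (a + \<zeta> *s b) \<le> norm a + cmod \<zeta> * norm b"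
      using norm_triangle_ineq[of a "\<zeta> *s b"] by (simp add: norm_vector_smult)
    also have "\<dots> \<le> (norm a + norm b) * cmod \<zeta>"
      using \<zeta> mult_left_mono[of 1 "cmod \<zeta>" "norm a"] by (simp add: algebra_simps)
    finally have n0: "norm (a + \<zeta> *s b) \<le> (norm a + norm b) * cmod \<zeta>" .
    have "norm (a + \<zeta> *s b) / (1/2) = 2 * norm (a + \<zeta> *s b)" by simp
    also have "\<dots> \<le> 2 * ((norm a + norm b) * cmod \<zeta>)" using n0 by (rule mult_left_mono) simp
    finally have n: "norm (a + \<zeta> *s b) / (1/2) \<le> 2 * (norm a + norm b) * cmod \<zeta>"
      by (simp only: mult.assoc)
    have "norm (?g \<zeta>) \<le> M * (norm (a + \<zeta> *s b) / (1/2)) ^ k" by (rule M(2))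
    also have "\<dots> \<le> M * (2 * (norm a + norm b) * cmod \<zeta>) ^ k"
      using n M(1) by (intro mult_left_mono power_mono) auto
    finally show "norm (?g \<zeta>) \<le> M * (2 * (norm a + norm b)) ^ k * cmod \<zeta> ^ k"
      by (simp add: power_mult_distrib mult_ac)
  qed
  define p where "p = (\<Sum>i\<le>k. monom ((deriv ^^ i) ?g 0 / fact i) i)"
  have "degree p \<le> k" unfolding p_def by (intro degree_sum_le) (auto intro: order_trans[OF degree_monom_le])
  moreover have "?g \<zeta> = poly p \<zeta>" for \<zeta> by (subst L) (simp add: p_def poly_sum poly_monom)
  ultimately show ?thesis by blast
qed

lemma line_coeff_eq_hpart: "\<exists>b. \<forall>z. line_coeff f k z = hpart b k z"
proof -
  have sep: "\<exists>p. degree p \<le> k \<and> (\<forall>\<zeta>. line_coeff f k (coord_subst {i} (\<lambda>_. \<zeta>) z) = poly p \<zeta>)" for i z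
  proof -
    have eq: "coord_subst {i} (\<lambda>_. \<zeta>) z = coord_subst {i} (\<lambda>_. 0) z + \<zeta> *s axis i 1" for \<zeta>
      by (auto simp: coord_subst_def vec_eq_iff axis_def)
    from line_coeff_polynomial_on_lines[of k "coord_subst {i} (\<lambda>_. 0) z" "axis i 1"]
    show ?thesis by (simp only: eq[symmetric])
  qed
  obtain b where "\<And>z. line_coeff f k z = mi_poly (\<Pi>\<^sub>E i\<in>UNIV. {..k}) b z"
    by (rule mi_poly_if_polynomial_in_each_coordinate[of k "line_coeff f k"]) (use sep in auto)
  from hpart_if_homogeneous[of "line_coeff f k", OF line_coeff_scale this] show ?thesis by blast
qed

end

text \<open>
  The condition that makes the homogeneous expansion converge locally uniformly on the ball.  It bounds the
  homogeneous parts and not the single terms, as Cauchy's estimates along lines do.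
\<close>

definition admissible :: "('n::finite multi_index \<Rightarrow> complex) \<Rightarrow> bool" where
  "admissible a \<longleftrightarrow> (\<forall>\<rho>. 0 < \<rho> \<and> \<rho> < 1 \<longrightarrow> (\<exists>M. \<forall>k z. norm z \<le> \<rho> \<longrightarrow> norm (hpart a k z) \<le> M))"

theorem holo_on_ball_expansion:
  fixes f :: "complex ^ 'n::finite \<Rightarrow> complex"
  assumes f: "holo_on unit_ball f"
  obtains a where "admissible a" "\<And>z. norm z < 1 \<Longrightarrow> (\<lambda>k. hpart a k z) sums f z"
proof -
  obtain b where b: "\<And>k z. line_coeff f k z = hpart (b k) k z"
    using line_coeff_eq_hpart[OF f] by metis
  \<comment> \<open>Each degree comes with its own coefficient family; only its values in that degree matter.\<close>
  define a where "a = (\<lambda>m. b (mi_deg m) m)"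
  have ab: "hpart a k z = line_coeff f k z" for k z
    unfolding b hpart_def mi_poly_def a_def by (intro sum.cong) auto
  show ?thesis
  proof
    show "admissible a"
      unfolding admissible_def
    proof (intro allI impI)
      fix \<rho> :: real assume \<rho>: "0 < \<rho> \<and> \<rho> < 1"
      obtain M where M: "M \<ge> 0" "\<And>k z. norm (line_coeff f k z) \<le> M * (norm z / \<rho>) ^ k"
        by (rule line_coeff_bound[OF f, of \<rho>]) (use \<rho> in auto)
      have "norm (hpart a k z) \<le> M" if "norm z \<le> \<rho>" for k z
        using M(2)[of k z] mult_left_le[OF power_le_one[of "norm z / \<rho>" k] M(1)] that \<rho>
        by (simp add: ab)
      then show "\<exists>M. \<forall>k z. norm z \<le> \<rho> \<longrightarrow> norm (hpart a k z) \<le> M" by blast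
    qed
    show "(\<lambda>k. hpart a k z) sums f z" if "norm z < 1" for z
      using line_coeff_sums[OF f, of 1 z] that by (simp add: ab)
  qed
qed

section \<open>Holomorphy and radial derivatives of power series\<close>

lemma holo_on_const: "holo_on S (\<lambda>z. c)"
  unfolding holo_on_def by (intro ballI exI[of _ "\<lambda>_. 0"]) auto

lemma holo_on_nth: "holo_on S (\<lambda>z. z $ i)"
  unfolding holo_on_def
  by (intro ballI exI[of _ "\<lambda>v. v $ i"])
    (auto intro: bounded_linear.has_derivative[OF bounded_linear_vec_nth has_derivative_ident])

lemma holo_on_add:
  assumes "holo_on S f" "holo_on S g"
  shows "holo_on S (\<lambda>z. f z + g z)"
  unfolding holo_on_def
proof
  fix z assume "z \<in> S"
  then obtain D E where "(f has_derivative D) (at z)" "\<And>c v. D (c *s v) = c * D v"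
    "(g has_derivative E) (at z)" "\<And>c v. E (c *s v) = c * E v"
    using assms unfolding holo_on_def by meson
  then show "\<exists>D. ((\<lambda>z. f z + g z) has_derivative D) (at z) \<and> (\<forall>c v. D (c *s v) = c * D v)"
    by (intro exI[of _ "\<lambda>v. D v + E v"]) (auto intro: has_derivative_add simp: algebra_simps)
qed

lemma holo_on_mult:
  assumes "holo_on S f" "holo_on S g"
  shows "holo_on S (\<lambda>z. f z * g z)"
  unfolding holo_on_def
proof
  fix z assume "z \<in> S"
  then obtain D E where "(f has_derivative D) (at z)" "\<And>c v. D (c *s v) = c * D v"
    "(g has_derivative E) (at z)" "\<And>c v. E (c *s v) = c * E v"
    using assms unfolding holo_on_def by meson
  then show "\<exists>D. ((\<lambda>z. f z * g z) has_derivative D) (at z) \<and> (\<forall>c v. D (c *s v) = c * D v)"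
    by (intro exI[of _ "\<lambda>v. f z * E v + D v * g z"] conjI has_derivative_mult) (simp_all add: algebra_simps)
qed

lemma holo_on_power: "holo_on S f \<Longrightarrow> holo_on S (\<lambda>z. f z ^ k)"
  by (induction k) (auto intro: holo_on_const holo_on_mult)

lemma holo_on_sum: "(\<And>i. i \<in> I \<Longrightarrow> holo_on S (f i)) \<Longrightarrow> holo_on S (\<lambda>z. \<Sum>i\<in>I. f i z)"
  by (induction I rule: infinite_finite_induct) (auto intro: holo_on_const holo_on_add)

lemma holo_on_prod: "(\<And>i. i \<in> I \<Longrightarrow> holo_on S (f i)) \<Longrightarrow> holo_on S (\<lambda>z. \<Prod>i\<in>I. f i z)"
  by (induction I rule: infinite_finite_induct) (auto intro: holo_on_const holo_on_mult)

lemma holo_on_mi_poly: "holo_on S (mi_poly F a)"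
  unfolding mi_poly_def mi_power_def
  by (intro holo_on_sum holo_on_mult holo_on_const holo_on_prod holo_on_power holo_on_nth)

definition pseries :: "('n::finite multi_index \<Rightarrow> complex) \<Rightarrow> complex ^ 'n \<Rightarrow> complex" where
  "pseries a z = (if z \<in> unit_ball then (\<Sum>k. hpart a k z) else 0)"

lemma admissible_bound:
  assumes "admissible a" "0 < \<rho>" "\<rho> < 1"
  obtains M where "M \<ge> 0" "\<And>k z. norm (hpart a k z) \<le> M * (norm z / \<rho>) ^ k"
proof -
  obtain M where M: "\<And>k z. norm z \<le> \<rho> \<Longrightarrow> norm (hpart a k z) \<le> M"
    using assms unfolding admissible_def by blast
  have "M \<ge> 0" using order_trans[OF norm_ge_zero M[of 0 0]] assms by simp
  then show ?thesis
    by (rule that) (rule homogeneous_bound[OF hpart_scale M assms(2)])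
qed

lemma admissible_summable:
  assumes a: "admissible a" and z: "norm z < 1"
  shows "summable (\<lambda>k. norm (hpart a k z))"
proof -
  define \<rho> where "\<rho> = (norm z + 1) / 2"
  have \<rho>: "0 < \<rho>" "\<rho> < 1" "norm z < \<rho>" using z by (auto simp: \<rho>_def add_nonneg_pos)
  obtain M where M: "M \<ge> 0" "\<And>k z. norm (hpart a k z) \<le> M * (norm z / \<rho>) ^ k"
    using admissible_bound[OF a \<rho>(1,2)] by blast
  show ?thesis
  proof (rule summable_comparison_test')
    show "summable (\<lambda>k. M * (norm z / \<rho>) ^ k)"
      using \<rho> by (intro summable_mult summable_geometric) simp
    show "norm (norm (hpart a k z)) \<le> M * (norm z / \<rho>) ^ k" for k using M(2) by simp
  qed
qed

lemma pseries_sums: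
  assumes "admissible a" "norm z < 1"
  shows "(\<lambda>k. hpart a k z) sums pseries a z"
  using summable_sums[OF summable_norm_cancel[OF admissible_summable[OF assms]]] assms(2)
  by (simp add: pseries_def unit_ball_def)

lemma sum_mi_below: "sum f (mi_below K) = (\<Sum>k<K. \<Sum>m | mi_deg m = k. f m)"
proof -
  have "(\<Sum>k<K. \<Sum>m | mi_deg m = k. f m) = (\<Sum>k<K. \<Sum>m\<in>{m \<in> mi_below K. mi_deg m = k}. f m)"
    by (intro sum.cong refl) (auto simp: mi_below_def)
  also have "\<dots> = sum f (mi_below K)"
    by (rule sum.group[OF finite_mi_below]) (auto simp: mi_below_def)
  finally show ?thesis by simp
qed

lemma mi_poly_mi_below: "mi_poly (mi_below K) a z = (\<Sum>k<K. hpart a k z)"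
  by (simp add: mi_poly_def hpart_def sum_mi_below)

lemma pseries_uniform_limit:
  assumes a: "admissible a" and r: "0 < r" "r < 1"
  shows "uniform_limit (cball 0 r) (\<lambda>K. mi_poly (mi_below K) a) (pseries a) sequentially"
proof -
  define \<rho> where "\<rho> = (r + 1) / 2"
  have \<rho>: "0 < \<rho>" "\<rho> < 1" "r < \<rho>" using r by (auto simp: \<rho>_def)
  obtain M where M: "M \<ge> 0" "\<And>k z. norm (hpart a k z) \<le> M * (norm z / \<rho>) ^ k"
    using admissible_bound[OF a \<rho>(1,2)] by blast
  have "uniform_limit (cball 0 r) (\<lambda>K z. \<Sum>k<K. hpart a k z) (\<lambda>z. \<Sum>k. hpart a k z) sequentially"
  proof (rule Weierstrass_m_test)
    show "summable (\<lambda>k. M * (r / \<rho>) ^ k)"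
      using \<rho> r by (intro summable_mult summable_geometric) simp
    show "norm (hpart a k z) \<le> M * (r / \<rho>) ^ k" if "z \<in> cball 0 r" for k z
      by (rule order_trans[OF M(2)])
        (use that M(1) \<rho> in \<open>auto intro!: mult_left_mono power_mono divide_right_mono\<close>)
  qed
  then have "uniform_limit (cball 0 r) (\<lambda>K z. mi_poly (mi_below K) a z) (\<lambda>z. \<Sum>k. hpart a k z) sequentially"
    by (simp add: mi_poly_mi_below)
  then show ?thesis
    by (rule uniform_limit_cong'[THEN iffD1, rotated 2]) (use r in \<open>auto simp: pseries_def unit_ball_def\<close>)
qed

text \<open>
  Cauchy's estimate for the derivative along the complex line through \<open>z\<close> in direction \<open>h\<close>.
\<close>

lemma deriv_bound_of_bound:
  fixes F :: "complex ^ 'n::finite \<Rightarrow> complex"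
  assumes F: "holo_on UNIV F" and D: "(F has_derivative D) (at z)" "\<And>c v. D (c *s v) = c * D v"
    and bound: "\<And>w. norm w \<le> R \<Longrightarrow> norm (F w) \<le> B" and R: "norm z < r" "r < R"
  shows "norm (D h) \<le> B / (R - r) * norm h"
proof (cases "h = 0")
  case True
  then show ?thesis using D(2)[of 0 0] by simp
next
  case False
  define \<delta> where "\<delta> = (R - r) / norm h"
  have \<delta>: "\<delta> > 0" using False R by (simp add: \<delta>_def)
  have hol: "(\<lambda>\<zeta>. F (z + \<zeta> *s h)) holomorphic_on UNIV"
    using holo_on_line[OF F, of z h] by simp
  have "((\<lambda>\<zeta>. F (z + \<zeta> *s h)) has_field_derivative D h) (at 0)"
    by (rule has_field_derivative_along_line) (use D in auto)
  then have Dh: "deriv (\<lambda>\<zeta>. F (z + \<zeta> *s h)) 0 = D h" by (rule DERIV_imp_deriv)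
  have "norm ((deriv ^^ 1) (\<lambda>\<zeta>. F (z + \<zeta> *s h)) 0) \<le> fact 1 * B / \<delta> ^ 1"
  proof (rule Cauchy_inequality)
    show "(\<lambda>\<zeta>. F (z + \<zeta> *s h)) holomorphic_on ball 0 \<delta>" using hol by (rule holomorphic_on_subset) simp
    show "continuous_on (cball 0 \<delta>) (\<lambda>\<zeta>. F (z + \<zeta> *s h))"
      using holomorphic_on_imp_continuous_on[OF hol] by (rule continuous_on_subset) simp
    fix x :: complex assume "norm (0 - x) = \<delta>"
    then have "norm (x *s h) = R - r" using False by (simp add: norm_vector_smult \<delta>_def)
    then show "norm (F (z + x *s h)) \<le> B"
      using norm_triangle_ineq[of z "x *s h"] R by (intro bound) simp
  qed (fact \<delta>)
  then show ?thesis using False by (simp add: Dh \<delta>_def)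
qed

text \<open>
  The derivatives of the homogeneous parts decay geometrically on smaller balls by Cauchy's estimate, so
  the series can be differentiated term by term; complex linearity passes to the limit.
\<close>

lemma pseries_holo_on:
  fixes a :: "'n::finite multi_index \<Rightarrow> complex"
  assumes a: "admissible a"
  shows "holo_on unit_ball (pseries a)"
  unfolding holo_on_def
proof
  fix z0 :: "complex ^ 'n" assume "z0 \<in> unit_ball"
  then have z0: "norm z0 < 1" by (simp add: unit_ball_def)
  define r where "r = (norm z0 + 1) / 2"
  define R where "R = (r + 1) / 2"
  define \<rho> where "\<rho> = (R + 1) / 2"
  have r: "norm z0 < r" "r < R" "R < \<rho>" "\<rho> < 1" "0 < r"
    using z0 by (auto simp: r_def R_def \<rho>_def add_nonneg_pos)
  then have R0: "0 < R" "0 < \<rho>" by auto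
  obtain M where M: "M \<ge> 0" "\<And>k z. norm (hpart a k z) \<le> M * (norm z / \<rho>) ^ k"
    using admissible_bound[OF a R0(2) r(4)] by blast
  have "\<forall>k z. \<exists>D. (hpart a k has_derivative D) (at z) \<and> (\<forall>c v. D (c *s v) = c * D v)"
    using holo_on_mi_poly[of UNIV] unfolding holo_on_def hpart_def by blast
  then obtain D where D: "\<And>k z. (hpart a k has_derivative D k z) (at z)" "\<And>k z c v. D k z (c *s v) = c * D k z v"
    by metis
  \<comment> \<open>Bounds hold on radius \<open>R\<close> with ratio \<open>q\<close>; the gap \<open>R - r\<close> pays for the derivative.\<close>
  define q where "q = R / \<rho>"
  have q: "0 < q" "q < 1" using r R0 by (auto simp: q_def)
  define C where "C = M / (R - r)"
  have C: "C \<ge> 0" using M r by (simp add: C_def)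
  have Dbound: "norm (D k z h) \<le> C * q ^ k * norm h" if z: "z \<in> ball 0 r" for k z h
  proof -
    have "norm (D k z h) \<le> (M * q ^ k) / (R - r) * norm h"
    proof (rule deriv_bound_of_bound[of "hpart a k"])
      show "holo_on UNIV (hpart a k)" unfolding hpart_def by (rule holo_on_mi_poly)
      show "norm (hpart a k w) \<le> M * q ^ k" if "norm w \<le> R" for w
        by (rule order_trans[OF M(2)])
          (use that M(1) R0 in \<open>auto intro!: mult_left_mono power_mono divide_right_mono simp: q_def\<close>)
      show "norm z < r" using z by simp
    qed (use D r in auto)
    then show ?thesis by (simp add: C_def)
  qed
  have summ: "summable (\<lambda>k. C * q ^ k * x)" for x :: real
    using q by (intro summable_mult summable_mult2 summable_geometric) auto
  define D' where "D' = (\<lambda>z h. \<Sum>k. D k z h)"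
  have Dsum: "summable (\<lambda>k. D k z h)" if "z \<in> ball 0 r" for z h
    by (rule summable_comparison_test'[OF summ Dbound[OF that]])
  have tail: "norm ((\<Sum>k<n. D k z h) - D' z h) \<le> C / (1 - q) * q ^ n * norm h" if z: "z \<in> ball 0 r" for n z h
  proof -
    have "D' z h - (\<Sum>k<n. D k z h) = (\<Sum>k. D (k + n) z h)"
      unfolding D'_def using suminf_minus_initial_segment[OF Dsum[OF z]] by simp
    also have "norm \<dots> \<le> (\<Sum>k. C * q ^ n * norm h * q ^ k)"
    proof (rule norm_suminf_le)
      show "norm (D (k + n) z h) \<le> C * q ^ n * norm h * q ^ k" for k
        using Dbound[OF z, of "k + n" h] by (simp add: power_add mult_ac)
      show "summable (\<lambda>k. C * q ^ n * norm h * q ^ k)"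
        using q by (intro summable_mult summable_geometric) auto
    qed
    also have "\<dots> = C * q ^ n * norm h * (1 / (1 - q))"
      using q by (subst suminf_mult) (auto simp: suminf_geometric summable_geometric)
    finally show ?thesis by (simp add: norm_minus_commute)
  qed
  have "\<exists>g. \<forall>x\<in>ball 0 r. (\<lambda>n. hpart a n x) sums (g x) \<and> (g has_derivative D' x) (at x within ball 0 r)"
  proof (rule has_derivative_series)
    show "convex (ball (0::complex ^ 'n) r)" by simp
    show "(hpart a n has_derivative D n x) (at x within ball 0 r)" for n x
      using D(1) by (rule has_derivative_at_withinI)
    show "z0 \<in> ball 0 r" using r by simp
    show "(\<lambda>n. hpart a n z0) sums pseries a z0" by (rule pseries_sums[OF a z0])
    fix e :: real assume e: "e > 0"
    have "(\<lambda>n. C / (1 - q) * q ^ n) \<longlonglongrightarrow> C / (1 - q) * 0"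
      using q by (intro tendsto_mult tendsto_const LIMSEQ_power_zero) auto
    then have ev: "\<forall>\<^sub>F n in sequentially. C / (1 - q) * q ^ n < e"
      using e by (intro order_tendstoD(2)) auto
    show "\<forall>\<^sub>F n in sequentially. \<forall>x\<in>ball 0 r. \<forall>h. norm ((\<Sum>i<n. D i x h) - D' x h) \<le> e * norm h"
    proof (rule eventually_mono[OF ev], intro ballI allI)
      fix n h and x :: "complex ^ 'n" assume n: "C / (1 - q) * q ^ n < e" and "x \<in> ball 0 r"
      from tail[OF this(2), of h n] mult_right_mono[OF less_imp_le[OF n] norm_ge_zero[of h]]
      show "norm ((\<Sum>i<n. D i x h) - D' x h) \<le> e * norm h" by (rule order_trans)
    qed
  qed
  then obtain g where g: "\<And>x. x \<in> ball 0 r \<Longrightarrow> (\<lambda>n. hpart a n x) sums (g x)"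
    "\<And>x. x \<in> ball 0 r \<Longrightarrow> (g has_derivative D' x) (at x within ball 0 r)"
    by blast
  have geq: "g x = pseries a x" if "x \<in> ball 0 r" for x
    using sums_unique2[OF g(1)[OF that] pseries_sums[OF a]] that r by auto
  have "(g has_derivative D' z0) (at z0)"
    using g(2)[of z0] r by (simp add: at_within_open[OF _ open_ball])
  then have "(pseries a has_derivative D' z0) (at z0)"
    by (rule has_derivative_transform_within_open[of _ _ _ _ "ball 0 r"]) (use r geq in auto)
  moreover have "D' z0 (c *s v) = c * D' z0 v" for c v
    unfolding D'_def D(2) using r by (intro suminf_mult Dsum) simp
  ultimately show "\<exists>D. (pseries a has_derivative D) (at z0) \<and> (\<forall>c v. D (c *s v) = c * D v)" by blast
qed

text \<open>
  Both sides equal the total derivative of \<open>g\<close> at \<open>z\<close> applied to the vector \<open>z\<close>.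
\<close>

lemma radial_deriv_eq_deriv_on_ray:
  fixes g :: "complex ^ 'n::finite \<Rightarrow> complex"
  assumes g: "holo_on S g" and z: "z \<in> S"
  shows "radial_deriv g z = deriv (\<lambda>\<mu>. g (\<mu> *s z)) 1"
proof -
  obtain D where D: "(g has_derivative D) (at z)" "\<And>c v. D (c *s v) = c * D v"
    using g z unfolding holo_on_def by blast
  have part: "partial_deriv i g z = D (axis i 1)" for i
  proof -
    let ?a = "\<chi> j. if j = i then 0 else z $ j"
    have *: "(\<chi> j. if j = i then \<zeta> else z $ j) = ?a + \<zeta> *s axis i 1" for \<zeta>
      by (auto simp: vec_eq_iff axis_def)
    have "?a + z $ i *s axis i 1 = z" by (auto simp: vec_eq_iff axis_def)
    then have "((\<lambda>\<zeta>. g (?a + \<zeta> *s axis i 1)) has_field_derivative D (axis i 1)) (at (z $ i))"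
      by (intro has_field_derivative_along_line) (use D in auto)
    moreover have "(\<lambda>\<zeta>. g (\<chi> j. if j = i then \<zeta> else z $ j)) = (\<lambda>\<zeta>. g (?a + \<zeta> *s axis i 1))"
      by (intro ext arg_cong[where f=g] *)
    ultimately show ?thesis unfolding partial_deriv_def by (simp only: DERIV_imp_deriv)
  qed
  have lin: "linear D" using D(1) by (rule has_derivative_linear)
  have "radial_deriv g z = (\<Sum>i\<in>UNIV. D (z $ i *s axis i 1))"
    by (simp add: radial_deriv_def part D(2))
  also have "\<dots> = D (\<Sum>i\<in>UNIV. z $ i *s axis i 1)" by (rule linear_sum[OF lin, symmetric])
  also have "(\<Sum>i\<in>UNIV. z $ i *s axis i 1) = z" by (rule basis_expansion)
  finally have 1: "radial_deriv g z = D z" .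
  have "((\<lambda>\<mu>. g (0 + \<mu> *s z)) has_field_derivative D z) (at 1)"
    by (rule has_field_derivative_along_line) (use D in auto)
  then show ?thesis using 1 DERIV_imp_deriv by fastforce
qed

definition deg_mult :: "('n::finite multi_index \<Rightarrow> complex) \<Rightarrow> 'n multi_index \<Rightarrow> complex" where
  "deg_mult a m = of_nat (mi_deg m) * a m"

lemma hpart_deg_mult: "hpart (deg_mult a) k z = of_nat k * hpart a k z"
  by (auto simp: hpart_def mi_poly_def deg_mult_def sum_distrib_left mult.assoc intro!: sum.cong)

lemma admissible_deg_mult:
  assumes a: "admissible a"
  shows "admissible (deg_mult a)"
  unfolding admissible_def
proof (intro allI impI)
  fix r :: real assume r: "0 < r \<and> r < 1"
  define \<rho> where "\<rho> = (r + 1) / 2"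
  have \<rho>: "0 < \<rho>" "\<rho> < 1" "r < \<rho>" using r by (auto simp: \<rho>_def)
  obtain M where M: "M \<ge> 0" "\<And>k z. norm (hpart a k z) \<le> M * (norm z / \<rho>) ^ k"
    using admissible_bound[OF a \<rho>(1,2)] by blast
  have "(\<lambda>k. real k * (r / \<rho>) ^ k) \<longlonglongrightarrow> 0"
    using \<rho> r by (intro powser_times_n_limit_0) auto
  then obtain B where B: "\<And>k. norm (real k * (r / \<rho>) ^ k) \<le> B"
    using convergentI convergent_imp_Bseq Bseq_def by metis
  have "norm (hpart (deg_mult a) k z) \<le> M * B" if z: "norm z \<le> r" for k z
  proof -
    have "norm (hpart (deg_mult a) k z) \<le> real k * (M * (norm z / \<rho>) ^ k)"
      using M(2)[of k z] by (simp add: hpart_deg_mult norm_mult mult_left_mono)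
    also have "\<dots> \<le> real k * (M * (r / \<rho>) ^ k)"
      using z M(1) \<rho> by (intro mult_left_mono power_mono divide_right_mono) auto
    also have "\<dots> = M * (real k * (r / \<rho>) ^ k)" by simp
    also have "\<dots> \<le> M * B" using B[of k] M(1) by (intro mult_left_mono) auto
    finally show ?thesis .
  qed
  then show "\<exists>M. \<forall>k z. norm z \<le> r \<longrightarrow> norm (hpart (deg_mult a) k z) \<le> M" by blast
qed

lemma pseries_scale_sums:
  assumes "admissible a" "norm (c *s z) < 1"
  shows "(\<lambda>k. hpart a k z * c ^ k) sums pseries a (c *s z)"
  using pseries_sums[OF assms] by (simp add: hpart_scale mult.commute)

text \<open>
  Along the ray through \<open>z\<close> the homogeneous expansion is an ordinary power series with radius of
  convergence above 1, so it can be differentiated term by term at 1.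
\<close>

lemma radial_deriv_pseries:
  fixes a :: "'n::finite multi_index \<Rightarrow> complex"
  assumes a: "admissible a" and z: "norm z < 1"
  shows "radial_deriv (pseries a) z = pseries (deg_mult a) z"
proof -
  obtain K where K: "K > 1" "K * norm z < 1"
  proof
    show "2 / (1 + norm z) > 1" using z by (simp add: pos_less_divide_eq add_pos_nonneg)
    show "2 / (1 + norm z) * norm z < 1" using z by (simp add: pos_divide_less_eq add_pos_nonneg)
  qed
  let ?c = "\<lambda>k. hpart a k z"
  have in_ball: "norm (\<mu> *s z) < 1" if "norm \<mu> < K" for \<mu>
    using K(2) mult_right_mono[OF less_imp_le[OF that] norm_ge_zero[of z]] by (simp add: norm_vector_smult)
  have "summable (\<lambda>k. ?c k * \<mu> ^ k)" if "norm \<mu> < K" for \<mu>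
    using sums_summable[OF pseries_scale_sums[OF a in_ball[OF that]]] .
  then have der: "((\<lambda>\<mu>. \<Sum>k. ?c k * \<mu> ^ k) has_field_derivative (\<Sum>k. diffs ?c k * 1 ^ k)) (at 1)"
    by (rule termdiffs_strong') (use K in auto)
  have "(\<lambda>k. of_nat k * ?c k) sums pseries (deg_mult a) z"
    using pseries_sums[OF admissible_deg_mult[OF a] z] by (simp add: hpart_deg_mult)
  then have "(\<lambda>k. diffs ?c k) sums pseries (deg_mult a) z"
    using sums_Suc_iff[of "\<lambda>k. of_nat k * ?c k"] by (simp add: diffs_def)
  then have "(\<Sum>k. diffs ?c k * 1 ^ k) = pseries (deg_mult a) z" by (simp add: sums_iff)
  with der have "((\<lambda>\<mu>. \<Sum>k. ?c k * \<mu> ^ k) has_field_derivative pseries (deg_mult a) z) (at 1)" by simp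
  then have "((\<lambda>\<mu>. pseries a (\<mu> *s z)) has_field_derivative pseries (deg_mult a) z) (at 1)"
  proof (rule has_field_derivative_transform_within_open[where S="ball 0 K"])
    show "(\<Sum>k. ?c k * \<mu> ^ k) = pseries a (\<mu> *s z)" if "\<mu> \<in> ball 0 K" for \<mu>
      using pseries_scale_sums[OF a in_ball[of \<mu>]] that by (simp add: sums_iff)
  qed (use K in auto)
  then show ?thesis
    using radial_deriv_eq_deriv_on_ray[OF pseries_holo_on[OF a]] z
    by (simp add: unit_ball_def DERIV_imp_deriv)
qed

lemma radial_deriv_cong:
  fixes f g :: "complex ^ 'n::finite \<Rightarrow> complex"
  assumes eq: "\<And>z. norm z < 1 \<Longrightarrow> f z = g z" and z: "norm z < 1"
  shows "radial_deriv f z = radial_deriv g z"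
proof -
  have "partial_deriv i f z = partial_deriv i g z" for i
    unfolding partial_deriv_def
  proof (rule deriv_cong_ev)
    let ?h = "\<lambda>\<zeta>. \<chi> j. if j = i then \<zeta> else z $ j"
    have "(?h \<longlongrightarrow> (\<chi> j. if j = i then z $ i else z $ j)) (nhds (z $ i))"
    proof (rule tendsto_vec_lambda)
      show "((\<lambda>\<zeta>. if j = i then \<zeta> else z $ j) \<longlongrightarrow> (if j = i then z $ i else z $ j)) (nhds (z $ i))" for j
        by (cases "j = i") (simp_all add: filterlim_ident)
    qed
    moreover have "(\<chi> j. if j = i then z $ i else z $ j) = z" by (simp add: vec_eq_iff)
    ultimately have "(?h \<longlongrightarrow> z) (nhds (z $ i))" by simp
    then have "\<forall>\<^sub>F \<zeta> in nhds (z $ i). ?h \<zeta> \<in> ball 0 1"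
      by (rule topological_tendstoD) (use z in auto)
    then show "\<forall>\<^sub>F \<zeta> in nhds (z $ i). f (?h \<zeta>) = g (?h \<zeta>)"
      by (rule eventually_mono) (auto intro: eq)
  qed simp
  then show ?thesis by (simp add: radial_deriv_def)
qed

lemma deg_mult_funpow: "(deg_mult ^^ j) a m = of_nat (mi_deg m) ^ j * a m"
  by (induction j) (auto simp: deg_mult_def)

lemma admissible_deg_mult_funpow: "admissible a \<Longrightarrow> admissible ((deg_mult ^^ j) a)"
  by (induction j) (auto intro: admissible_deg_mult)

lemma radial_deriv_funpow_pseries:
  assumes a: "admissible a" and z: "norm z < 1"
  shows "(radial_deriv ^^ j) (pseries a) z = pseries ((deg_mult ^^ j) a) z"
  using z
proof (induction j arbitrary: z)
  case (Suc j)
  have "(radial_deriv ^^ Suc j) (pseries a) z = radial_deriv (pseries ((deg_mult ^^ j) a)) z"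
    using radial_deriv_cong[OF Suc.IH Suc.prems] by simp
  also have "\<dots> = pseries ((deg_mult ^^ Suc j) a) z"
    by (simp add: radial_deriv_pseries[OF admissible_deg_mult_funpow[OF a] Suc.prems])
  finally show ?case .
qed simp

section \<open>Taylor coefficients of the kernel\<close>

lemma power_series_unique:
  fixes a b :: "nat \<Rightarrow> complex"
  assumes a: "\<And>z. norm z < 1 \<Longrightarrow> (\<lambda>k. a k * z ^ k) sums f z"
    and b: "\<And>z. norm z < 1 \<Longrightarrow> (\<lambda>k. b k * z ^ k) sums f z"
  shows "a = b"
proof (rule ccontr)
  assume "a \<noteq> b"
  then obtain m where m: "a m - b m \<noteq> 0" by auto
  have d: "(\<lambda>k. (a k - b k) * (z - 0) ^ k) sums 0" if "norm (z - 0) < 1" for z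
    using sums_diff[OF a[of z] b[of z]] that by (simp add: left_diff_distrib)
  have "(\<lambda>k. (a k - b k) * 0 ^ k) sums (a 0 - b 0)"
    using sums_If_finite_set[of "{0}" "\<lambda>k. a k - b k"] by (simp add: power_0_left if_distrib cong: if_cong)
  with d[of 0] have "a 0 - b 0 = 0" using sums_unique2 by fastforce
  with m have "m > 0" by (cases m) auto
  \<comment> \<open>A nonzero coefficient of positive order would make the zero function nonzero near 0.\<close>
  show False
  proof (rule powser_0_nonzero[where r=1 and \<xi>="0 :: complex" and a="\<lambda>k. a k - b k" and f="\<lambda>_. 0" and m=m])
    show "(\<lambda>k. (a k - b k) * (x - 0) ^ k) sums 0" if "norm (x - 0) < 1" for x
      using d that by blast
    show "a m - b m \<noteq> 0" "m > 0" by fact+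
    fix s :: real assume s: "0 < s" "\<And>z :: complex. z \<in> cball 0 s - {0} \<Longrightarrow> (0 :: complex) \<noteq> 0"
    have "complex_of_real s \<in> cball 0 s - {0}" using s(1) by simp
    from s(2)[OF this] show False by simp
  qed simp_all
qed

text \<open>
  Passing from \<open>N\<close> to \<open>N + 1\<close> multiplies the series by \<open>z - 1\<close>, so the new coefficients are the
  differences of consecutive old ones, and the quotients of factorials telescope.
\<close>

lemma log_fun_taylor_explicit:
  "\<exists>A::nat \<Rightarrow> real. (\<forall>z. norm z < 1 \<longrightarrow> (\<lambda>k. complex_of_real (A k) * z ^ k) sums log_fun N z) \<and>
     (\<forall>k>N. A k = fact N * fact (k - N - 1) / fact k)"
proof (induction N)
  case 0
  have L: "(\<lambda>k. complex_of_real (1 / real k) * z ^ k) sums log_fun 0 z" if z: "norm z < 1" for z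
  proof -
    have "Re (1 - z) > 0" using z complex_Re_le_cmod[of z] by simp
    then have "1 - z \<notin> \<real>\<^sub>\<le>\<^sub>0" by (auto simp: complex_nonpos_Reals_iff)
    then have eq: "log_fun 0 z = - Ln (1 - z)"
      using Ln_inverse[of "1 - z"] by (simp add: log_fun_def inverse_eq_divide)
    have "(\<lambda>n. - ((- (- z)) ^ n) / of_nat n) sums ln (1 + - z)"
      using z by (intro Ln_series') simp
    from sums_minus[OF this] show ?thesis by (simp add: eq)
  qed
  have "1 / real k = fact 0 * fact (k - 0 - 1) / fact k" if "k > 0" for k
    using that by (cases k) auto
  with L show ?case by (intro exI[of _ "\<lambda>k. 1 / real k"]) auto
next
  case (Suc N)
  then obtain A :: "nat \<Rightarrow> real" where
    A: "\<And>z. norm z < 1 \<Longrightarrow> (\<lambda>k. complex_of_real (A k) * z ^ k) sums log_fun N z" and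
    Aval: "\<And>k. k > N \<Longrightarrow> A k = fact N * fact (k - N - 1) / fact k"
    by blast
  define B where "B = (\<lambda>k. (if k = 0 then 0 else A (k - 1)) - A k)"
  have "(\<lambda>k. complex_of_real (B k) * z ^ k) sums log_fun (Suc N) z" if z: "norm z < 1" for z
  proof -
    have "(\<lambda>k. z * (complex_of_real (A k) * z ^ k)) sums (z * log_fun N z)"
      by (intro sums_mult A z)
    then have "(\<lambda>k. complex_of_real (if Suc k = 0 then 0 else A (Suc k - 1)) * z ^ Suc k)
        sums (z * log_fun N z)"
      by (simp add: mult_ac)
    then have "(\<lambda>k. complex_of_real (if k = 0 then 0 else A (k - 1)) * z ^ k) sums (z * log_fun N z)"
      by (subst (asm) sums_Suc_iff) simp
    from sums_diff[OF this A[OF z]] show ?thesis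
      by (simp add: B_def log_fun_def algebra_simps)
  qed
  moreover have "B k = fact (Suc N) * fact (k - Suc N - 1) / fact k" if k: "k > Suc N" for k
  proof -
    obtain j where j: "k = Suc (Suc N + j)" using k less_iff_Suc_add by auto
    have "B k = fact N * fact j / fact (Suc N + j) - fact N * fact (Suc j) / fact (Suc (Suc N + j))"
      using Aval[of "Suc N + j"] Aval[of k] by (simp add: B_def j)
    also have "\<dots> = fact N * fact j * (real (Suc (Suc N + j)) - real (Suc j)) / fact (Suc (Suc N + j))"
    proof -
      have frac: "a / F - a * c / (x * F) = a * (x - c) / (x * F)" if "x \<noteq> 0" for a c x F :: real
      proof -
        have "a / F = a * x / (x * F)" using that by simp
        then show ?thesis by (simp only: diff_divide_distrib[symmetric] right_diff_distrib)
      qed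
      have 1: "fact N * fact (Suc j) = (fact N * fact j) * real (Suc j)"
        by (simp only: fact_Suc ac_simps)
      have 2: "fact (Suc (Suc N + j)) = real (Suc (Suc N + j)) * fact (Suc N + j)" by (rule fact_Suc)
      show ?thesis unfolding 1 2 by (rule frac) simp
    qed
    also have "real (Suc (Suc N + j)) - real (Suc j) = real (Suc N)" by simp
    also have "fact N * fact j * real (Suc N) / fact (Suc (Suc N + j)) = fact (Suc N) * fact j / fact (Suc (Suc N + j))"
      by (simp add: mult_ac)
    finally show ?thesis by (simp add: j)
  qed
  ultimately show ?case by (intro exI[of _ B]) auto
qed

lemma log_fun_taylor_coeff:
  fixes A :: "nat \<Rightarrow> real"
  assumes A: "\<And>z. norm z < 1 \<Longrightarrow> (\<lambda>k. complex_of_real (A k) * z ^ k) sums log_fun N z"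
    and k: "k > N"
  shows "A k = fact N * fact (k - N - 1) / fact k"
proof -
  obtain B :: "nat \<Rightarrow> real" where
    B: "\<And>z. norm z < 1 \<Longrightarrow> (\<lambda>k. complex_of_real (B k) * z ^ k) sums log_fun N z"
      "\<And>k. k > N \<Longrightarrow> B k = fact N * fact (k - N - 1) / fact k"
    using log_fun_taylor_explicit[of N] by blast
  have "(\<lambda>k. complex_of_real (A k)) = (\<lambda>k. complex_of_real (B k))"
    by (rule power_series_unique[OF A B(1)])
  then have "A k = B k" by (metis of_real_eq_iff)
  with B(2)[OF k] show ?thesis by simp
qed

lemma mi_deg_upd: "mi_deg (m(i := Suc (m i))) = Suc (mi_deg m)"
proof -
  have "mi_deg (m(i := Suc (m i))) = (\<Sum>j\<in>UNIV. m j + (if j = i then 1 else 0))"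
    unfolding mi_deg_def by (intro sum.cong) auto
  then show ?thesis by (simp add: mi_deg_def sum.distrib)
qed

lemma mi_fact_upd: "mi_fact (m(i := Suc (m i))) = real (Suc (m i)) * mi_fact m"
proof -
  have "mi_fact (m(i := Suc (m i))) = (\<Prod>j\<in>UNIV. (if j = i then real (Suc (m i)) else 1) * fact (m j))"
    unfolding mi_fact_def by (intro prod.cong) auto
  then show ?thesis by (simp add: mi_fact_def prod.distrib)
qed

lemma mi_power_upd: "mi_power v (m(i := Suc (m i))) = v $ i * mi_power v m"
proof -
  have "mi_power v (m(i := Suc (m i))) = (\<Prod>j\<in>UNIV. (if j = i then v $ i else 1) * (v $ j) ^ m j)"
    unfolding mi_power_def by (intro prod.cong) auto
  then show ?thesis by (simp add: mi_power_def prod.distrib)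
qed

lemma mi_fact_pos: "mi_fact m > 0"
  by (auto simp: mi_fact_def intro: prod_pos)

text \<open>
  By induction on \<open>k\<close>: multiplying a monomial by \<open>v $ i\<close> raises its \<open>i\<close>-th exponent, and a monomial \<open>m\<close> of
  degree \<open>k + 1\<close> arises from index \<open>i\<close> with coefficient \<open>k! m\<^sub>i / m!\<close>; these add up to
  \<open>(k + 1)! / m!\<close> because the exponents add up to the degree.
\<close>

lemma multinomial_theorem:
  fixes v :: "complex ^ 'n::finite"
  shows "(\<Sum>i\<in>UNIV. v $ i) ^ k = (\<Sum>m | mi_deg m = k. of_real (fact k / mi_fact m) * mi_power v m)"
proof (induction k)
  case 0
  have "{m :: 'n multi_index. mi_deg m = 0} = {\<lambda>_. 0}" by (auto simp: mi_deg_def)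
  then show ?case by (simp add: mi_fact_def mi_power_def)
next
  case (Suc k)
  let ?s = "\<Sum>m | mi_deg m = k. of_real (fact k / mi_fact m) * mi_power v m"
  let ?h = "\<lambda>i m. complex_of_real (fact k / mi_fact m * real (m i)) * mi_power v m"
  have step: "v $ i * ?s
      = (\<Sum>m | mi_deg m = Suc k. ?h i m)" for i
  proof -
    have "v $ i * ?s
        = (\<Sum>m | mi_deg m = k. of_real (fact k / mi_fact m) * mi_power v (m(i := Suc (m i))))"
      by (simp add: sum_distrib_left mi_power_upd mult_ac)
    also have "\<dots> = (\<Sum>m\<in>{m. mi_deg m = Suc k \<and> m i > 0}. ?h i m)"
    proof (rule sum.reindex_bij_witness[of _ "\<lambda>m. m(i := m i - 1)" "\<lambda>m. m(i := Suc (m i))"])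
      fix m :: "'n multi_index" assume m: "m \<in> {m. mi_deg m = k}"
      show "(m(i := Suc (m i)))(i := (m(i := Suc (m i))) i - 1) = m" by simp
      show "m(i := Suc (m i)) \<in> {m. mi_deg m = Suc k \<and> 0 < m i}" using m by (simp add: mi_deg_upd)
      show "complex_of_real (fact k / mi_fact (m(i := Suc (m i))) * real ((m(i := Suc (m i))) i)) * mi_power v (m(i := Suc (m i)))
         = of_real (fact k / mi_fact m) * mi_power v (m(i := Suc (m i)))"
        by (simp add: mi_fact_upd)
    next
      fix m :: "'n multi_index" assume m: "m \<in> {m. mi_deg m = Suc k \<and> 0 < m i}"
      let ?m = "m(i := m i - 1)"
      have e: "?m(i := Suc (?m i)) = m" using m by auto
      then show "?m(i := Suc (?m i)) = m" .
      show "?m \<in> {m. mi_deg m = k}" using mi_deg_upd[of ?m i] m unfolding e by simp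
    qed
    also have "\<dots> = (\<Sum>m | mi_deg m = Suc k. ?h i m)"
      by (rule sum.mono_neutral_left) (auto simp: finite_mi_deg_eq)
    finally show ?thesis .
  qed
  have "(\<Sum>i\<in>UNIV. v $ i) ^ Suc k = (\<Sum>i\<in>UNIV. v $ i * ?s)"
    by (simp add: Suc.IH sum_distrib_right)
  also have "\<dots> = (\<Sum>i\<in>UNIV. \<Sum>m | mi_deg m = Suc k. ?h i m)"
    by (simp only: step)
  also have "\<dots> = (\<Sum>m | mi_deg m = Suc k. \<Sum>i\<in>UNIV. ?h i m)"
    by (rule sum.swap)
  also have "\<dots> = (\<Sum>m | mi_deg m = Suc k. of_real (fact (Suc k) / mi_fact m) * mi_power v m)"
  proof (rule sum.cong[OF refl])
    fix m :: "'n multi_index" assume "m \<in> {m. mi_deg m = Suc k}"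
    then have "(\<Sum>i\<in>UNIV. real (m i)) = real (Suc k)" by (simp add: mi_deg_def flip: of_nat_sum)
    then have "(\<Sum>i\<in>UNIV. fact k / mi_fact m * real (m i)) = fact (Suc k) / mi_fact m"
      by (simp only: sum_distrib_left[symmetric]) (simp add: mult_ac)
    then show "(\<Sum>i\<in>UNIV. complex_of_real (fact k / mi_fact m * real (m i)) * mi_power v m)
        = of_real (fact (Suc k) / mi_fact m) * mi_power v m"
      by (simp only: sum_distrib_right[symmetric] of_real_sum[symmetric])
  qed
  finally show ?case .
qed

lemma hinner_power:
  "hinner z w ^ k = (\<Sum>m | mi_deg m = k. of_real (fact k / mi_fact m) * (mi_power z m * mi_power (cnj_vec w) m))"
  using multinomial_theorem[of "\<chi> i. z $ i * cnj (w $ i)" k]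
  by (simp add: hinner_def mi_power_def cnj_vec_def power_mult_distrib prod.distrib)

lemma norm_hinner_le: "norm (hinner z w) \<le> norm z * norm w"
proof -
  have "norm (hinner z w) \<le> (\<Sum>j\<in>UNIV. \<bar>norm (z $ j)\<bar> * \<bar>norm (w $ j)\<bar>)"
    unfolding hinner_def by (rule sum_norm_le) (simp add: norm_mult)
  also have "\<dots> \<le> norm z * norm w" unfolding norm_vec_def by (rule L2_set_mult_ineq)
  finally show ?thesis .
qed

text \<open>
  The coefficient of \<open>z\<^sup>m w'\<^sup>m\<close> in the kernel, where \<open>w'\<close> is the conjugate of \<open>w\<close>.
\<close>

definition kernel_coeff :: "nat \<Rightarrow> ('n::finite multi_index \<Rightarrow> real) \<Rightarrow> (nat \<Rightarrow> real) \<Rightarrow> 'n multi_index \<Rightarrow> real" where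
  "kernel_coeff N \<omega> A m = (if mi_deg m \<le> N then \<omega> m else 0) + A (mi_deg m) * fact (mi_deg m) / mi_fact m"

lemma K_ker_expansion:
  fixes z w :: "complex ^ 'n::finite" and A :: "nat \<Rightarrow> real"
  assumes A: "\<And>z. norm z < 1 \<Longrightarrow> (\<lambda>k. complex_of_real (A k) * z ^ k) sums log_fun N z"
    and z: "norm z < 1" and w: "norm w < 1"
  shows "(\<lambda>k. hpart (\<lambda>m. of_real (kernel_coeff N \<omega> A m) * mi_power (cnj_vec w) m) k z) sums K_ker N \<omega> z w"
proof -
  define q where "q = (\<lambda>m. (if mi_deg m \<le> N then of_real (\<omega> m) else 0) * mi_power (cnj_vec w) m)"
  have "norm (hinner z w) < 1"
    using norm_hinner_le[of z w] mult_strict_mono[OF z w] z w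
      by (smt (verit) mult_left_le norm_ge_zero)
  from A[OF this] have 1: "(\<lambda>k. complex_of_real (A k) * hinner z w ^ k) sums log_fun N (hinner z w)" .
  have "(\<lambda>k. hpart q k z) sums (\<Sum>k<Suc N. hpart q k z)"
  proof (rule sums_finite)
    show "hpart q k z = 0" if "k \<notin> {..<Suc N}" for k
      using that by (auto simp: hpart_def mi_poly_def q_def intro!: sum.neutral)
  qed simp
  also have "(\<Sum>k<Suc N. hpart q k z) = Q_poly N \<omega> z w"
    by (auto simp: mi_poly_mi_below[symmetric] mi_poly_def Q_poly_def q_def mi_below_def less_Suc_eq_le mult_ac intro!: sum.cong)
  finally have "(\<lambda>k. hpart q k z + complex_of_real (A k) * hinner z w ^ k) sums K_ker N \<omega> z w"
    unfolding K_ker_def using 1 by (rule sums_add)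
  also have "(\<lambda>k. hpart q k z + complex_of_real (A k) * hinner z w ^ k)
      = (\<lambda>k. hpart (\<lambda>m. of_real (kernel_coeff N \<omega> A m) * mi_power (cnj_vec w) m) k z)"
  proof
    fix k
    have "hpart q k z + complex_of_real (A k) * hinner z w ^ k
        = (\<Sum>m | mi_deg m = k. q m * mi_power z m + of_real (A k) * (of_real (fact k / mi_fact m) * (mi_power z m * mi_power (cnj_vec w) m)))"
      by (simp add: hpart_def mi_poly_def hinner_power sum_distrib_left sum.distrib)
    also have "\<dots> = hpart (\<lambda>m. of_real (kernel_coeff N \<omega> A m) * mi_power (cnj_vec w) m) k z"
      unfolding hpart_def mi_poly_def
      by (intro sum.cong refl) (auto simp: q_def kernel_coeff_def algebra_simps)
    finally show "hpart q k z + complex_of_real (A k) * hinner z w ^ k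
        = hpart (\<lambda>m. of_real (kernel_coeff N \<omega> A m) * mi_power (cnj_vec w) m) k z" .
  qed
  finally show ?thesis .
qed

lemma kernel_coeff_large:
  fixes A :: "nat \<Rightarrow> real"
  assumes A: "\<And>z. norm z < 1 \<Longrightarrow> (\<lambda>k. complex_of_real (A k) * z ^ k) sums log_fun N z"
    and m: "mi_deg m > N"
  shows "kernel_coeff N \<omega> A m = fact N * fact (mi_deg m - N - 1) / mi_fact m"
  using m by (simp add: kernel_coeff_def log_fun_taylor_coeff[OF A m])

lemma kernel_coeff_pos:
  fixes A :: "nat \<Rightarrow> real"
  assumes A: "\<And>z. norm z < 1 \<Longrightarrow> (\<lambda>k. complex_of_real (A k) * z ^ k) sums log_fun N z"
    and \<omega>: "\<And>m. mi_deg m \<le> N \<Longrightarrow> \<omega> m > - (fact (mi_deg m) * A (mi_deg m) / mi_fact m)"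
  shows "kernel_coeff N \<omega> A m > 0"
proof (cases "mi_deg m \<le> N")
  case True
  then show ?thesis using \<omega>[OF True] by (simp add: kernel_coeff_def mult.commute)
next
  case False
  then show ?thesis using mi_fact_pos[of m] by (simp add: kernel_coeff_large[OF A])
qed

section \<open>The sequence space of square summable families\<close>

definition ell2 :: "('i \<Rightarrow> complex) set" where
  "ell2 = {u. (\<lambda>i. (norm (u i))\<^sup>2) summable_on UNIV}"

definition ell2_inner :: "('i \<Rightarrow> complex) \<Rightarrow> ('i \<Rightarrow> complex) \<Rightarrow> complex" where
  "ell2_inner u v = (\<Sum>\<^sub>\<infinity>i. u i * cnj (v i))"

definition ell2_norm :: "('i \<Rightarrow> complex) \<Rightarrow> real" where
  "ell2_norm u = sqrt (\<Sum>\<^sub>\<infinity>i. (norm (u i))\<^sup>2)"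

lemma ell2_finite_sum_le:
  assumes "u \<in> ell2" "finite F"
  shows "L2_set (\<lambda>i. norm (u i)) F \<le> ell2_norm u"
  using assms unfolding L2_set_def ell2_norm_def ell2_def
  by (auto intro!: finite_sum_le_infsum)

text \<open>
  Membership in \<open>ell2\<close> and bounds for the norm are both tested on finite index sets, which reduces the triangle
  inequality and completeness to facts about finite sums.
\<close>

lemma ell2_of_finite_sums:
  assumes "\<And>F. finite F \<Longrightarrow> L2_set (\<lambda>i. norm (u i)) F \<le> B"
  shows "u \<in> ell2" "ell2_norm u \<le> B"
proof -
  have B: "B \<ge> 0" using assms[of "{}"] by simp
  have le: "(\<Sum>i\<in>F. (norm (u i))\<^sup>2) \<le> B\<^sup>2" if "finite F" for F
    using assms[OF that] unfolding L2_set_def by (rule sqrt_le_D)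
  have "(\<lambda>i. (norm (u i))\<^sup>2) summable_on UNIV"
    by (rule nonneg_bdd_above_summable_on) (auto intro!: bdd_aboveI2[where M="B\<^sup>2"] le)
  then show "u \<in> ell2" by (simp add: ell2_def)
  have "(\<Sum>\<^sub>\<infinity>i. (norm (u i))\<^sup>2) \<le> B\<^sup>2"
    by (rule infsum_le_finite_sums) (use le \<open>u \<in> ell2\<close> in \<open>auto simp: ell2_def\<close>)
  then show "ell2_norm u \<le> B" unfolding ell2_norm_def using B by (simp add: real_le_lsqrt)
qed

lemma ell2_zero: "(\<lambda>i. 0) \<in> ell2"
  by (simp add: ell2_def)

lemma ell2_add:
  assumes "u \<in> ell2" "v \<in> ell2"
  shows "(\<lambda>i. u i + v i) \<in> ell2" "ell2_norm (\<lambda>i. u i + v i) \<le> ell2_norm u + ell2_norm v"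
proof -
  have fin: "L2_set (\<lambda>i. norm (u i + v i)) F \<le> ell2_norm u + ell2_norm v" if F: "finite F" for F
  proof -
    have "L2_set (\<lambda>i. norm (u i + v i)) F \<le> L2_set (\<lambda>i. norm (u i) + norm (v i)) F"
      by (rule L2_set_mono) (auto intro: norm_triangle_ineq)
    also have "\<dots> \<le> L2_set (\<lambda>i. norm (u i)) F + L2_set (\<lambda>i. norm (v i)) F"
      by (rule L2_set_triangle_ineq)
    also have "\<dots> \<le> ell2_norm u + ell2_norm v"
      using assms F by (intro add_mono ell2_finite_sum_le)
    finally show ?thesis .
  qed
  show "(\<lambda>i. u i + v i) \<in> ell2" by (rule ell2_of_finite_sums(1)[OF fin])
  show "ell2_norm (\<lambda>i. u i + v i) \<le> ell2_norm u + ell2_norm v" by (rule ell2_of_finite_sums(2)[OF fin])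
qed

lemma ell2_scale: "u \<in> ell2 \<Longrightarrow> (\<lambda>i. c * u i) \<in> ell2"
  by (simp add: ell2_def norm_mult power_mult_distrib summable_on_cmult_right)

lemma ell2_diff:
  assumes "u \<in> ell2" "v \<in> ell2"
  shows "(\<lambda>i. u i - v i) \<in> ell2"
  using ell2_add(1)[OF assms(1) ell2_scale[OF assms(2), of "-1"]] by simp

lemma ell2_prod_summable:
  assumes "u \<in> ell2" "v \<in> ell2"
  shows "(\<lambda>i. u i * cnj (v i)) summable_on UNIV"
proof (rule abs_summable_summable, rule summable_on_comparison_test)
  show "(\<lambda>i. (norm (u i))\<^sup>2 + (norm (v i))\<^sup>2) summable_on UNIV"
    using assms by (intro summable_on_add) (auto simp: ell2_def)
  show "norm (u i * cnj (v i)) \<le> (norm (u i))\<^sup>2 + (norm (v i))\<^sup>2" for i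
    using sum_squares_bound[of "norm (u i)" "norm (v i)"] mult_nonneg_nonneg[OF norm_ge_zero[of "u i"] norm_ge_zero[of "v i"]]
    unfolding norm_mult complex_mod_cnj mult.assoc by linarith
qed simp

lemma ell2_inner_self:
  assumes "u \<in> ell2"
  shows "ell2_inner u u = complex_of_real (\<Sum>\<^sub>\<infinity>i. (norm (u i))\<^sup>2)"
proof -
  have "((\<lambda>i. complex_of_real ((norm (u i))\<^sup>2)) has_sum complex_of_real (\<Sum>\<^sub>\<infinity>i. (norm (u i))\<^sup>2)) UNIV"
    unfolding has_sum_of_real_iff using assms by (intro has_sum_infsum) (simp add: ell2_def)
  then show ?thesis
    unfolding ell2_inner_def by (simp only: infsumI complex_norm_square[symmetric])
qed

lemma ell2_norm_eq_inner: "u \<in> ell2 \<Longrightarrow> ell2_norm u = sqrt (Re (ell2_inner u u))"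
  by (simp add: ell2_inner_self ell2_norm_def)

lemma ell2_norm_nonneg: "ell2_norm u \<ge> 0"
  by (simp add: ell2_norm_def infsum_nonneg)

lemma ell2_norm_eq_0:
  assumes "u \<in> ell2" "ell2_norm u = 0"
  shows "u = (\<lambda>i. 0)"
proof
  fix i
  have "L2_set (\<lambda>i. norm (u i)) {i} \<le> 0" using ell2_finite_sum_le[OF assms(1), of "{i}"] assms(2) by simp
  then show "u i = 0" by simp
qed

lemma ell2_norm_minus_commute: "ell2_norm (\<lambda>i. u i - v i) = ell2_norm (\<lambda>i. v i - u i)"
  by (simp add: ell2_norm_def norm_minus_commute)

text \<open>
  The limit is taken coordinatewise; a bound that holds for all differences of late members passes to
  the limit on every finite index set.
\<close>

lemma ell2_complete:
  fixes s :: "nat \<Rightarrow> 'i \<Rightarrow> complex"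
  assumes s: "\<And>n. s n \<in> ell2"
    and cauchy: "\<And>e. e > 0 \<Longrightarrow> \<exists>N. \<forall>n\<ge>N. \<forall>n'\<ge>N. ell2_norm (\<lambda>i. s n i - s n' i) < e"
  obtains t where "t \<in> ell2" "\<And>e. e > 0 \<Longrightarrow> \<exists>N. \<forall>n\<ge>N. ell2_norm (\<lambda>i. s n i - t i) < e"
proof -
  have "Cauchy (\<lambda>n. s n i)" for i
  proof (rule metric_CauchyI)
    fix e :: real assume "e > 0"
    then obtain N where N: "\<And>n n'. n \<ge> N \<Longrightarrow> n' \<ge> N \<Longrightarrow> ell2_norm (\<lambda>i. s n i - s n' i) < e"
      using cauchy by blast
    have "dist (s n i) (s n' i) < e" if "n \<ge> N" "n' \<ge> N" for n n'
      using ell2_finite_sum_le[OF ell2_diff[OF s s], of "{i}" n n'] N[OF that] by (simp add: dist_norm)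
    then show "\<exists>N. \<forall>m\<ge>N. \<forall>n\<ge>N. dist (s m i) (s n i) < e" by blast
  qed
  then have "\<forall>i. \<exists>l. (\<lambda>n. s n i) \<longlonglongrightarrow> l" using Cauchy_convergent convergent_def by blast
  then obtain t where t: "\<And>i. (\<lambda>n. s n i) \<longlonglongrightarrow> t i" by metis
  have close: "(\<lambda>i. s n i - t i) \<in> ell2 \<and> ell2_norm (\<lambda>i. s n i - t i) \<le> e"
    if N: "\<And>n n'. n \<ge> N \<Longrightarrow> n' \<ge> N \<Longrightarrow> ell2_norm (\<lambda>i. s n i - s n' i) < e" and n: "n \<ge> N" for n N e
  proof -
    have "L2_set (\<lambda>i. norm (s n i - t i)) F \<le> e" if F: "finite F" for F
    proof (rule LIMSEQ_le_const2)
      show "(\<lambda>n'. L2_set (\<lambda>i. norm (s n i - s n' i)) F) \<longlonglongrightarrow> L2_set (\<lambda>i. norm (s n i - t i)) F"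
        unfolding L2_set_def by (intro tendsto_intros t)
      show "\<exists>M. \<forall>n'\<ge>M. L2_set (\<lambda>i. norm (s n i - s n' i)) F \<le> e"
        using ell2_finite_sum_le[OF ell2_diff[OF s s] F] N[OF n] by (intro exI[of _ N]) (meson less_imp_le order_trans)
    qed
    from ell2_of_finite_sums[OF this] show ?thesis by simp
  qed
  obtain N where N: "\<And>n n'. n \<ge> N \<Longrightarrow> n' \<ge> N \<Longrightarrow> ell2_norm (\<lambda>i. s n i - s n' i) < 1"
    using cauchy[of 1] by auto
  have "(\<lambda>i. s N i - (s N i - t i)) \<in> ell2"
    by (rule ell2_diff[OF s conjunct1[OF close[OF N order_refl]]])
  then have "t \<in> ell2" by simp
  then show ?thesis
  proof (rule that)
    fix e :: real assume e: "e > 0"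
    then obtain N where "\<And>n n'. n \<ge> N \<Longrightarrow> n' \<ge> N \<Longrightarrow> ell2_norm (\<lambda>i. s n i - s n' i) < e / 2"
      using cauchy[of "e / 2"] by auto
    then have "ell2_norm (\<lambda>i. s n i - t i) \<le> e / 2" if "n \<ge> N" for n using close that by blast
    then show "\<exists>N. \<forall>n\<ge>N. ell2_norm (\<lambda>i. s n i - t i) < e"
      using e by (intro exI[of _ N] allI impI) (rule le_less_trans[of _ "e / 2"], auto)
  qed
qed

definition transported_inner ::
    "(('i \<Rightarrow> complex) \<Rightarrow> 'a \<Rightarrow> complex) \<Rightarrow> ('a \<Rightarrow> complex) \<Rightarrow> ('a \<Rightarrow> complex) \<Rightarrow> complex" where
  "transported_inner \<Phi> f g = ell2_inner (inv_into ell2 \<Phi> f) (inv_into ell2 \<Phi> g)"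

lemma transported_inner_eq:
  assumes "inj_on \<Phi> ell2" "u \<in> ell2" "v \<in> ell2"
  shows "transported_inner \<Phi> (\<Phi> u) (\<Phi> v) = ell2_inner u v"
  using assms by (simp add: transported_inner_def inv_into_f_f)

text \<open>
  The inner product is transported along the bijection with \<open>ell2\<close>.  Linearity is a hypothesis on \<open>ell2\<close>
  only, because outside of it the series that defines the map of interest may diverge.
\<close>

lemma hilbert_space_on_ell2_image:
  fixes \<Phi> :: "('i \<Rightarrow> complex) \<Rightarrow> 'a \<Rightarrow> complex"
  assumes inj: "inj_on \<Phi> ell2"
    and add: "\<And>u v. u \<in> ell2 \<Longrightarrow> v \<in> ell2 \<Longrightarrow> \<Phi> (\<lambda>i. u i + v i) = (\<lambda>x. \<Phi> u x + \<Phi> v x)"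
    and scale: "\<And>c u. u \<in> ell2 \<Longrightarrow> \<Phi> (\<lambda>i. c * u i) = (\<lambda>x. c * \<Phi> u x)"
  shows "hilbert_space_on (\<Phi> ` ell2) (transported_inner \<Phi>)"
proof -
  let ?V = "\<Phi> ` ell2" and ?ip = "transported_inner \<Phi>"
  note ip = transported_inner_eq[OF inj]
  have zero: "\<Phi> (\<lambda>i. 0) = (\<lambda>x. 0)" using scale[OF ell2_zero, of 0] by simp
  have diff: "\<Phi> (\<lambda>i. u i - v i) = (\<lambda>x. \<Phi> u x - \<Phi> v x)" if "u \<in> ell2" "v \<in> ell2" for u v
    using add[OF that(1) ell2_scale[OF that(2), of "-1"]] scale[OF that(2), of "-1"] by simp
  have sub: "function_subspace ?V"
    unfolding function_subspace_def
  proof (intro conjI ballI allI)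
    show "(\<lambda>x. 0) \<in> ?V" using ell2_zero zero by (metis imageI)
    show "(\<lambda>x. f x + g x) \<in> ?V" if "f \<in> ?V" "g \<in> ?V" for f g
      using that ell2_add(1) by (force simp flip: add)
    show "(\<lambda>x. c * f x) \<in> ?V" if "f \<in> ?V" for c f
      using that ell2_scale by (force simp flip: scale)
  qed
  have inner: "inner_product_on ?V ?ip"
    unfolding inner_product_on_def
  proof (intro conjI ballI allI impI)
    fix f g h assume "f \<in> ?V" "g \<in> ?V" "h \<in> ?V"
    then obtain u v w where f: "f = \<Phi> u" "u \<in> ell2" and g: "g = \<Phi> v" "v \<in> ell2" and h: "h = \<Phi> w" "w \<in> ell2"
      by blast
    show "?ip (\<lambda>x. f x + g x) h = ?ip f h + ?ip g h"
      using f g h ell2_prod_summable[OF f(2) h(2)] ell2_prod_summable[OF g(2) h(2)]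
      by (simp add: ip ell2_add(1) ell2_inner_def infsum_add distrib_right flip: add)
  next
    fix c f g assume "f \<in> ?V" "g \<in> ?V"
    then obtain u v where f: "f = \<Phi> u" "u \<in> ell2" and g: "g = \<Phi> v" "v \<in> ell2" by blast
    show "?ip (\<lambda>x. c * f x) g = c * ?ip f g"
      using f g by (simp add: ip ell2_scale ell2_inner_def infsum_cmult_right' mult.assoc flip: scale)
  next
    fix f g assume "f \<in> ?V" "g \<in> ?V"
    then obtain u v where f: "f = \<Phi> u" "u \<in> ell2" and g: "g = \<Phi> v" "v \<in> ell2" by blast
    show "?ip g f = cnj (?ip f g)"
      using f g by (simp add: ip ell2_inner_def mult.commute flip: infsum_cnj)
  next
    fix f assume "f \<in> ?V"
    then obtain u where f: "f = \<Phi> u" "u \<in> ell2" by blast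
    show "?ip f f \<in> \<real>" "0 \<le> Re (?ip f f)" using f by (simp_all add: ip ell2_inner_self infsum_nonneg)
    show "f = (\<lambda>x. 0)" if "?ip f f = 0"
      using that f ell2_norm_eq_0[of u] zero by (simp add: ip ell2_norm_eq_inner)
  qed
  let ?d = "\<lambda>f g. if f \<in> ?V \<and> g \<in> ?V then ip_dist ?ip f g else 0"
  have dist: "?d (\<Phi> u) (\<Phi> v) = ell2_norm (\<lambda>i. u i - v i)" if "u \<in> ell2" "v \<in> ell2" for u v
    using that by (simp add: ip_dist_def ip ell2_diff ell2_norm_eq_inner flip: diff)
  have metric: "Metric_space ?V ?d"
  proof
    show "0 \<le> ?d f g" for f g
    proof (cases "f \<in> ?V \<and> g \<in> ?V")
      case True
      then obtain u v where "f = \<Phi> u" "u \<in> ell2" "g = \<Phi> v" "v \<in> ell2" by blast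
      then show ?thesis using dist[of u v] ell2_norm_nonneg[of "\<lambda>i. u i - v i"] by simp
    qed auto
    show "?d f g = ?d g f" for f g
    proof (cases "f \<in> ?V \<and> g \<in> ?V")
      case True
      then obtain u v where "f = \<Phi> u" "u \<in> ell2" "g = \<Phi> v" "v \<in> ell2" by blast
      then show ?thesis using dist[of u v] dist[of v u] ell2_norm_minus_commute[of u v] by simp
    qed auto
    show "(?d f g = 0) = (f = g)" if "f \<in> ?V" "g \<in> ?V" for f g
    proof -
      obtain u v where uv: "f = \<Phi> u" "u \<in> ell2" "g = \<Phi> v" "v \<in> ell2"
        using \<open>f \<in> ?V\<close> \<open>g \<in> ?V\<close> by blast
      have eq: "ell2_norm (\<lambda>i. u i - v i) = 0 \<longleftrightarrow> u = v"
      proof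
        assume "ell2_norm (\<lambda>i. u i - v i) = 0"
        from ell2_norm_eq_0[OF ell2_diff[OF uv(2,4)] this]
        have "u i - v i = 0" for i by (rule fun_cong)
        then show "u = v" by (intro ext) simp
      qed (simp add: ell2_norm_def)
      show ?thesis
        unfolding uv(1,3) dist[OF uv(2,4)] eq inj_on_eq_iff[OF inj uv(2,4)] by (rule refl)
    qed
    show "?d f h \<le> ?d f g + ?d g h" if "f \<in> ?V" "g \<in> ?V" "h \<in> ?V" for f g h
    proof -
      obtain u v w where uvw: "f = \<Phi> u" "u \<in> ell2" "g = \<Phi> v" "v \<in> ell2" "h = \<Phi> w" "w \<in> ell2"
        using \<open>f \<in> ?V\<close> \<open>g \<in> ?V\<close> \<open>h \<in> ?V\<close> by blast
      have "ell2_norm (\<lambda>i. u i - w i) \<le> ell2_norm (\<lambda>i. u i - v i) + ell2_norm (\<lambda>i. v i - w i)"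
        using ell2_add(2)[OF ell2_diff[OF uvw(2,4)] ell2_diff[OF uvw(4,6)]] by simp
      then show ?thesis
        unfolding uvw(1,3,5) dist[OF uvw(2,4)] dist[OF uvw(4,6)] dist[OF uvw(2,6)] .
    qed
  qed
  interpret Metric_space ?V ?d by (rule metric)
  have "mcomplete"
    unfolding mcomplete_def
  proof (intro allI impI)
    fix \<sigma> assume "MCauchy \<sigma>"
    then have \<sigma>: "\<And>n. \<sigma> n \<in> ?V" and
      c: "\<And>e. e > 0 \<Longrightarrow> \<exists>N. \<forall>n n'. N \<le> n \<longrightarrow> N \<le> n' \<longrightarrow> ?d (\<sigma> n) (\<sigma> n') < e"
      unfolding MCauchy_def by blast+
    have "\<forall>n. \<exists>u. u \<in> ell2 \<and> \<sigma> n = \<Phi> u" using \<sigma> by blast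
    from choice[OF this] obtain s where "\<forall>n. s n \<in> ell2 \<and> \<sigma> n = \<Phi> (s n)" ..
    then have s: "\<And>n. s n \<in> ell2" "\<And>n. \<sigma> n = \<Phi> (s n)" by simp_all
    have ds: "?d (\<sigma> n) (\<sigma> n') = ell2_norm (\<lambda>i. s n i - s n' i)" for n n'
      unfolding s(2) by (rule dist[OF s(1) s(1)])
    have "\<exists>N. \<forall>n\<ge>N. \<forall>n'\<ge>N. ell2_norm (\<lambda>i. s n i - s n' i) < e" if "e > 0" for e
      using c[OF that] unfolding ds by blast
    then obtain t where t: "t \<in> ell2" "\<And>e. e > 0 \<Longrightarrow> \<exists>N. \<forall>n\<ge>N. ell2_norm (\<lambda>i. s n i - t i) < e"
      using ell2_complete[of s, OF s(1)] by blast
    have dt: "?d (\<sigma> n) (\<Phi> t) = ell2_norm (\<lambda>i. s n i - t i)" for n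
      unfolding s(2) by (rule dist[OF s(1) t(1)])
    have "limitin mtopology \<sigma> (\<Phi> t) sequentially"
      unfolding limit_metric_sequentially dt using t \<sigma> by blast
    then show "\<exists>x. limitin mtopology \<sigma> x sequentially" by blast
  qed
  with sub inner show ?thesis unfolding hilbert_space_on_def by blast
qed

section \<open>The weighted space and its kernel\<close>

lemma measurable_pseries:
  assumes "admissible a"
  shows "pseries a \<in> borel_measurable borel"
proof -
  have "(\<lambda>z. if z \<in> unit_ball then pseries a z else 0) \<in> borel_measurable borel"
    using holo_on_imp_continuous_on[OF pseries_holo_on[OF assms]]
    by (intro borel_measurable_continuous_on_if) (auto simp: unit_ball_def)
  also have "(\<lambda>z. if z \<in> unit_ball then pseries a z else 0) = pseries a"
    by (auto simp: pseries_def)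
  finally show ?thesis .
qed

text \<open>
  Finiteness in one direction is Bessel's inequality and in the other direction Fatou's lemma.
\<close>

lemma pseries_square_integral_finite_iff:
  assumes b: "admissible b"
  shows "(\<integral>\<^sup>+z. ennreal ((norm (pseries b z))\<^sup>2) \<partial>bergman_measure \<beta> 1) < \<infinity>
     \<longleftrightarrow> (\<lambda>m. (norm (b m))\<^sup>2 * bergman_norm \<beta> m) summable_on UNIV"
    (is "?I < \<infinity> \<longleftrightarrow> ?S")
proof
  let ?f = "\<lambda>m. (norm (b m))\<^sup>2 * bergman_norm \<beta> m"
  have nonneg: "0 \<le> ?f m" for m
    using bergman_norm_pos[of \<beta> m] by simp
  {
    assume "?I < \<infinity>"
    then have I: "?I = ennreal (enn2real ?I)" by (simp add: less_top)
    have "(\<Sum>m\<in>F. ?f m) \<le> enn2real ?I" if "finite F" for F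
    proof -
      have "ennreal (\<Sum>m\<in>F. ?f m) \<le> ennreal (enn2real ?I)"
        using mi_poly_sq_nn_integral_le[OF measurable_pseries[OF b] pseries_uniform_limit[OF b] that, of \<beta>] I
        by simp
      then show ?thesis by (simp add: ennreal_le_iff)
    qed
    then show ?S
      by (intro nonneg_bdd_above_summable_on nonneg bdd_aboveI2[where M="enn2real ?I"]) auto
  next
    assume S: ?S
    have "?I \<le> ennreal (\<Sum>\<^sub>\<infinity>m. ?f m)"
    proof (rule nn_integral_le_of_mi_poly[OF measurable_pseries[OF b]])
      show "(\<lambda>K. mi_poly (mi_below K) b z) \<longlonglongrightarrow> pseries b z" if "norm z < 1" for z
        using pseries_sums[OF b that] by (simp add: sums_def mi_poly_mi_below)
      show "(\<Sum>m\<in>F. ?f m) \<le> (\<Sum>\<^sub>\<infinity>m. ?f m)"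
        if "finite F" for F
        using S that nonneg by (intro finite_sum_le_infsum) auto
    qed
    then show "?I < \<infinity>" by (simp add: le_less_trans)
  }
qed

text \<open>
  Bessel's inequality for the difference, which represents the zero function.
\<close>

lemma pseries_injective:
  fixes a b :: "'n::finite multi_index \<Rightarrow> complex"
  assumes a: "admissible a" and b: "admissible b" and eq: "pseries a = pseries b"
  shows "a = b"
proof
  fix m
  define d where "d = (\<lambda>m. a m - b m)"
  have hd: "hpart d k z = hpart a k z - hpart b k z" for k z
    by (simp add: d_def hpart_def mi_poly_def left_diff_distrib sum_subtractf)
  have d: "admissible d"
    unfolding admissible_def
  proof (intro allI impI)
    fix \<rho> :: real assume \<rho>: "0 < \<rho> \<and> \<rho> < 1"
    obtain M M' where "\<And>k z. norm z \<le> \<rho> \<Longrightarrow> norm (hpart a k z) \<le> M" "\<And>k z. norm z \<le> \<rho> \<Longrightarrow> norm (hpart b k z) \<le> M'"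
      using a b \<rho> unfolding admissible_def by meson
    then have "norm (hpart d k z) \<le> M + M'" if "norm z \<le> \<rho>" for k z
      unfolding hd using that by (intro order_trans[OF norm_triangle_ineq4] add_mono) auto
    then show "\<exists>M. \<forall>k z. norm z \<le> \<rho> \<longrightarrow> norm (hpart d k z) \<le> M" by blast
  qed
  have "pseries d z = 0" for z
  proof (cases "z \<in> unit_ball")
    case True
    then have z: "norm z < 1" by (simp add: unit_ball_def)
    from sums_diff[OF pseries_sums[OF a z] pseries_sums[OF b z]] pseries_sums[OF d z] eq
    show ?thesis by (simp add: hd sums_unique2)
  qed (simp add: pseries_def)
  then have "(\<integral>\<^sup>+z. ennreal ((norm (pseries d z))\<^sup>2) \<partial>bergman_measure 0 1) = 0" by simp
  then have "ennreal (\<Sum>m\<in>{m}. (norm (d m))\<^sup>2 * bergman_norm 0 m) \<le> 0"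
    using mi_poly_sq_nn_integral_le[OF measurable_pseries[OF d] pseries_uniform_limit[OF d], of "{m}" 0] by simp
  then have "(norm (d m))\<^sup>2 * bergman_norm 0 m \<le> 0" by (simp add: ennreal_eq_0_iff)
  then have "d m = 0" using bergman_norm_pos[of 0 m] by (simp add: mult_le_0_iff)
  then show "a m = b m" by (simp add: d_def)
qed

text \<open>
  The factors \<open>(1 - \<bar>z\<bar>\<^sup>2)\<^sup>k\<close>, squared, and \<open>(1 - \<bar>z\<bar>\<^sup>2)\<^sup>\<alpha>\<close> combine to the integral power \<open>\<beta>\<close>.
\<close>

lemma square_integrable_dv_iff:
  fixes a :: "'n::finite multi_index \<Rightarrow> complex"
  assumes a: "admissible a" and \<beta>: "real \<beta> = 2 * real k + \<alpha>"
  shows "square_integrable (dv_measure \<alpha>)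
       (\<lambda>z. complex_of_real ((1 - (norm z)\<^sup>2) ^ k) * (radial_deriv ^^ k) (pseries a) z)
     \<longleftrightarrow> (\<integral>\<^sup>+z. ennreal ((norm (pseries ((deg_mult ^^ k) a) z))\<^sup>2) \<partial>bergman_measure \<beta> 1) < \<infinity>"
proof -
  let ?b = "(deg_mult ^^ k) a"
  let ?g = "\<lambda>z. complex_of_real ((1 - (norm z)\<^sup>2) ^ k) * (radial_deriv ^^ k) (pseries a) z"
  let ?R = "restrict_space lborel unit_ball :: (complex ^ 'n) measure"
  have b: "admissible ?b" by (rule admissible_deg_mult_funpow[OF a])
  have [measurable]: "pseries ?b \<in> borel_measurable borel" by (rule measurable_pseries[OF b])
  have sp: "space ?R = unit_ball" by (simp add: space_restrict_space)
  have g_eq: "?g z = complex_of_real ((1 - (norm z)\<^sup>2) ^ k) * pseries ?b z" if "z \<in> unit_ball" for z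
    using radial_deriv_funpow_pseries[OF a, of z k] that by (simp add: unit_ball_def)
  have "(\<lambda>z. complex_of_real ((1 - (norm z)\<^sup>2) ^ k) * pseries ?b z) \<in> borel_measurable ?R"
    by (intro measurable_restrict_space1) measurable
  then have mg: "?g \<in> borel_measurable ?R"
    by (subst measurable_cong[OF g_eq]) (simp_all add: sp)
  have mg': "?g \<in> borel_measurable (dv_measure \<alpha>)"
    using mg by (simp add: dv_measure_def)
  have mw: "(\<lambda>z. ennreal ((1 - (norm z)\<^sup>2) powr \<alpha>)) \<in> borel_measurable ?R"
    by (intro measurable_restrict_space1) measurable
  have msq: "(\<lambda>z. ennreal ((norm (?g z))\<^sup>2)) \<in> borel_measurable ?R"
    by (rule measurable_compose[OF mg, of "\<lambda>x. ennreal ((norm x)\<^sup>2)"]) measurable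
  have "(\<integral>\<^sup>+z. ennreal ((norm (?g z))\<^sup>2) \<partial>dv_measure \<alpha>)
      = (\<integral>\<^sup>+z. ennreal ((1 - (norm z)\<^sup>2) powr \<alpha>) * ennreal ((norm (?g z))\<^sup>2) \<partial>?R)"
    unfolding dv_measure_def by (rule nn_integral_density[OF mw msq])
  also have "\<dots> = (\<integral>\<^sup>+z. ennreal ((1 - (norm z)\<^sup>2) powr \<alpha>) * ennreal ((norm (?g z))\<^sup>2) * indicator unit_ball z \<partial>lborel)"
    by (rule nn_integral_restrict_space) (simp add: unit_ball_def)
  also have "\<dots> = (\<integral>\<^sup>+z. ennreal (bergman_density \<beta> 1 z) * ennreal ((norm (pseries ?b z))\<^sup>2) \<partial>lborel)"
  proof (rule nn_integral_cong)
    fix z :: "complex ^ 'n"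
    show "ennreal ((1 - (norm z)\<^sup>2) powr \<alpha>) * ennreal ((norm (?g z))\<^sup>2) * indicator unit_ball z
      = ennreal (bergman_density \<beta> 1 z) * ennreal ((norm (pseries ?b z))\<^sup>2)"
    proof (cases "z \<in> unit_ball")
      case True
      then have z: "norm z < 1" by (simp add: unit_ball_def)
      define s where "s = 1 - (norm z)\<^sup>2"
      have s: "s > 0" using z by (simp add: s_def abs_square_less_1)
      have "s powr \<alpha> * (s ^ k)\<^sup>2 = s powr \<alpha> * s powr real (2 * k)"
        using s by (simp only: powr_realpow) (simp add: power_mult[symmetric] mult.commute)
      also have "\<dots> = s powr real \<beta>" by (simp add: powr_add[symmetric] \<beta> add.commute)
      also have "\<dots> = s ^ \<beta>" using s by (simp only: powr_realpow)
      finally have w: "s powr \<alpha> * (s ^ k)\<^sup>2 = s ^ \<beta>" .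
      have ng: "norm (?g z) = s ^ k * norm (pseries ?b z)"
      proof -
        have "norm (?g z) = norm (complex_of_real (s ^ k) * pseries ?b z)"
          by (rule arg_cong[where f=norm], subst g_eq[OF True]) (simp add: s_def)
        then show ?thesis using s by (simp add: norm_mult norm_power)
      qed
      have "s powr \<alpha> * (norm (?g z))\<^sup>2 = s ^ \<beta> * (norm (pseries ?b z))\<^sup>2"
        unfolding ng w[symmetric] by (simp add: power_mult_distrib)
      then show ?thesis
        using True z s by (simp add: bergman_density_def s_def ennreal_mult'[symmetric])
    qed (simp add: pseries_def)
  qed
  also have "\<dots> = (\<integral>\<^sup>+z. ennreal ((norm (pseries ?b z))\<^sup>2) \<partial>bergman_measure \<beta> 1)"
    unfolding bergman_measure_def by (rule nn_integral_density[symmetric]) measurable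
  finally have I: "(\<integral>\<^sup>+z. ennreal ((norm (?g z))\<^sup>2) \<partial>dv_measure \<alpha>)
      = (\<integral>\<^sup>+z. ennreal ((norm (pseries ?b z))\<^sup>2) \<partial>bergman_measure \<beta> 1)" .
  have "(\<lambda>z. (norm (?g z))\<^sup>2) \<in> borel_measurable (dv_measure \<alpha>)"
    by (rule measurable_compose[OF mg', of "\<lambda>x. (norm x)\<^sup>2"]) measurable
  then show ?thesis
    unfolding square_integrable_def integrable_iff_bounded I[symmetric] using mg' by simp
qed

text \<open>
  The quotient of the factorials is a product of \<open>j\<close> factors between \<open>p + 1\<close> and \<open>p + j\<close>.
\<close>

lemma fact_ratio_bounds:
  "real (p + 1) ^ j * fact p \<le> fact (p + j)" "fact (p + j) \<le> real (p + j) ^ j * fact p"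
proof -
  show "real (p + 1) ^ j * fact p \<le> fact (p + j)"
  proof (induction j)
    case (Suc j)
    have "real (p + 1) ^ Suc j * fact p = real (p + 1) * (real (p + 1) ^ j * fact p)" by simp
    also have "\<dots> \<le> real (Suc (p + j)) * fact (p + j)" by (intro mult_mono Suc.IH) auto
    finally show ?case by (simp only: fact_Suc add_Suc_right)
  qed simp
  have "fact (p + j) \<le> real x ^ j * fact p" if "p + j \<le> x" for x
    using that
  proof (induction j)
    case (Suc j)
    have "fact (p + Suc j) = real (Suc (p + j)) * fact (p + j)" by (simp only: fact_Suc add_Suc_right)
    also have "\<dots> \<le> real x * (real x ^ j * fact p)" using Suc by (intro mult_mono Suc.IH) auto
    finally show ?case by simp
  qed simp
  then show "fact (p + j) \<le> real (p + j) ^ j * fact p" by blast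
qed

text \<open>
  With \<open>p = \<bar>m\<bar> - N - 1\<close> the relation between \<open>k\<close> and \<open>\<beta>\<close> turns the denominator of \<open>bergman_norm\<close> into
  \<open>(p + 2 k)!\<close>, so the product of the two weights is a constant times
  \<open>\<bar>m\<bar>\<^sup>2\<^sup>k p! / (p + 2 k)!\<close>.  It is bounded from both sides because \<open>\<bar>m\<bar> \<le> (N + 1) (p + 1)\<close> and
  \<open>p + 2 k \<le> (1 + 2 k) \<bar>m\<bar>\<close>.
\<close>

lemma bergman_norm_comparable:
  fixes c :: "'n::finite multi_index \<Rightarrow> real"
  assumes c: "\<And>m. mi_deg m > N \<Longrightarrow> c m = fact N * fact (mi_deg m - N - 1) / mi_fact m"
    and k: "2 * k = \<beta> + N + CARD('n) + 1"
  obtains C where "\<And>m. mi_deg m > N \<Longrightarrow> real (mi_deg m) ^ (2 * k) * bergman_norm \<beta> m \<le> C * (1 / c m)"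
    "\<And>m. mi_deg m > N \<Longrightarrow> 1 / c m \<le> C * (real (mi_deg m) ^ (2 * k) * bergman_norm \<beta> m)"
proof -
  define D where "D = pi ^ CARD('n) * fact \<beta> * fact N"
  have D: "D > 0" by (simp add: D_def)
  define C where "C = max (D * real (N + 1) ^ (2 * k)) (real (1 + 2 * k) ^ (2 * k) / D)"
  have main: "real (mi_deg m) ^ (2 * k) * bergman_norm \<beta> m * c m \<le> D * real (N + 1) ^ (2 * k) \<and>
      1 \<le> real (1 + 2 * k) ^ (2 * k) / D * (real (mi_deg m) ^ (2 * k) * bergman_norm \<beta> m * c m)"
    if m: "mi_deg m > N" for m :: "'n multi_index"
  proof -
    define p where "p = mi_deg m - N - 1"
    have K: "mi_deg m = p + N + 1" using m by (simp add: p_def)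
    have idx: "mi_deg m + CARD('n) + \<beta> = p + 2 * k" using k K by simp
    define q where "q = real (mi_deg m) ^ (2 * k) * fact p / fact (p + 2 * k)"
    have eq: "real (mi_deg m) ^ (2 * k) * bergman_norm \<beta> m * c m = D * q"
      using mi_fact_pos[of m] by (simp add: bergman_norm_def c[OF m] idx D_def q_def p_def)
    have "real (mi_deg m) ^ (2 * k) * fact p \<le> (real (N + 1) * real (p + 1)) ^ (2 * k) * fact p"
      by (intro mult_right_mono power_mono) (auto simp: K algebra_simps)
    also have "\<dots> = real (N + 1) ^ (2 * k) * (real (p + 1) ^ (2 * k) * fact p)"
      by (simp only: power_mult_distrib mult.assoc)
    also have "\<dots> \<le> real (N + 1) ^ (2 * k) * fact (p + 2 * k)"
      by (intro mult_left_mono fact_ratio_bounds) simp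
    finally have up: "q \<le> real (N + 1) ^ (2 * k)"
      unfolding q_def by (subst pos_divide_le_eq) simp_all
    have "fact (p + 2 * k) \<le> real (p + 2 * k) ^ (2 * k) * fact p" by (rule fact_ratio_bounds)
    also have "\<dots> \<le> (real (1 + 2 * k) * real (mi_deg m)) ^ (2 * k) * fact p"
    proof (intro mult_right_mono power_mono)
      have "p + 2 * k \<le> mi_deg m + 2 * k * mi_deg m" by (intro add_mono) (auto simp: K)
      then have "p + 2 * k \<le> (1 + 2 * k) * mi_deg m" by simp
      then show "real (p + 2 * k) \<le> real (1 + 2 * k) * real (mi_deg m)"
        by (simp only: of_nat_le_iff of_nat_mult[symmetric])
    qed auto
    also have "\<dots> = real (1 + 2 * k) ^ (2 * k) * (real (mi_deg m) ^ (2 * k) * fact p)"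
      by (simp only: power_mult_distrib mult.assoc)
    finally have lo: "1 \<le> real (1 + 2 * k) ^ (2 * k) * q"
      unfolding q_def times_divide_eq_right by (subst pos_le_divide_eq) simp_all
    show ?thesis unfolding eq using up lo D by simp
  qed
  show ?thesis
  proof (rule that[of C])
    fix m :: "'n multi_index" assume m: "mi_deg m > N"
    have cm: "c m > 0" using mi_fact_pos[of m] by (simp add: c[OF m])
    let ?x = "real (mi_deg m) ^ (2 * k) * bergman_norm \<beta> m"
    have x: "?x \<ge> 0" using bergman_norm_pos[of \<beta> m] by simp
    have "?x * c m \<le> C"
      unfolding C_def by (rule order_trans[OF conjunct1[OF main[OF m]] max.cobounded1])
    then show "?x \<le> C * (1 / c m)" using cm by (simp add: pos_le_divide_eq)
    have "1 \<le> real (1 + 2 * k) ^ (2 * k) / D * (?x * c m)" using main[OF m] by simp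
    also have "\<dots> \<le> C * (?x * c m)" using x cm unfolding C_def
      by (intro mult_right_mono max.cobounded2 mult_nonneg_nonneg[OF x]) simp
    finally show "1 / c m \<le> C * ?x" using cm by (simp add: pos_divide_le_eq mult.assoc)
  qed
qed

text \<open>
  Only high degrees are comparable, so finitely many indices have to be set aside.
\<close>

lemma summable_on_comparison_cofinite:
  fixes f g :: "'i \<Rightarrow> real"
  assumes g: "g summable_on UNIV" and F: "finite F"
    and le: "\<And>i. i \<notin> F \<Longrightarrow> f i \<le> C * g i" and nonneg: "\<And>i. 0 \<le> f i"
  shows "f summable_on UNIV"
proof -
  have "(\<lambda>i. C * g i) summable_on (UNIV - F)"
    by (rule summable_on_cmult_right[OF summable_on_cofin_subset[OF g F]])
  then have "f summable_on (UNIV - F)"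
    by (rule summable_on_comparison_test) (use le nonneg in auto)
  from summable_on_Un_disjoint[OF summable_on_finite[OF F] this] show ?thesis by simp
qed

text \<open>
  The equivalence \<open>iff\<close> shows at the same time that the choice of \<open>k\<close> in the definition of \<open>A2\<close> is
  immaterial: its right-hand side does not mention \<open>k\<close>.
\<close>

lemma A2_eq_weighted_pseries:
  fixes c :: "'n::finite multi_index \<Rightarrow> real" and \<alpha> :: real
  assumes \<alpha>: "real CARD('n) + 1 + \<alpha> = - real N"
    and c: "\<And>m. mi_deg m > N \<Longrightarrow> c m = fact N * fact (mi_deg m - N - 1) / mi_fact m"
    and pos: "\<And>m. c m > 0"
  shows "A2 \<alpha> = {pseries a | a. admissible a \<and> (\<lambda>m. (norm (a m))\<^sup>2 / c m) summable_on UNIV}" (is "_ = ?W")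
proof -
  let ?w = "\<lambda>a. (\<lambda>m. (norm (a m))\<^sup>2 / c m) summable_on UNIV"
  let ?sq = "\<lambda>k f. square_integrable (dv_measure \<alpha>) (\<lambda>z. complex_of_real ((1 - (norm z)\<^sup>2) ^ k) * (radial_deriv ^^ k) f z)"
  have iff: "?sq k (pseries a)
     \<longleftrightarrow> ?w a"
    if a: "admissible a" and k: "2 * k = \<beta> + N + CARD('n) + 1" for k \<beta> and a :: "'n multi_index \<Rightarrow> complex"
  proof -
    have "2 * real k = real \<beta> + real N + real CARD('n) + 1" using k by (metis of_nat_1 of_nat_add of_nat_mult of_nat_numeral)
    then have \<beta>: "real \<beta> = 2 * real k + \<alpha>" using \<alpha> by simp
    obtain C where C: "\<And>m. mi_deg m > N \<Longrightarrow> real (mi_deg m) ^ (2 * k) * bergman_norm \<beta> m \<le> C * (1 / c m)"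
      "\<And>m. mi_deg m > N \<Longrightarrow> 1 / c m \<le> C * (real (mi_deg m) ^ (2 * k) * bergman_norm \<beta> m)"
      using bergman_norm_comparable[OF c k] by blast
    let ?f = "\<lambda>m. (norm ((deg_mult ^^ k) a m))\<^sup>2 * bergman_norm \<beta> m"
    have f: "?f m = (norm (a m))\<^sup>2 * (real (mi_deg m) ^ (2 * k) * bergman_norm \<beta> m)" for m
      by (simp add: deg_mult_funpow norm_mult norm_power power_mult_distrib power_mult[symmetric] mult_ac)
    have low: "mi_deg m > N" if "m \<notin> mi_below (Suc N)" for m :: "'n multi_index"
      using that by (simp add: mi_below_def)
    have "?f summable_on UNIV \<longleftrightarrow> ?w a"
    proof
      assume "?f summable_on UNIV"
      then show "?w a"
      proof (rule summable_on_comparison_cofinite[OF _ finite_mi_below[of "Suc N"]])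
        fix m :: "'n multi_index" assume "m \<notin> mi_below (Suc N)"
        from mult_left_mono[OF C(2)[OF low[OF this]], of "(norm (a m))\<^sup>2"]
        show "(norm (a m))\<^sup>2 / c m \<le> C * ?f m" unfolding f by (simp add: mult_ac)
      qed (use pos in \<open>auto simp: less_imp_le\<close>)
    next
      assume "?w a"
      then show "?f summable_on UNIV"
      proof (rule summable_on_comparison_cofinite[OF _ finite_mi_below[of "Suc N"]])
        fix m :: "'n multi_index" assume "m \<notin> mi_below (Suc N)"
        from mult_left_mono[OF C(1)[OF low[OF this]], of "(norm (a m))\<^sup>2"]
        show "?f m \<le> C * ((norm (a m))\<^sup>2 / c m)" unfolding f by (simp add: mult_ac)
      qed (intro mult_nonneg_nonneg less_imp_le[OF bergman_norm_pos] zero_le_power2)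
    qed
    then show ?thesis
      by (simp only: square_integrable_dv_iff[OF a \<beta>] pseries_square_integral_finite_iff[OF admissible_deg_mult_funpow[OF a]])
  qed
  show ?thesis
  proof (intro subset_antisym subsetI)
    fix f :: "complex ^ 'n \<Rightarrow> complex" assume "f \<in> A2 \<alpha>"
    then obtain k where ext: "zero_ext f = f" and hol: "holo_on unit_ball f" and k: "2 * real k + \<alpha> > -1"
      and sq: "?sq k f"
      unfolding A2_def by blast
    obtain a where a: "admissible a" "\<And>z. norm z < 1 \<Longrightarrow> (\<lambda>k. hpart a k z) sums f z"
      using holo_on_ball_expansion[OF hol] by blast
    have "pseries a z = f z" for z
    proof (cases "z \<in> unit_ball")
      case True
      then have z: "norm z < 1" by (simp add: unit_ball_def)
      show ?thesis by (rule sums_unique2[OF pseries_sums[OF a(1) z] a(2)[OF z]])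
    next
      case False
      then show ?thesis using fun_cong[OF ext, of z] by (simp add: pseries_def zero_ext_def)
    qed
    then have fa: "f = pseries a" by auto
    have "real (2 * k) \<ge> real (N + CARD('n) + 1)"
    proof -
      have "real (2 * k) > real (N + CARD('n))" using k \<alpha> by simp
      then show ?thesis by (simp only: of_nat_less_iff of_nat_le_iff)
    qed
    then have "N + CARD('n) + 1 \<le> 2 * k" by (simp only: of_nat_le_iff)
    \<comment> \<open>Here \<open>\<beta>\<close> is the difference in parentheses, which does not truncate.\<close>
    then have "2 * k = (2 * k - (N + CARD('n) + 1)) + N + CARD('n) + 1" by simp
    from iff[OF a(1) this] sq a(1) fa
    show "f \<in> ?W" by blast
  next
    fix f :: "complex ^ 'n \<Rightarrow> complex"
    assume "f \<in> ?W"
    then obtain a where f: "f = pseries a" and a: "admissible a" "?w a"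
      by blast
    define k where "k = N + CARD('n) + 1"
    have "2 * k = (N + CARD('n) + 1) + N + CARD('n) + 1" by (simp add: k_def)
    from iff[OF a(1) this] a(2)
    have "?sq k f"
      by (simp add: f)
    moreover have "2 * real k + \<alpha> > -1" using \<alpha> by (simp add: k_def)
    moreover have "zero_ext f = f" by (auto simp: f zero_ext_def pseries_def)
    ultimately show "f \<in> A2 \<alpha>"
      unfolding A2_def using pseries_holo_on[OF a(1)] f by blast
  qed
qed

lemma mi_power_cnj_vec: "mi_power (cnj_vec w) m = cnj (mi_power w m)"
  by (simp add: mi_power_def cnj_vec_def)

lemma norm_power_multinomial:
  fixes z :: "complex ^ 'n::finite"
  shows "(\<Sum>m | mi_deg m = k. fact k / mi_fact m * (norm (mi_power z m))\<^sup>2) = (norm z)\<^sup>2 ^ k"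
proof -
  have "hinner z z = complex_of_real ((norm z)\<^sup>2)"
    by (simp add: hinner_def norm_sq_vec complex_norm_square[symmetric])
  then have "complex_of_real ((norm z)\<^sup>2 ^ k)
      = (\<Sum>m | mi_deg m = k. of_real (fact k / mi_fact m) * (mi_power z m * cnj (mi_power z m)))"
    using hinner_power[of z z k] by (simp add: mi_power_cnj_vec)
  also have "\<dots> = complex_of_real (\<Sum>m | mi_deg m = k. fact k / mi_fact m * (norm (mi_power z m))\<^sup>2)"
    by (simp only: of_real_sum of_real_mult complex_norm_square)
  finally show ?thesis unfolding of_real_eq_iff by (rule sym)
qed

text \<open>
  In degree \<open>k > N\<close> the sum is \<open>A\<^sub>k \<bar>z\<bar>\<^sup>2\<^sup>k\<close> by the multinomial theorem, and these coefficients are bounded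
  by \<open>N!\<close>.
\<close>

lemma kernel_coeff_sum_bounded:
  fixes c :: "'n::finite multi_index \<Rightarrow> real"
  assumes c: "\<And>m. mi_deg m > N \<Longrightarrow> c m = fact N * fact (mi_deg m - N - 1) / mi_fact m"
    and pos: "\<And>m. c m > 0"
  obtains B where "B \<ge> 0" "\<And>k z. norm z \<le> 1 \<Longrightarrow> (\<Sum>m | mi_deg m = k. c m * (norm (mi_power z m))\<^sup>2) \<le> B"
proof -
  let ?S = "\<lambda>k z. \<Sum>m | mi_deg m = k. c m * (norm (mi_power z m))\<^sup>2"
  define B where "B = fact N + (\<Sum>m\<in>mi_below (Suc N). c m)"
  have s0: "(\<Sum>m\<in>mi_below (Suc N). c m) \<ge> 0" using pos by (intro sum_nonneg) (auto simp: less_imp_le)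
  have "?S k z \<le> B"
    if z: "norm z \<le> 1" for k and z :: "complex ^ 'n"
  proof (cases "k \<le> N")
    case True
    have "?S k z \<le> (\<Sum>m | mi_deg m = k. c m)"
      using norm_mi_power_le_one[OF z] pos
      by (intro sum_mono mult_left_le) (auto simp: less_imp_le power_le_one)
    also have "\<dots> \<le> (\<Sum>m\<in>mi_below (Suc N). c m)"
      using True pos by (intro sum_mono2 finite_mi_below) (auto simp: mi_below_def less_imp_le)
    finally show ?thesis using fact_ge_zero[of N, where 'a=real] unfolding B_def by linarith
  next
    case False
    have "?S k z
        = fact N * fact (k - N - 1) / fact k * (\<Sum>m | mi_deg m = k. fact k / mi_fact m * (norm (mi_power z m))\<^sup>2)"
      unfolding sum_distrib_left using False by (intro sum.cong refl) (simp add: c)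
    also have "\<dots> = fact N * (fact (k - N - 1) / fact k * (norm z)\<^sup>2 ^ k)"
      unfolding norm_power_multinomial by simp
    also have "\<dots> \<le> fact N * 1"
    proof (intro mult_left_mono mult_le_one)
      show "fact (k - N - 1) / fact k \<le> (1 :: real)" by (simp add: fact_mono)
      show "(norm z)\<^sup>2 ^ k \<le> 1" using z by (simp add: power_le_one)
    qed simp_all
    finally show ?thesis using s0 unfolding B_def by linarith
  qed
  moreover have "B \<ge> 0" using s0 by (simp add: B_def)
  ultimately show ?thesis using that by blast
qed

text \<open>
  Splitting each term by \<open>x y \<le> x\<^sup>2 + y\<^sup>2\<close> bounds a homogeneous part by the squared norm of \<open>u\<close> plus the
  degree-wise sum of the kernel on the diagonal.
\<close>

lemma weighted_ell2_admissible:
  fixes c :: "'n::finite multi_index \<Rightarrow> real"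
  assumes pos: "\<And>m. c m > 0"
    and B: "\<And>k z. norm z \<le> 1 \<Longrightarrow> (\<Sum>m | mi_deg m = k. c m * (norm (mi_power z m))\<^sup>2) \<le> B"
    and u: "u \<in> ell2"
  shows "admissible (\<lambda>m. complex_of_real (sqrt (c m)) * u m)"
  unfolding admissible_def
proof (intro allI impI)
  fix \<rho> :: real assume \<rho>: "0 < \<rho> \<and> \<rho> < 1"
  let ?a = "\<lambda>m. complex_of_real (sqrt (c m)) * u m"
  have "norm (hpart ?a k z) \<le> (\<Sum>\<^sub>\<infinity>m. (norm (u m))\<^sup>2) + B" if z: "norm z \<le> \<rho>" for k z
  proof -
    have "norm (hpart ?a k z) \<le> (\<Sum>m | mi_deg m = k. (norm (u m))\<^sup>2 + c m * (norm (mi_power z m))\<^sup>2)"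
      unfolding hpart_def mi_poly_def
    proof (rule sum_norm_le)
      fix m :: "'n multi_index"
      let ?t = "sqrt (c m) * norm (mi_power z m)"
      have "norm (?a m * mi_power z m) = norm (u m) * ?t"
        using pos[of m] by (simp add: norm_mult mult_ac)
      also have "\<dots> \<le> (norm (u m))\<^sup>2 + ?t\<^sup>2"
      proof -
        have "0 \<le> norm (u m) * ?t" using pos[of m] by (intro mult_nonneg_nonneg) (auto simp: less_imp_le)
        then show ?thesis using sum_squares_bound[of "norm (u m)" ?t] unfolding mult.assoc by linarith
      qed
      also have "?t\<^sup>2 = c m * (norm (mi_power z m))\<^sup>2"
        using pos[of m] by (simp add: power_mult_distrib less_imp_le)
      finally show "norm (?a m * mi_power z m) \<le> (norm (u m))\<^sup>2 + c m * (norm (mi_power z m))\<^sup>2" .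
    qed
    also have "\<dots> = (\<Sum>m | mi_deg m = k. (norm (u m))\<^sup>2) + (\<Sum>m | mi_deg m = k. c m * (norm (mi_power z m))\<^sup>2)"
      by (rule sum.distrib)
    also have "\<dots> \<le> (\<Sum>\<^sub>\<infinity>m. (norm (u m))\<^sup>2) + B"
      using u z \<rho> by (intro add_mono B finite_sum_le_infsum) (auto simp: ell2_def finite_mi_deg_eq)
    finally show ?thesis .
  qed
  then show "\<exists>M. \<forall>k z. norm z \<le> \<rho> \<longrightarrow> norm (hpart ?a k z) \<le> M" by blast
qed

text \<open>
  The squared norm of this sequence is the value of the kernel on the diagonal at \<open>w\<close>; scaling \<open>w\<close> to the
  closed ball makes its homogeneous parts decay geometrically.
\<close>

lemma weighted_monomials_ell2:
  fixes c :: "'n::finite multi_index \<Rightarrow> real"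
  assumes pos: "\<And>m. c m > 0" and B0: "B \<ge> 0"
    and B: "\<And>k z. norm z \<le> 1 \<Longrightarrow> (\<Sum>m | mi_deg m = k. c m * (norm (mi_power z m))\<^sup>2) \<le> B"
    and w: "norm w < 1"
  shows "(\<lambda>m. complex_of_real (sqrt (c m)) * cnj (mi_power w m)) \<in> ell2"
proof -
  define \<rho> where "\<rho> = (norm w + 1) / 2"
  have \<rho>: "0 < \<rho>" "\<rho> < 1" "norm w \<le> \<rho>" using w by (auto simp: \<rho>_def add_nonneg_pos)
  define v where "v = complex_of_real (1 / \<rho>) *s w"
  have wv: "w = complex_of_real \<rho> *s v" using \<rho> by (simp add: v_def vector_smult_assoc)
  have nv: "norm v \<le> 1" using \<rho> by (simp add: v_def norm_vector_smult norm_divide)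
  let ?f = "\<lambda>m. c m * (norm (mi_power w m))\<^sup>2"
  have f0: "?f m \<ge> 0" for m using pos[of m] by simp
  have sq: "(norm (complex_of_real (sqrt (c m)) * cnj (mi_power w m)))\<^sup>2 = ?f m" for m
    using pos[of m] by (simp add: norm_mult power_mult_distrib less_imp_le)
  have q: "0 \<le> \<rho>\<^sup>2" "\<rho>\<^sup>2 < 1" using \<rho> by (auto simp: abs_square_less_1)
  have part: "(\<Sum>m | mi_deg m = k. ?f m) \<le> B * (\<rho>\<^sup>2) ^ k" for k
  proof -
    have "(\<Sum>m | mi_deg m = k. ?f m) = (\<Sum>m | mi_deg m = k. (\<rho>\<^sup>2) ^ k * (c m * (norm (mi_power v m))\<^sup>2))"
    proof (rule sum.cong[OF refl])
      fix m :: "'n multi_index" assume "m \<in> {m. mi_deg m = k}"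
      then have "norm (mi_power w m) = \<rho> ^ k * norm (mi_power v m)"
        using \<rho> by (subst wv) (simp add: mi_power_scale norm_mult norm_power)
      then show "?f m = (\<rho>\<^sup>2) ^ k * (c m * (norm (mi_power v m))\<^sup>2)"
        by (simp add: power_mult_distrib power_mult[symmetric] mult.commute)
    qed
    also have "\<dots> = (\<rho>\<^sup>2) ^ k * (\<Sum>m | mi_deg m = k. c m * (norm (mi_power v m))\<^sup>2)"
      by (rule sum_distrib_left[symmetric])
    also have "\<dots> \<le> (\<rho>\<^sup>2) ^ k * B" using B[OF nv] by (intro mult_left_mono) auto
    finally show ?thesis by (simp add: mult.commute)
  qed
  have geo: "summable (\<lambda>k. B * (\<rho>\<^sup>2) ^ k)" using q by (intro summable_mult summable_geometric) simp
  have "?f summable_on UNIV"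
  proof (rule nonneg_bdd_above_summable_on)
    show "bdd_above (sum ?f ` {F. F \<subseteq> UNIV \<and> finite F})"
    proof (rule bdd_aboveI2)
      fix F :: "'n multi_index set" assume "F \<in> {F. F \<subseteq> UNIV \<and> finite F}"
      then have F: "finite F" by simp
      define K where "K = Suc (Max (mi_deg ` F))"
      have "F \<subseteq> mi_below K" using F by (auto simp: K_def mi_below_def less_Suc_eq_le)
      then have "sum ?f F \<le> sum ?f (mi_below K)" using f0 by (intro sum_mono2 finite_mi_below)
      also have "\<dots> \<le> (\<Sum>k<K. B * (\<rho>\<^sup>2) ^ k)" unfolding sum_mi_below by (intro sum_mono part)
      also have "\<dots> \<le> (\<Sum>k. B * (\<rho>\<^sup>2) ^ k)" using B0 by (intro sum_le_suminf geo) auto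
      finally show "sum ?f F \<le> (\<Sum>k. B * (\<rho>\<^sup>2) ^ k)" .
    qed
  qed (use f0 in auto)
  then show ?thesis unfolding ell2_def mem_Collect_eq sq .
qed

lemma pseries_add:
  assumes "admissible a" "admissible b"
  shows "pseries (\<lambda>m. a m + b m) = (\<lambda>z. pseries a z + pseries b z)"
proof
  fix z
  have "hpart (\<lambda>m. a m + b m) k z = hpart a k z + hpart b k z" for k
    by (simp add: hpart_def mi_poly_def distrib_right sum.distrib)
  then show "pseries (\<lambda>m. a m + b m) z = pseries a z + pseries b z"
    using sums_add[OF pseries_sums[OF assms(1)] pseries_sums[OF assms(2)], of z]
    by (cases "z \<in> unit_ball") (simp_all add: pseries_def unit_ball_def sums_iff)
qed

lemma pseries_scale:
  assumes "admissible a"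
  shows "pseries (\<lambda>m. x * a m) = (\<lambda>z. x * pseries a z)"
proof
  fix z
  have "hpart (\<lambda>m. x * a m) k z = x * hpart a k z" for k
    by (simp add: hpart_def mi_poly_def sum_distrib_left mult.assoc)
  then show "pseries (\<lambda>m. x * a m) z = x * pseries a z"
    using sums_mult[OF pseries_sums[OF assms], of z x]
    by (cases "z \<in> unit_ball") (simp_all add: pseries_def unit_ball_def sums_iff)
qed

text \<open>
  Links the two modes of summation: the inner product sums over all multi-indices without order, the
  power series by degree.
\<close>

lemma pseries_eq_infsum:
  fixes a :: "'n::finite multi_index \<Rightarrow> complex"
  assumes a: "admissible a" and z: "norm z < 1" and s: "(\<lambda>m. a m * mi_power z m) summable_on UNIV"
  shows "pseries a z = (\<Sum>\<^sub>\<infinity>m. a m * mi_power z m)"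
proof -
  have "filterlim (mi_below :: nat \<Rightarrow> 'n multi_index set) (finite_subsets_at_top UNIV) sequentially"
    unfolding filterlim_finite_subsets_at_top
  proof (intro allI impI)
    fix X :: "'n multi_index set" assume X: "finite X \<and> X \<subseteq> UNIV"
    show "\<forall>\<^sub>F K in sequentially. finite (mi_below K :: 'n multi_index set) \<and> X \<subseteq> mi_below K \<and> mi_below K \<subseteq> UNIV"
    proof (rule eventually_mono[OF eventually_ge_at_top[of "Suc (Max (mi_deg ` X))"]])
      fix K assume K: "Suc (Max (mi_deg ` X)) \<le> K"
      have "mi_deg m < K" if "m \<in> X" for m
      proof -
        have "mi_deg m \<le> Max (mi_deg ` X)" using X that by (intro Max_ge) auto
        then show ?thesis using K by simp
      qed
      then show "finite (mi_below K :: 'n multi_index set) \<and> X \<subseteq> mi_below K \<and> mi_below K \<subseteq> UNIV"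
        using finite_mi_below[of K, where 'n='n] by (auto simp: mi_below_def)
    qed
  qed
  with has_sum_infsum[OF s] have "(\<lambda>K. sum (\<lambda>m. a m * mi_power z m) (mi_below K)) \<longlonglongrightarrow> (\<Sum>\<^sub>\<infinity>m. a m * mi_power z m)"
    unfolding has_sum_def by (rule filterlim_compose)
  moreover have "(\<lambda>K. sum (\<lambda>m. a m * mi_power z m) (mi_below K)) \<longlonglongrightarrow> pseries a z"
    using pseries_sums[OF a z] by (simp add: sums_def mi_poly_mi_below[symmetric] mi_poly_def)
  ultimately show ?thesis by (rule LIMSEQ_unique[symmetric])
qed

theorem theorem44:
  fixes \<alpha> :: real and N :: nat and A :: "nat \<Rightarrow> real" and \<omega> :: "'n::finite multi_index \<Rightarrow> real"
  assumes "N > 0"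
    and "real CARD('n) + 1 + \<alpha> = - real N"
    and "\<And>z. norm z < 1 \<Longrightarrow> (\<lambda>k. complex_of_real (A k) * z ^ k) sums log_fun N z"
    and "\<And>m. mi_deg m \<le> N \<Longrightarrow> \<omega> m > - (fact (mi_deg m) * A (mi_deg m) / mi_fact m)"
  shows "\<exists>ip. has_reproducing_kernel (A2 \<alpha> :: (complex ^ 'n \<Rightarrow> complex) set) ip (K_ker N \<omega>)"
proof -
  define c where "c = kernel_coeff N \<omega> A"
  have pos: "c m > 0" for m
    unfolding c_def by (rule kernel_coeff_pos[OF assms(3,4)])
  have large: "c m = fact N * fact (mi_deg m - N - 1) / mi_fact m" if "mi_deg m > N" for m
    unfolding c_def by (rule kernel_coeff_large[OF assms(3) that])
  obtain B where B: "B \<ge> 0" "\<And>k z. norm z \<le> 1 \<Longrightarrow> (\<Sum>m | mi_deg m = k. c m * (norm (mi_power z m))\<^sup>2) \<le> B"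
    using kernel_coeff_sum_bounded[OF large pos] by blast
  \<comment> \<open>Multiplication by \<open>r\<close> turns the weight \<open>1 / c\<close> into the constant weight of \<open>ell2\<close>.\<close>
  define r where "r = (\<lambda>m. complex_of_real (sqrt (c m)))"
  have r0: "r m \<noteq> 0" for m using pos[of m] by (simp add: r_def)
  have rr: "r m * r m = complex_of_real (c m)" for m
    using pos[of m] by (simp add: r_def flip: of_real_mult)
  define \<Phi> where "\<Phi> = (\<lambda>u. pseries (\<lambda>m. r m * u m))"
  have adm: "admissible (\<lambda>m. r m * u m)" if "u \<in> ell2" for u
    unfolding r_def by (rule weighted_ell2_admissible[OF pos B(2) that])
  have norm_r: "(norm (r m * x))\<^sup>2 / c m = (norm x)\<^sup>2" for m x
    using pos[of m] by (simp add: r_def norm_mult power_mult_distrib less_imp_le)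
  have A2: "A2 \<alpha> = \<Phi> ` ell2"
  proof (subst A2_eq_weighted_pseries[OF assms(2) large pos], assumption, intro subset_antisym subsetI)
    fix f :: "complex ^ 'n \<Rightarrow> complex"
    assume "f \<in> {pseries a | a. admissible a \<and> (\<lambda>m. (norm (a m))\<^sup>2 / c m) summable_on UNIV}"
    then obtain a where f: "f = pseries a" and a: "(\<lambda>m. (norm (a m))\<^sup>2 / c m) summable_on UNIV" by blast
    have ra: "r m * (a m / r m) = a m" for m using r0 by simp
    have "(norm (a m / r m))\<^sup>2 = (norm (a m))\<^sup>2 / c m" for m
      using norm_r[of m "a m / r m"] unfolding ra by simp
    then have "(\<lambda>m. a m / r m) \<in> ell2" using a by (simp add: ell2_def)
    moreover have "f = \<Phi> (\<lambda>m. a m / r m)" unfolding \<Phi>_def ra by (rule f)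
    ultimately show "f \<in> \<Phi> ` ell2" by blast
  next
    fix f :: "complex ^ 'n \<Rightarrow> complex" assume "f \<in> \<Phi> ` ell2"
    then obtain u where u: "u \<in> ell2" "f = \<Phi> u" by blast
    have "(\<lambda>m. (norm (r m * u m))\<^sup>2 / c m) summable_on UNIV" using u(1) unfolding norm_r by (simp add: ell2_def)
    then show "f \<in> {pseries a | a. admissible a \<and> (\<lambda>m. (norm (a m))\<^sup>2 / c m) summable_on UNIV}"
      using adm[OF u(1)] u(2) unfolding \<Phi>_def by blast
  qed
  have inj: "inj_on \<Phi> ell2"
  proof (rule inj_onI)
    fix u v assume "u \<in> ell2" "v \<in> ell2" "\<Phi> u = \<Phi> v"
    then have "(\<lambda>m. r m * u m) = (\<lambda>m. r m * v m)" unfolding \<Phi>_def by (intro pseries_injective adm)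
    then have "r m * u m = r m * v m" for m by (rule fun_cong)
    then show "u = v" using r0 by (intro ext) simp
  qed
  have hilbert: "hilbert_space_on (\<Phi> ` ell2) (transported_inner \<Phi>)"
  proof (rule hilbert_space_on_ell2_image[OF inj])
    fix u v :: "'n multi_index \<Rightarrow> complex" assume "u \<in> ell2" "v \<in> ell2"
    then show "\<Phi> (\<lambda>i. u i + v i) = (\<lambda>x. \<Phi> u x + \<Phi> v x)"
      unfolding \<Phi>_def distrib_left by (intro pseries_add adm)
  next
    fix x :: complex and u :: "'n multi_index \<Rightarrow> complex" assume "u \<in> ell2"
    then show "\<Phi> (\<lambda>i. x * u i) = (\<lambda>z. x * \<Phi> u z)"
      unfolding \<Phi>_def mult.left_commute[of "r _" x] by (intro pseries_scale adm)
  qed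
  have kernel: "zero_ext (\<lambda>z. K_ker N \<omega> z w) \<in> \<Phi> ` ell2 \<and>
      (\<forall>f\<in>\<Phi> ` ell2. f w = transported_inner \<Phi> f (zero_ext (\<lambda>z. K_ker N \<omega> z w)))"
    if "w \<in> unit_ball" for w
  proof -
    have w: "norm w < 1" using that by (simp add: unit_ball_def)
    \<comment> \<open>The \<open>ell2\<close> sequence that represents evaluation at \<open>w\<close>.\<close>
    define \<kappa> where "\<kappa> = (\<lambda>m. r m * cnj (mi_power w m))"
    have \<kappa>: "\<kappa> \<in> ell2"
      unfolding \<kappa>_def r_def by (rule weighted_monomials_ell2[OF pos B w])
    have coeff: "r m * \<kappa> m = of_real (kernel_coeff N \<omega> A m) * mi_power (cnj_vec w) m" for m
      unfolding \<kappa>_def mi_power_cnj_vec mult.assoc[symmetric] rr c_def ..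
    have K: "zero_ext (\<lambda>z. K_ker N \<omega> z w) = \<Phi> \<kappa>"
    proof
      fix z
      show "zero_ext (\<lambda>z. K_ker N \<omega> z w) z = \<Phi> \<kappa> z"
      proof (cases "z \<in> unit_ball")
        case True
        then have z: "norm z < 1" by (simp add: unit_ball_def)
        show ?thesis
          using sums_unique[OF K_ker_expansion[OF assms(3) z w, of \<omega>]] True
          by (simp add: zero_ext_def \<Phi>_def pseries_def coeff)
      qed (simp add: zero_ext_def \<Phi>_def pseries_def)
    qed
    have "\<Phi> u w = transported_inner \<Phi> (\<Phi> u) (\<Phi> \<kappa>)" if u: "u \<in> ell2" for u
    proof -
      have summand: "u m * cnj (\<kappa> m) = (r m * u m) * mi_power w m" for m
        by (simp add: \<kappa>_def r_def mult_ac)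
      have "(\<lambda>m. (r m * u m) * mi_power w m) summable_on UNIV"
        using ell2_prod_summable[OF u \<kappa>] unfolding summand .
      then have "\<Phi> u w = (\<Sum>\<^sub>\<infinity>m. (r m * u m) * mi_power w m)"
        unfolding \<Phi>_def by (rule pseries_eq_infsum[OF adm[OF u] w])
      also have "\<dots> = ell2_inner u \<kappa>" unfolding ell2_inner_def summand ..
      also have "\<dots> = transported_inner \<Phi> (\<Phi> u) (\<Phi> \<kappa>)" by (rule transported_inner_eq[OF inj u \<kappa>, symmetric])
      finally show ?thesis .
    qed
    then show ?thesis unfolding K using \<kappa> by blast
  qed
  show ?thesis
    unfolding has_reproducing_kernel_def A2 using hilbert kernel by blast
qed

end
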